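(* The values of $(\operatorname{endapp}(G),\operatorname{affapp}(G))$ for the finite groups $G$ with $|G|\leq 15$ (up to isomorphism) are as follows. - $\{1\}$: $(1,1)$. - $\mathbb{Z}/2\mathbb{Z}$: $(1,2)$. - $\mathbb{Z}/3\mathbb{Z}$: $(1,2)$. - $\mathbb{Z}/4\mathbb{Z}$: $(1,2)$. - $(\mathbb{Z}/2\mathbb{Z})^2$: $(2,3)$. - $\mathbb{Z}/5\mathbb{Z}$: $(1,2)$. - $\mathrm{D}_6$: $(0,2)$. - $\mathbb{Z}/6\mathbb{Z}$: $(1,2)$. - $\mathbb{Z}/7\mathbb{Z}$: $(1,2)$. - $\mathbb{Z}/8\mathbb{Z}$: $(1,2)$. - $\mathbb{Z}/4\mathbb{Z}\times\mathbb{Z}/2\mathbb{Z}$: $(1,2)$. - $\mathrm{D}_8$: $(1,2)$. - $\mathrm{Dic}_8$: $(1,3)$. - $(\mathbb{Z}/2\mathbb{Z})^3$: $(3,4)$. - $\mathbb{Z}/9\mathbb{Z}$: $(1,2)$. - $(\mathbb{Z}/3\mathbb{Z})^2$: $(2,3)$. - $\mathrm{D}_{10}$: $(0,2)$. - $\mathbb{Z}/10\mathbb{Z}$: $(1,2)$. - $\mathbb{Z}/11\mathbb{Z}$: $(1,2)$. - $\mathrm{Dic}_{12}$: $(0,2)$. - $\mathbb{Z}/12\mathbb{Z}$: $(1,2)$. - $\mathrm{Alt}(4)$: $(0,3)$. - $\mathrm{D}_{12}$: $(1,3)$. - $\mathbb{Z}/6\mathbb{Z}\times\mathbb{Z}/2\mathbb{Z}$: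 $(1,3)$. - $\mathbb{Z}/13\mathbb{Z}$: $(1,2)$. - $\mathrm{D}_{14}$: $(0,2)$. - $\mathbb{Z}/14\mathbb{Z}$: $(1,2)$. - $\mathbb{Z}/15\mathbb{Z}$: $(1,2)$.
   Context: $\mathrm{D}_{2n}$ denotes the dihedral group of order $2n$, $\mathrm{Dic}_{4n}$ the dicyclic group of order $4n$ (so $\mathrm{Dic}_8$ is the quaternion group of order $8$), and $\mathrm{Alt}(4)$ the alternating group of degree $4$. For a group $G$, $\operatorname{End}(G)$ is the set of group endomorphisms of $G$, and $\operatorname{Aff}(G)$ is the set of affine maps on $G$, i.e. the functions $A_{g,\varphi}:G\to G$, $x\mapsto g\varphi(x)$, with $g\in G$ and $\varphi\in\operatorname{End}(G)$. For a finite group $G$ and a function $f:G\to G$, set $\operatorname{endapp}(f):=\max_{\varphi\in\operatorname{End}(G)}|\{x\in G: \varphi(x)=f(x)\}|$ and $\operatorname{affapp}(f):=\max_{A\in\operatorname{Aff}(G)}|\{x\in G: A(x)=f(x)\}|$. Set $\operatorname{endapp}(G):=\min_{f:G\to G}\operatorname{endapp}(f)$ and $\operatorname{affapp}(G):=\min_{f:G\to G}\operatorname{affapp}(f)$. *)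

theory Defs
  imports "HOL-Algebra.Algebra"
begin

definition affine_maps :: "('a, 'b) monoid_scheme \<Rightarrow> ('a \<Rightarrow> 'a) set" where
  "affine_maps G = {A. \<exists>g \<in> carrier G. \<exists>\<phi> \<in> hom G G. A = (\<lambda>x. g \<otimes>\<^bsub>G\<^esub> \<phi> x)}"

definition agreement :: "('a, 'b) monoid_scheme \<Rightarrow> ('a \<Rightarrow> 'a) \<Rightarrow> ('a \<Rightarrow> 'a) \<Rightarrow> nat" where
  "agreement G h f = card {x \<in> carrier G. h x = f x}"

(* The index sets of MAX and MIN below may be infinite, as functions on the carrier are represented
   by total functions; the sets of values are nevertheless finite and nonempty when G is a finite
   group (see the lemmas below). *)

definition endapp_fun :: "('a, 'b) monoid_scheme \<Rightarrow> ('a \<Rightarrow> 'a) \<Rightarrow> nat" where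
  "endapp_fun G f = (MAX \<phi> \<in> hom G G. agreement G \<phi> f)"

definition affapp_fun :: "('a, 'b) monoid_scheme \<Rightarrow> ('a \<Rightarrow> 'a) \<Rightarrow> nat" where
  "affapp_fun G f = (MAX A \<in> affine_maps G. agreement G A f)"

definition endapp :: "('a, 'b) monoid_scheme \<Rightarrow> nat" where
  "endapp G = (MIN f \<in> carrier G \<rightarrow> carrier G. endapp_fun G f)"

definition affapp :: "('a, 'b) monoid_scheme \<Rightarrow> nat" where
  "affapp G = (MIN f \<in> carrier G \<rightarrow> carrier G. affapp_fun G f)"

(* Dihedral group of order 2n (so D_6 is dihedral 3), for n > 0: the presentation
   r^n = s^2 = 1, s r s = r^(-1), with (i, a) standing for r^i if not a and for r^i s if a. *)
definition dihedral :: "nat \<Rightarrow> (int \<times> bool) monoid" where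
  "dihedral n = \<lparr>carrier = {0..<int n} \<times> UNIV,
     monoid.mult = (\<lambda>(i, a) (j, b). ((if a then i - j else i + j) mod int n, a \<noteq> b)),
     one = (0, False)\<rparr>"

(* Dicyclic group of order 4n (so Dic_8 is dicyclic 2), for n > 0: the presentation
   r^(2n) = 1, s^2 = r^n, s^(-1) r s = r^(-1), with (i, a) standing for r^i if not a and for
   r^i s if a. The summand n accounts for s^2 = r^n. *)
definition dicyclic :: "nat \<Rightarrow> (int \<times> bool) monoid" where
  "dicyclic n = \<lparr>carrier = {0..<2 * int n} \<times> UNIV,
     monoid.mult = (\<lambda>(i, a) (j, b).
       (((if a then i - j else i + j) + (if a \<and> b then int n else 0)) mod (2 * int n), a \<noteq> b)),
     one = (0, False)\<rparr>"

lemma finite_agreements: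
  assumes "finite (carrier G)"
  shows "finite ((\<lambda>h. agreement G h f) ` H)"
proof (rule finite_subset)
  show "(\<lambda>h. agreement G h f) ` H \<subseteq> {..order G}"
    unfolding agreement_def order_def using assms by (auto intro: card_mono)
qed simp

lemma hom_self_nonempty: "id \<in> hom G G"
  by (auto simp: hom_def)

lemma (in group) affine_maps_nonempty: "(\<lambda>x. \<one> \<otimes> x) \<in> affine_maps G"
  unfolding affine_maps_def using hom_self_nonempty[of G] one_closed
  by (intro CollectI bexI[of _ "\<one>"] bexI[of _ id]) auto

lemma
  assumes "group G" "finite (carrier G)"
  shows finite_endapp_funs: "finite (endapp_fun G ` F)"
    and finite_affapp_funs: "finite (affapp_fun G ` F)"
proof -
  have le: "agreement G h f \<le> order G" for h f
    unfolding agreement_def order_def using assms by (auto intro: card_mono)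
  have "endapp_fun G f \<le> order G" for f
    unfolding endapp_fun_def using finite_agreements[OF assms(2)] hom_self_nonempty[of G] le
    by (subst Max_le_iff) auto
  moreover have "affapp_fun G f \<le> order G" for f
    unfolding affapp_fun_def
    using finite_agreements[OF assms(2)] group.affine_maps_nonempty[OF assms(1)] le
    by (subst Max_le_iff) auto
  ultimately show "finite (endapp_fun G ` F)" "finite (affapp_fun G ` F)"
    by (auto intro!: finite_subset[of _ "{..order G}"])
qed

lemma order_dihedral: "order (dihedral n) = 2 * n"
  by (simp add: order_def dihedral_def card_cartesian_product)

lemma order_dicyclic: "order (dicyclic n) = 4 * n"
  by (simp add: order_def dicyclic_def card_cartesian_product)

lemma group_dihedral:
  assumes "n > 0"
  shows "group (dihedral n)"
proof (rule groupI)
  fix x assume x: "x \<in> carrier (dihedral n)"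
  obtain i a where [simp]: "x = (i, a)" by force
  show "\<exists>y \<in> carrier (dihedral n). y \<otimes>\<^bsub>dihedral n\<^esub> x = \<one>\<^bsub>dihedral n\<^esub>"
    using x assms
    by (intro bexI[of _ "(if a then i else (- i) mod int n, a)"])
       (auto simp: dihedral_def mod_simps)
qed (use assms in \<open>auto simp: dihedral_def mod_simps algebra_simps split: if_splits\<close>)

lemma group_dicyclic:
  assumes "n > 0"
  shows "group (dicyclic n)"
proof (rule groupI)
  fix x assume x: "x \<in> carrier (dicyclic n)"
  obtain i a where [simp]: "x = (i, a)" by force
  have "((i + int n) mod (2 * int n) + (int n - i)) mod (2 * int n) = 0"
    by (simp add: mod_add_left_eq)
  then have *: "((i + int n) mod (2 * int n) - i + int n) mod (2 * int n) = 0"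
    by (simp add: algebra_simps)
  show "\<exists>y \<in> carrier (dicyclic n). y \<otimes>\<^bsub>dicyclic n\<^esub> x = \<one>\<^bsub>dicyclic n\<^esub>"
    using x assms
    by (intro bexI[of _ "(if a then (i + int n) mod (2 * int n) else (- i) mod (2 * int n), a)"])
       (use * in \<open>auto simp: dicyclic_def mod_simps\<close>)
next
  fix x y z
  assume "x \<in> carrier (dicyclic n)" "y \<in> carrier (dicyclic n)" "z \<in> carrier (dicyclic n)"
  obtain i a j b k c where [simp]: "x = (i, a)" "y = (j, b)" "z = (k, c)" by (metis surj_pair)
  have *: "(i - (j - k + int n)) mod (2 * int n) = (i - j + int n + k) mod (2 * int n)"
  proof -
    have "i - j + int n + k = (i - (j - k + int n)) + 2 * int n" by simp
    then show ?thesis by (metis mod_add_self2)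
  qed
  have **: "(int n + u mod (int n * 2) - k) mod (int n * 2) = (int n + u - k) mod (int n * 2)" for u
    by (metis mod_add_right_eq mod_diff_left_eq)
  show "x \<otimes>\<^bsub>dicyclic n\<^esub> y \<otimes>\<^bsub>dicyclic n\<^esub> z = x \<otimes>\<^bsub>dicyclic n\<^esub> (y \<otimes>\<^bsub>dicyclic n\<^esub> z)"
    using * by (cases a; cases b; cases c) (simp_all add: dicyclic_def mod_simps algebra_simps **)
qed (use assms in \<open>auto simp: dicyclic_def\<close>)

end

theory Submission
  imports Defs
begin

text \<open>Groups of order at most 15 are classified by Sylow's existence theorem and by counting the
  double coset of a subgroup of prime order; each one is identified with its model through a
  homomorphism out of the model whose image has too many elements to be proper.

  The upper bounds on \<open>endapp\<close> and \<open>affapp\<close> are witnessed by explicit functions, found by computer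
  search, whose agreement with all endomorphisms is counted by evaluation: an endomorphism is
  determined by the images of the generators, and \<open>f\<close> agrees with \<open>x \<mapsto> g \<phi>(x)\<close> exactly where
  \<open>f(x) \<phi>(x)\<^sup>-\<^sup>1 = g\<close>.

  For the lower bounds one looks for two or three points at which a given function agrees with an
  affine map. If every map from a set \<open>E\<close> of nontrivial elements extends to an endomorphism, then
  \<open>endapp \<ge> |E|\<close> and \<open>affapp \<ge> |E| + 1\<close>. In the remaining cases the pigeonhole principle yields
  points whose values are related by an endomorphism; those endomorphisms factor through small
  quotients or are automorphisms.\<close>

section \<open>Approximability and agreement\<close>

text \<open>Isomorphisms carry affine maps to affine maps, so both invariants are computed in fixed
  models. The delicate values are the pairs (1,3) and (0,3), at Dic8, D12, Z6 x Z2 and Alt(4): a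
  third point of agreement is wanted, although a free set of two elements is impossible, as it would
  force \<open>endapp\<close> to be at least 2. The points must therefore depend on the given
  function. In the three nonabelian cases the absence of a triple restricts the values coset by
  coset, modulo the center in Dic8 and D12 and modulo the normal four-group in Alt(4), until
  counting gives a contradiction. Constant maps are affine, so repeated values count as agreement.
  In Z6 x Z2 the pigeonhole principle is applied to the four elements of order at most 2 and yields
  two points to which a third can be freely added. In the classification, a subgroup of prime order
  \<open>p\<close> that is not normal forces at least \<open>p^2 + p\<close> elements. This exceeds
  the order of the group wherever it is used, except for order 12 and \<open>p = 3\<close>, where
  equality holds and singles out Alt(4).\<close>

lemma endapp_le:
  assumes "group G" "finite (carrier G)" "f \<in> carrier G \<rightarrow> carrier G"
    and "\<And>\<phi>. \<phi> \<in> hom G G \<Longrightarrow> agreement G \<phi> f \<le> k"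
  shows "endapp G \<le> k"
proof -
  have "endapp G \<le> endapp_fun G f"
    unfolding endapp_def using assms by (intro Min_le finite_endapp_funs) auto
  also have "\<dots> \<le> k"
    unfolding endapp_fun_def using assms finite_agreements[OF assms(2)] hom_self_nonempty[of G]
    by (subst Max_le_iff) auto
  finally show ?thesis .
qed

lemma affapp_le:
  assumes "group G" "finite (carrier G)" "f \<in> carrier G \<rightarrow> carrier G"
    and "\<And>g \<phi>. g \<in> carrier G \<Longrightarrow> \<phi> \<in> hom G G \<Longrightarrow> agreement G (\<lambda>x. g \<otimes>\<^bsub>G\<^esub> \<phi> x) f \<le> k"
  shows "affapp G \<le> k"
proof -
  have "affapp G \<le> affapp_fun G f"
    unfolding affapp_def using assms by (intro Min_le finite_affapp_funs) auto
  also have "\<dots> \<le> k"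
    unfolding affapp_fun_def
    using assms finite_agreements[OF assms(2)] group.affine_maps_nonempty[OF assms(1)]
    by (subst Max_le_iff) (auto simp: affine_maps_def)
  finally show ?thesis .
qed

lemma endapp_geI:
  assumes "group G" "finite (carrier G)"
    and "\<And>f. f \<in> carrier G \<rightarrow> carrier G \<Longrightarrow> \<exists>\<phi>\<in>hom G G. k \<le> agreement G \<phi> f"
  shows "k \<le> endapp G"
  unfolding endapp_def
proof (subst Min_ge_iff)
  show "\<forall>m\<in>endapp_fun G ` (carrier G \<rightarrow> carrier G). k \<le> m"
  proof clarify
    fix f assume "f \<in> carrier G \<rightarrow> carrier G"
    then obtain \<phi> where "\<phi> \<in> hom G G" "k \<le> agreement G \<phi> f" using assms(3) by blast
    then show "k \<le> endapp_fun G f"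
      unfolding endapp_fun_def using finite_agreements[OF assms(2)]
      by (meson Max_ge imageI order_trans)
  qed
qed (use assms finite_endapp_funs in auto)

lemma affapp_geI:
  assumes "group G" "finite (carrier G)"
    and "\<And>f. f \<in> carrier G \<rightarrow> carrier G \<Longrightarrow>
      \<exists>g\<in>carrier G. \<exists>\<phi>\<in>hom G G. k \<le> agreement G (\<lambda>x. g \<otimes>\<^bsub>G\<^esub> \<phi> x) f"
  shows "k \<le> affapp G"
  unfolding affapp_def
proof (subst Min_ge_iff)
  show "\<forall>m\<in>affapp_fun G ` (carrier G \<rightarrow> carrier G). k \<le> m"
  proof clarify
    fix f assume "f \<in> carrier G \<rightarrow> carrier G"
    then obtain A where "A \<in> affine_maps G" "k \<le> agreement G A f"
      using assms(3) unfolding affine_maps_def by blast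
    then show "k \<le> affapp_fun G f"
      unfolding affapp_fun_def using finite_agreements[OF assms(2)]
      by (meson Max_ge imageI order_trans)
  qed
qed (use assms finite_affapp_funs in auto)

lemma endapp_geD:
  assumes "group G" "finite (carrier G)" "f \<in> carrier G \<rightarrow> carrier G"
  obtains \<phi> where "\<phi> \<in> hom G G" "endapp G \<le> agreement G \<phi> f"
proof -
  have "\<exists>\<phi>\<in>hom G G. \<not> agreement G \<phi> f < endapp G"
  proof (rule ccontr)
    assume *: "\<not> ?thesis"
    \<comment> \<open>Applied to \<open>id\<close>, the negated claim makes \<open>endapp G\<close>
      positive, so \<open>endapp G - 1\<close> is a true decrease on natural numbers.\<close>
    then have "endapp G > 0" using hom_self_nonempty[of G] by force
    with * endapp_le[OF assms, of "endapp G - 1"] show False by force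
  qed
  then show ?thesis using that by force
qed

lemma affapp_geD:
  assumes "group G" "finite (carrier G)" "f \<in> carrier G \<rightarrow> carrier G"
  obtains g \<phi> where "g \<in> carrier G" "\<phi> \<in> hom G G"
    "affapp G \<le> agreement G (\<lambda>x. g \<otimes>\<^bsub>G\<^esub> \<phi> x) f"
proof -
  interpret group G by fact
  have "\<exists>g\<in>carrier G. \<exists>\<phi>\<in>hom G G. \<not> agreement G (\<lambda>x. g \<otimes>\<^bsub>G\<^esub> \<phi> x) f < affapp G"
  proof (rule ccontr)
    assume *: "\<not> ?thesis"
    then have "affapp G > 0" using hom_self_nonempty[of G] by force
    with * affapp_le[OF assms, of "affapp G - 1"] show False by force
  qed
  then show ?thesis using that by force
qed

text \<open>Conjugation by \<open>h\<close>, with inverse \<open>k\<close>, turns affine maps of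
  \<open>G\<close> into affine maps of \<open>M\<close>. A function \<open>F\<close> on
  \<open>M\<close> is pulled back to \<open>k \<circ> F \<circ> h\<close>, and the agreement sets
  correspond under \<open>h\<close>. Exchanging the two groups gives the other inequality.\<close>

lemma app_le_iso:
  assumes G: "group G" "finite (carrier G)" and "group M" and iso: "G \<cong> M"
  shows "endapp G \<le> endapp M" and "affapp G \<le> affapp M"
proof -
  interpret G: group G by fact
  interpret M: group M by fact
  obtain h where h: "h \<in> iso G M" using iso by (auto simp: is_iso_def)
  define k where "k = inv_into (carrier G) h"
  have bij: "bij_betw h (carrier G) (carrier M)" using h by (auto simp: iso_def)
  have fin: "finite (carrier M)" using iso_finite[OF iso] assms by blast
  have k: "k \<in> iso M G" unfolding k_def using G.iso_set_sym[OF h] .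
  have hom: "h \<in> hom G M" "k \<in> hom M G" using h k by (auto simp: iso_def)
  have kh: "k (h x) = x" if "x \<in> carrier G" for x
    unfolding k_def using that bij by (simp add: bij_betw_def)
  have hk: "h (k x) = x" if "x \<in> carrier M" for x
    unfolding k_def using that bij by (simp add: bij_betw_def f_inv_into_f)
  have conj_hom: "(\<lambda>x. h (\<phi> (k x))) \<in> hom M M" if "\<phi> \<in> hom G G" for \<phi>
    using hom_compose[OF hom_compose[OF hom(2) that] hom(1)] by (simp add: comp_def)
  have pull: "(\<lambda>x. k (F (h x))) \<in> carrier G \<rightarrow> carrier G" if "F \<in> carrier M \<rightarrow> carrier M" for F
    using that hom by (auto simp: hom_def Pi_iff)
  have agr: "agreement G A (\<lambda>x. k (F (h x))) = agreement M (\<lambda>x. h (A (k x))) F"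
    if "F \<in> carrier M \<rightarrow> carrier M" "A \<in> carrier G \<rightarrow> carrier G" for F A
    unfolding agreement_def
  proof (rule bij_betw_same_card[of h], rule bij_betw_byWitness[of _ k])
    show "h ` {x \<in> carrier G. A x = k (F (h x))} \<subseteq> {x \<in> carrier M. h (A (k x)) = F x}"
      "k ` {x \<in> carrier M. h (A (k x)) = F x} \<subseteq> {x \<in> carrier G. A x = k (F (h x))}"
      using that hom by (auto simp: kh hk hom_def Pi_iff) (metis kh)+
  qed (auto simp: kh hk)
  show "endapp G \<le> endapp M"
  proof (rule endapp_geI[OF assms(3) fin])
    fix F assume F: "F \<in> carrier M \<rightarrow> carrier M"
    obtain \<phi> where "\<phi> \<in> hom G G" "endapp G \<le> agreement G \<phi> (\<lambda>x. k (F (h x)))"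
      using endapp_geD[OF G pull[OF F]] .
    then show "\<exists>\<phi>\<in>hom M M. endapp G \<le> agreement M \<phi> F"
      using agr[OF F, of \<phi>] conj_hom[of \<phi>]
      by (intro bexI[of _ "\<lambda>x. h (\<phi> (k x))"]) (auto simp: hom_def)
  qed
  show "affapp G \<le> affapp M"
  proof (rule affapp_geI[OF assms(3) fin])
    fix F assume F: "F \<in> carrier M \<rightarrow> carrier M"
    obtain g \<phi> where *: "g \<in> carrier G" "\<phi> \<in> hom G G"
      "affapp G \<le> agreement G (\<lambda>x. g \<otimes>\<^bsub>G\<^esub> \<phi> x) (\<lambda>x. k (F (h x)))"
      using affapp_geD[OF G pull[OF F]] .
    have "agreement G (\<lambda>x. g \<otimes>\<^bsub>G\<^esub> \<phi> x) (\<lambda>x. k (F (h x)))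
        = agreement M (\<lambda>x. h (g \<otimes>\<^bsub>G\<^esub> \<phi> (k x))) F"
      using * by (intro agr F) (auto simp: hom_def Pi_iff)
    also have "\<dots> = agreement M (\<lambda>x. h g \<otimes>\<^bsub>M\<^esub> h (\<phi> (k x))) F"
      unfolding agreement_def using * hom
      by (intro arg_cong[of _ _ card] Collect_cong conj_cong refl)
        (simp add: hom_def Pi_iff)
    finally show "\<exists>g\<in>carrier M. \<exists>\<phi>\<in>hom M M. affapp G \<le> agreement M (\<lambda>x. g \<otimes>\<^bsub>M\<^esub> \<phi> x) F"
      using * conj_hom[of \<phi>] hom(1)
      by (intro bexI[of _ "h g"] bexI[of _ "\<lambda>x. h (\<phi> (k x))"]) (auto simp: hom_in_carrier)
  qed
qed

lemma app_iso:
  assumes "group G" "finite (carrier G)" "group M" "G \<cong> M"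
  shows "endapp G = endapp M" and "affapp G = affapp M"
  using app_le_iso[OF assms] app_le_iso[of M G] assms iso_finite[OF assms(4)] group.iso_sym[of G M]
  by (auto intro: antisym)

lemma agreement_geI:
  assumes "finite (carrier G)" "E \<subseteq> carrier G" "card E = n" "\<And>x. x \<in> E \<Longrightarrow> h x = f x"
  shows "n \<le> agreement G h f"
  unfolding agreement_def using assms card_mono[of "{x \<in> carrier G. h x = f x}" E] by auto

text \<open>Divide \<open>f\<close> on the left by its value at \<open>\<one>\<close> and extend the
  quotient from \<open>E\<close> to an endomorphism. Translating back by that value gives agreement
  on \<open>E\<close> and at \<open>\<one>\<close>, a new point because \<open>\<one>\<close> is
  outside \<open>E\<close>.\<close>

lemma free_set_le_app:
  assumes "group G" "finite (carrier G)" "E \<subseteq> carrier G" "card E = n" "\<one>\<^bsub>G\<^esub> \<notin> E"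
    and ext: "\<And>w. w \<in> E \<rightarrow> carrier G \<Longrightarrow> \<exists>\<phi>\<in>hom G G. \<forall>x\<in>E. \<phi> x = w x"
  shows "n \<le> endapp G" and "Suc n \<le> affapp G"
proof -
  interpret group G by fact
  show "n \<le> endapp G"
  proof (rule endapp_geI)
    fix f assume "f \<in> carrier G \<rightarrow> carrier G"
    then have "f \<in> E \<rightarrow> carrier G" using assms by auto
    then obtain \<phi> where "\<phi> \<in> hom G G" "\<forall>x\<in>E. \<phi> x = f x" using ext by blast
    then show "\<exists>\<phi>\<in>hom G G. n \<le> agreement G \<phi> f" using assms agreement_geI by metis
  qed fact+
  show "Suc n \<le> affapp G"
  proof (rule affapp_geI)
    fix f assume f: "f \<in> carrier G \<rightarrow> carrier G"
    interpret group G by fact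
    define w where "w x = inv\<^bsub>G\<^esub> (f \<one>\<^bsub>G\<^esub>) \<otimes>\<^bsub>G\<^esub> f x" for x
    have "w \<in> E \<rightarrow> carrier G" unfolding w_def using assms(3) f by (auto simp: Pi_iff)
    then obtain \<phi> where \<phi>: "\<phi> \<in> hom G G" "\<forall>x\<in>E. \<phi> x = w x" using ext by blast
    have "\<phi> \<one>\<^bsub>G\<^esub> = \<one>\<^bsub>G\<^esub>" using \<phi>(1) hom_one[OF \<phi>(1)] assms by auto
    then have "f \<one>\<^bsub>G\<^esub> \<otimes>\<^bsub>G\<^esub> \<phi> x = f x" if "x \<in> insert \<one>\<^bsub>G\<^esub> E" for x
      using that \<phi> f assms(3) unfolding w_def
      by (auto simp: Pi_iff m_assoc[symmetric] subset_iff)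
    moreover have "card (insert \<one>\<^bsub>G\<^esub> E) = Suc n"
      using assms by (simp add: finite_subset)
    ultimately show "\<exists>g\<in>carrier G. \<exists>\<phi>\<in>hom G G. Suc n \<le> agreement G (\<lambda>x. g \<otimes>\<^bsub>G\<^esub> \<phi> x) f"
      using assms(2,3) f \<phi>(1) agreement_geI[of G "insert \<one>\<^bsub>G\<^esub> E" "Suc n"]
      by (intro bexI[of _ "f \<one>\<^bsub>G\<^esub>"] bexI[of _ \<phi>]) auto
  qed fact+
qed

section \<open>Homomorphisms out of concrete groups\<close>

context group
begin

lemma int_pow_mod:
  assumes "x \<in> carrier G" "x [^] n = \<one>"
  shows "x [^] (i mod int n) = x [^] i"
proof -
  have "x [^] (int n * (i div int n)) = \<one>"
    using assms int_pow_pow[of x "int n" "i div int n"] by (simp add: int_pow_int)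
  then show ?thesis
    using assms int_pow_mult[of x "int n * (i div int n)" "i mod int n"] by simp
qed

lemma hom_integer_mod_group:
  assumes "x \<in> carrier G" "x [^] n = \<one>"
  shows "(\<lambda>i. x [^] i) \<in> hom (integer_mod_group n) G"
  using assms by (auto simp: hom_def int_pow_mod int_pow_mult)

lemma hom_DirProd:
  assumes "group H" "group K" and f: "f \<in> hom H G" and g: "g \<in> hom K G"
    and comm: "\<And>a b. a \<in> carrier H \<Longrightarrow> b \<in> carrier K \<Longrightarrow> g b \<otimes> f a = f a \<otimes> g b"
  shows "(\<lambda>(a, b). f a \<otimes> g b) \<in> hom (H \<times>\<times> K) G"
proof (rule homI)
  fix u v assume uv: "u \<in> carrier (H \<times>\<times> K)" "v \<in> carrier (H \<times>\<times> K)"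
  obtain a b c d where [simp]: "u = (a, b)" "v = (c, d)" by (metis surj_pair)
  have in_G: "f a \<in> carrier G" "f c \<in> carrier G" "g b \<in> carrier G" "g d \<in> carrier G"
    using uv f g by (auto simp: hom_def)
  have "f a \<otimes> f c \<otimes> (g b \<otimes> g d) = f a \<otimes> (f c \<otimes> g b) \<otimes> g d"
    using in_G by (simp add: m_assoc)
  also have "\<dots> = f a \<otimes> (g b \<otimes> f c) \<otimes> g d"
    using uv comm by simp
  also have "\<dots> = f a \<otimes> g b \<otimes> (f c \<otimes> g d)"
    using in_G by (simp add: m_assoc)
  finally show "(case u \<otimes>\<^bsub>H \<times>\<times> K\<^esub> v of (a, b) \<Rightarrow> f a \<otimes> g b)
    = (case u of (a, b) \<Rightarrow> f a \<otimes> g b) \<otimes> (case v of (a, b) \<Rightarrow> f a \<otimes> g b)"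
    using uv f g by (simp add: hom_mult)
qed (use f g in \<open>auto simp: hom_def\<close>)

text \<open>The relation passes from \<open>r\<close> to \<open>inv r\<close>; an induction on
  natural exponents, applied to both, covers all integers.\<close>

lemma twisted_commute_int_pow:
  assumes "r \<in> carrier G" "s \<in> carrier G" "s \<otimes> r = inv r \<otimes> s"
  shows "s \<otimes> r [^] (i::int) = r [^] (- i) \<otimes> s"
proof -
  have nat: "s \<otimes> x [^] n = inv x [^] n \<otimes> s"
    if "x \<in> carrier G" "s \<otimes> x = inv x \<otimes> s" for x and n :: nat
  proof (induction n)
    case (Suc n)
    have "s \<otimes> x [^] Suc n = inv x [^] n \<otimes> s \<otimes> x"
      using that assms(2) Suc by (simp add: m_assoc[symmetric])
    also have "\<dots> = inv x [^] n \<otimes> (inv x \<otimes> s)"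
      using that assms(2) by (simp add: m_assoc)
    also have "\<dots> = inv x [^] Suc n \<otimes> s"
      using that assms(2) by (simp add: m_assoc)
    finally show ?case .
  qed (use assms in simp)
  have "s \<otimes> inv r = r \<otimes> s"
  proof -
    have "r \<otimes> s = r \<otimes> (s \<otimes> r) \<otimes> inv r" using assms(1,2) by (simp add: m_assoc)
    also have "\<dots> = r \<otimes> (inv r \<otimes> s) \<otimes> inv r" using assms(3) by simp
    also have "\<dots> = s \<otimes> inv r" using assms(1,2) by (simp add: m_assoc[symmetric])
    finally show ?thesis by simp
  qed
  then have "s \<otimes> inv r [^] n = r [^] n \<otimes> s" for n :: nat
    using nat[of "inv r" n] assms by simp
  moreover have "s \<otimes> r [^] n = inv r [^] n \<otimes> s" for n :: nat
    using nat[of r n] assms by simp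
  ultimately show ?thesis
    using assms by (cases i rule: int_cases2) (auto simp: int_pow_int int_pow_neg_int nat_pow_inv)
qed

text \<open>One multiplication rule for two presentations: \<open>t = 0\<close> with modulus
  \<open>n\<close> is the dihedral case, \<open>t = n\<close> with modulus \<open>2n\<close> the
  dicyclic one. Moving \<open>s\<close> past a power of \<open>r\<close> inverts the power, and two
  factors \<open>s\<close> contribute \<open>r^t\<close>.\<close>

lemma twisted_mult:
  assumes "r \<in> carrier G" "s \<in> carrier G" "r [^] n = \<one>" "s \<otimes> s = r [^] (t::int)"
    and "s \<otimes> r = inv r \<otimes> s"
  shows "r [^] (((if a then i - j else i + j) + (if a \<and> b then t else 0)) mod int n) \<otimes>
      (if a \<noteq> b then s else \<one>)
    = (r [^] i \<otimes> (if a then s else \<one>)) \<otimes> (r [^] j \<otimes> (if b then s else \<one>))"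
proof (cases a)
  case True
  have "(r [^] i \<otimes> s) \<otimes> (r [^] j \<otimes> x) = r [^] i \<otimes> (s \<otimes> r [^] j) \<otimes> x"
    if "x \<in> carrier G" for x
    using assms that by (simp add: m_assoc)
  then have "(r [^] i \<otimes> s) \<otimes> (r [^] j \<otimes> x) = r [^] (i - j) \<otimes> (s \<otimes> x)"
    if "x \<in> carrier G" for x
    using assms that
    by (simp add: m_assoc[symmetric] twisted_commute_int_pow int_pow_mult[symmetric])
  then show ?thesis
    using assms True by (auto simp: int_pow_mod int_pow_mult)
next
  case False
  then show ?thesis
    using assms by (auto simp: int_pow_mod int_pow_mult m_assoc)
qed

lemma hom_dihedral:
  assumes "r \<in> carrier G" "s \<in> carrier G" "r [^] n = \<one>" "s \<otimes> s = \<one>"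
    and "s \<otimes> r = inv r \<otimes> s"
  shows "(\<lambda>(i, a). r [^] i \<otimes> (if a then s else \<one>)) \<in> hom (dihedral n) G"
proof (rule homI)
  fix u v assume "u \<in> carrier (dihedral n)" "v \<in> carrier (dihedral n)"
  then show "(case u \<otimes>\<^bsub>dihedral n\<^esub> v of (i, a) \<Rightarrow> r [^] i \<otimes> (if a then s else \<one>))
    = (case u of (i, a) \<Rightarrow> r [^] i \<otimes> (if a then s else \<one>)) \<otimes>
      (case v of (i, a) \<Rightarrow> r [^] i \<otimes> (if a then s else \<one>))"
    using assms
      twisted_mult[of r s n 0 "snd u" "fst u" "fst v" "snd v"]
    by (simp add: dihedral_def case_prod_beta)
qed (use assms in auto)

lemma hom_dicyclic:
  assumes "r \<in> carrier G" "s \<in> carrier G" "r [^] (2 * n) = \<one>" "s \<otimes> s = r [^] n"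
    and "s \<otimes> r = inv r \<otimes> s"
  shows "(\<lambda>(i, a). r [^] i \<otimes> (if a then s else \<one>)) \<in> hom (dicyclic n) G"
proof (rule homI)
  fix u v assume "u \<in> carrier (dicyclic n)" "v \<in> carrier (dicyclic n)"
  then show "(case u \<otimes>\<^bsub>dicyclic n\<^esub> v of (i, a) \<Rightarrow> r [^] i \<otimes> (if a then s else \<one>))
    = (case u of (i, a) \<Rightarrow> r [^] i \<otimes> (if a then s else \<one>)) \<otimes>
      (case v of (i, a) \<Rightarrow> r [^] i \<otimes> (if a then s else \<one>))"
    using assms
      twisted_mult[of r s "2 * n" "int n" "snd u" "fst u" "fst v" "snd v"]
    by (simp add: dicyclic_def case_prod_beta int_pow_int)
qed (use assms in auto)

text \<open>For even \<open>n\<close> both presentations have the Klein four-group as a quotient. In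
  the dicyclic case evenness makes \<open>p [^] n\<close> trivial and thus equal to
  \<open>q \<otimes> q\<close>; in the dihedral case it is the relation
  \<open>r^n = 1\<close>.\<close>

lemma hom_klein:
  assumes "even n" and M: "M \<in> {dihedral n, dicyclic n}"
    and "p \<in> carrier G" "q \<in> carrier G" "p \<otimes> p = \<one>" "q \<otimes> q = \<one>" "p \<otimes> q = q \<otimes> p"
  shows "(\<lambda>(i, a). p [^] i \<otimes> (if a then q else \<one>)) \<in> hom M G"
proof -
  have 2: "p [^] (2::nat) = \<one>" using assms by (simp add: numeral_2_eq_2)
  then have pow: "p [^] m = \<one>" if "even m" for m :: nat
    using that assms(3) by (metis dvdE nat_pow_one nat_pow_pow)
  have "q \<otimes> p = inv p \<otimes> q"
    using assms inv_equality[of p p] by simp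
  then show ?thesis
    using M hom_dihedral[of p q n] hom_dicyclic[of p q n] assms(1,3-6) pow[of n] pow[of "2 * n"]
    by fastforce
qed

end

text \<open>A model of \<open>Alt(4)\<close> as the semidirect product of the Klein four-group by a cyclic group of
  order 3: the triple \<open>(p, q, k)\<close> stands for \<open>a\<^sup>p b\<^sup>q c\<^sup>k\<close>, where conjugation by \<open>c\<close> maps \<open>a\<close> to
  \<open>b\<close> and \<open>b\<close> to \<open>ab\<close>.\<close>

definition tetra_rot :: "int \<Rightarrow> bool \<times> bool \<Rightarrow> bool \<times> bool" where
  "tetra_rot k = (\<lambda>(p, q). if k = 0 then (p, q) else if k = 1 then (q, p \<noteq> q) else (p \<noteq> q, p))"

definition tetra :: "(bool \<times> bool \<times> int) monoid" where
  "tetra = \<lparr>carrier = UNIV \<times> UNIV \<times> {0..<3},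
     monoid.mult = (\<lambda>(p, q, k) (p', q', k').
       (p \<noteq> fst (tetra_rot k (p', q')), q \<noteq> snd (tetra_rot k (p', q')), (k + k') mod 3)),
     one = (False, False, 0)\<rparr>"

lemma int_less_3_cases: "(k::int) \<in> {0..<3} \<Longrightarrow> k = 0 \<or> k = 1 \<or> k = 2"
  by auto

text \<open>Associativity of a semidirect product rests on two facts: each rotation is additive on
  the four-group (\<open>xor\<close>), and the rotations form an action of Z/3
  (\<open>comp\<close>).\<close>

lemma group_tetra: "group tetra"
proof (rule groupI)
  fix x y z assume in_G: "x \<in> carrier tetra" "y \<in> carrier tetra" "z \<in> carrier tetra"
  \<comment> \<open>Exclusive or appears as \<open>p = (\<not> p')\<close>, the form into which the
    simplifier brings \<open>p \<noteq> p'\<close>.\<close>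
  have xor: "fst (tetra_rot k (p = (\<not> p'), q = (\<not> q'))) = (fst (tetra_rot k (p, q)) \<noteq> fst (tetra_rot k (p', q')))"
    "snd (tetra_rot k (p = (\<not> p'), q = (\<not> q'))) = (snd (tetra_rot k (p, q)) \<noteq> snd (tetra_rot k (p', q')))"
    for k p q p' q'
    unfolding tetra_rot_def by auto
  have comp: "tetra_rot k (tetra_rot l v) = tetra_rot ((k + l) mod 3) v"
    if kl: "k \<in> {0..<3}" "l \<in> {0..<3}" for k l v
  proof -
    obtain p q where [simp]: "v = (p, q)" by fastforce
    have [simp]: "k mod 3 = k" "l mod 3 = l" using kl by auto
    consider "k = 0" | "l = 0" | "k = 1" "l = 1" | "k = 1" "l = 2" | "k = 2" "l = 1" | "k = 2" "l = 2"
      using int_less_3_cases[OF kl(1)] int_less_3_cases[OF kl(2)] by blast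
    then show ?thesis
      by cases (auto simp: tetra_rot_def)
  qed
  obtain p q k p' q' k' p'' q'' k''
    where [simp]: "x = (p, q, k)" "y = (p', q', k')" "z = (p'', q'', k'')" by (metis surj_pair)
  have "tetra_rot ((k + k') mod 3) (p'', q'') = tetra_rot k (tetra_rot k' (p'', q''))"
    using in_G by (intro comp[symmetric]) (auto simp: tetra_def)
  then show "x \<otimes>\<^bsub>tetra\<^esub> y \<otimes>\<^bsub>tetra\<^esub> z = x \<otimes>\<^bsub>tetra\<^esub> (y \<otimes>\<^bsub>tetra\<^esub> z)"
    by (auto simp: tetra_def xor mod_simps add.assoc)
next
  fix x assume x: "x \<in> carrier tetra"
  obtain p q k where [simp]: "x = (p, q, k)" by (metis surj_pair)
  show "\<exists>y\<in>carrier tetra. y \<otimes>\<^bsub>tetra\<^esub> x = \<one>\<^bsub>tetra\<^esub>"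
    using x
    by (intro bexI[of _ "(fst (tetra_rot ((- k) mod 3) (p, q)), snd (tetra_rot ((- k) mod 3) (p, q)), (- k) mod 3)"])
      (use int_less_3_cases[of k] in \<open>auto simp: tetra_def tetra_rot_def\<close>)
qed (auto simp: tetra_def tetra_rot_def)

lemma order_tetra: "order tetra = 12"
  by (simp add: order_def tetra_def card_cartesian_product)

lemma finite_tetra: "finite (carrier tetra)"
  by (simp add: tetra_def)

text \<open>The relations, together with copies that carry a further factor on the right, are
  rewrite rules that bring every product into the form \<open>a^p b^q c^k\<close>. This settles the
  finitely many products of normal forms.\<close>

lemma (in group) hom_tetra:
  assumes in_G: "a \<in> carrier G" "b \<in> carrier G" "c \<in> carrier G"
    and a2: "a \<otimes> a = \<one>" and b2: "b \<otimes> b = \<one>" and ba: "b \<otimes> a = a \<otimes> b"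
    and c3: "c \<otimes> (c \<otimes> c) = \<one>" and ca: "c \<otimes> a = b \<otimes> c" and cb: "c \<otimes> b = a \<otimes> (b \<otimes> c)"
  shows "(\<lambda>(p, q, k). (if p then a else \<one>) \<otimes> ((if q then b else \<one>) \<otimes> c [^] k)) \<in> hom tetra G"
proof (rule homI)
  have a2': "a \<otimes> (a \<otimes> x) = x" and b2': "b \<otimes> (b \<otimes> x) = x"
    and ba': "b \<otimes> (a \<otimes> x) = a \<otimes> (b \<otimes> x)" and c3': "c \<otimes> (c \<otimes> (c \<otimes> x)) = x"
    and ca': "c \<otimes> (a \<otimes> x) = b \<otimes> (c \<otimes> x)" and cb': "c \<otimes> (b \<otimes> x) = a \<otimes> (b \<otimes> (c \<otimes> x))"
    if "x \<in> carrier G" for x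
    using that in_G a2 b2 ba c3 ca cb by (metis m_assoc m_closed l_one)+
  have c2: "c [^] (2::int) = c \<otimes> c"
    using in_G int_pow_mult[of c 1 1] by simp
  fix x y assume xy: "x \<in> carrier tetra" "y \<in> carrier tetra"
  show "(case x \<otimes>\<^bsub>tetra\<^esub> y of (p, q, k) \<Rightarrow>
         (if p then a else \<one>) \<otimes> ((if q then b else \<one>) \<otimes> c [^] k))
    = (case x of (p, q, k) \<Rightarrow> (if p then a else \<one>) \<otimes> ((if q then b else \<one>) \<otimes> c [^] k)) \<otimes>
      (case y of (p, q, k) \<Rightarrow> (if p then a else \<one>) \<otimes> ((if q then b else \<one>) \<otimes> c [^] k))"
  proof (cases x; cases y)
    fix p q k p' q' k'
    assume [simp]: "x = (p, q, k)" "y = (p', q', k')"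
    have "k = 0 \<or> k = 1 \<or> k = 2" "k' = 0 \<or> k' = 1 \<or> k' = 2"
      using xy by (auto simp: tetra_def)
    then show ?thesis
      by (elim disjE; cases p; cases q; cases p'; cases q')
        (simp_all add: tetra_def tetra_rot_def m_assoc in_G c2 a2 b2 ba c3 ca cb a2' b2' ba' c3' ca' cb')
  qed
qed (use in_G in auto)

section \<open>Upper bounds by enumeration of homomorphisms\<close>

text \<open>The functions below are evaluated by the simplifier, which also rewrites under binders. They
  are therefore first-order recursions instead of combinations of library functionals.\<close>

fun eval_word :: "('a \<Rightarrow> 'a \<Rightarrow> 'a) \<Rightarrow> 'a \<Rightarrow> 'a list \<Rightarrow> nat list \<Rightarrow> 'a" where
  "eval_word m e ys [] = e"
| "eval_word m e ys (i # w) = m (ys ! i) (eval_word m e ys w)"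

fun satisfies :: "('a \<Rightarrow> 'a \<Rightarrow> 'a) \<Rightarrow> 'a \<Rightarrow> (nat list \<times> nat list) list \<Rightarrow> 'a list \<Rightarrow> bool" where
  "satisfies m e [] ys = True"
| "satisfies m e ((u, v) # R) ys =
     (if eval_word m e ys u = eval_word m e ys v then satisfies m e R ys else False)"

fun lmult_list :: "('a \<Rightarrow> 'a \<Rightarrow> 'a) \<Rightarrow> 'a \<Rightarrow> 'a list \<Rightarrow> 'a list" where
  "lmult_list m g [] = []"
| "lmult_list m g (x # xs) = m g x # lmult_list m g xs"

fun power_blocks :: "('a \<Rightarrow> 'a \<Rightarrow> 'a) \<Rightarrow> 'a \<Rightarrow> nat \<Rightarrow> 'a list \<Rightarrow> 'a list" where
  "power_blocks m g 0 xs = []"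
| "power_blocks m g (Suc k) xs = xs @ power_blocks m g k (lmult_list m g xs)"

text \<open>A function is given below by the list of its values at the normal forms
  \<open>g\<^sub>1\<^sup>i \<cdots> g\<^sub>r\<^sup>j\<close>, with exponents in lexicographic order.\<close>

fun normal_forms :: "('a \<Rightarrow> 'a \<Rightarrow> 'a) \<Rightarrow> 'a \<Rightarrow> 'a list \<Rightarrow> nat list \<Rightarrow> 'a list" where
  "normal_forms m e (g # gs) (k # ks) = power_blocks m g k (normal_forms m e gs ks)"
| "normal_forms m e gs ks = [e]"

fun quotients :: "('a \<Rightarrow> 'a \<Rightarrow> 'a) \<Rightarrow> ('a \<Rightarrow> 'a) \<Rightarrow> 'a list \<Rightarrow> 'a list \<Rightarrow> 'a list" where
  "quotients m iv (b # bs) (a # as) = m b (iv a) # quotients m iv bs as"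
| "quotients m iv bs as = []"

fun at_most :: "nat \<Rightarrow> 'a \<Rightarrow> 'a list \<Rightarrow> bool" where
  "at_most k g [] = True"
| "at_most k g (x # xs) =
     (if g = x then (case k of 0 \<Rightarrow> False | Suc j \<Rightarrow> at_most j g xs) else at_most k g xs)"

text \<open>The head is tested against the tail alone, so \<open>k\<close> later copies mean
  \<open>Suc k\<close> occurrences. Only elements that occur have to be tested; hence the affine
  bounds below have the form \<open>Suc k\<close>.\<close>

fun all_at_most_Suc :: "nat \<Rightarrow> 'a list \<Rightarrow> bool" where
  "all_at_most_Suc k [] = True"
| "all_at_most_Suc k (x # xs) = (if at_most k x xs then all_at_most_Suc k xs else False)"

text \<open>The list \<open>p\<close> holds the images of the generators under a candidate
  endomorphism. Its normal forms are the images of the group elements in the order of the table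
  \<open>fs\<close>, so the quotients can be formed entry by entry.\<close>

definition end_small ::
  "('a \<Rightarrow> 'a \<Rightarrow> 'a) \<Rightarrow> 'a \<Rightarrow> ('a \<Rightarrow> 'a) \<Rightarrow> nat list \<Rightarrow> 'a list \<Rightarrow> nat \<Rightarrow> 'a list \<Rightarrow> bool" where
  "end_small m e iv ks fs k p = at_most k e (quotients m iv fs (normal_forms m e p ks))"

definition aff_small ::
  "('a \<Rightarrow> 'a \<Rightarrow> 'a) \<Rightarrow> 'a \<Rightarrow> ('a \<Rightarrow> 'a) \<Rightarrow> nat list \<Rightarrow> 'a list \<Rightarrow> nat \<Rightarrow> 'a list \<Rightarrow> bool" where
  "aff_small m e iv ks fs k p = all_at_most_Suc k (quotients m iv fs (normal_forms m e p ks))"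

text \<open>The \<open>i\<close>-th list of relations involves the generators \<open>0, \<dots>, i\<close> only and is used to discard
  partial assignments of images to generators. The survivors need not all extend to homomorphisms.\<close>

fun all_assignments ::
  "('a list \<Rightarrow> bool) \<Rightarrow> ('a \<Rightarrow> 'a \<Rightarrow> 'a) \<Rightarrow> 'a \<Rightarrow> 'a list \<Rightarrow> (nat list \<times> nat list) list list \<Rightarrow>
    'a list \<Rightarrow> 'a list \<Rightarrow> bool" where
  "all_assignments P m e els [] ys p = P p"
| "all_assignments P m e els (R # Rs) [] p = True"
| "all_assignments P m e els (R # Rs) (y # ys) p =
     (if (if satisfies m e R (p @ [y]) then all_assignments P m e els Rs els (p @ [y]) else True)
      then all_assignments P m e els (R # Rs) ys p else False)"

fun presented ::
  "('a \<Rightarrow> 'a \<Rightarrow> 'a) \<Rightarrow> 'a \<Rightarrow> 'a list \<Rightarrow> (nat list \<times> nat list) list list \<Rightarrow> nat \<Rightarrow> bool" where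
  "presented m e gens [] n \<longleftrightarrow> n = length gens"
| "presented m e gens (R # Rs) n \<longleftrightarrow> n < length gens \<and>
     list_all (\<lambda>(u, v). list_all (\<lambda>j. j \<le> n) (u @ v)) R \<and> satisfies m e R gens \<and>
     presented m e gens Rs (Suc n)"

text \<open>The relations are required to hold, which is all that homomorphic images inherit. A list
  of relations that defines a larger group would only leave more assignments to be tested.\<close>

definition well_presented ::
  "('a \<Rightarrow> 'a \<Rightarrow> 'a) \<Rightarrow> 'a \<Rightarrow> ('a \<Rightarrow> 'a) \<Rightarrow> 'a list \<Rightarrow> nat list \<Rightarrow>
    (nat list \<times> nat list) list list \<Rightarrow> bool" where
  "well_presented m e iv gens ks Rs \<longleftrightarrow>
     (let els = normal_forms m e gens ks in
       presented m e gens Rs 0 \<and> distinct els \<and> list_all (\<lambda>y. y \<in> set els) gens \<and>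
       list_all (\<lambda>y. iv y \<in> set els \<and> m y (iv y) = e) els)"

definition app_check ::
  "(nat \<Rightarrow> 'a list \<Rightarrow> bool) \<Rightarrow> ('a \<Rightarrow> 'a \<Rightarrow> 'a) \<Rightarrow> 'a \<Rightarrow> 'a list \<Rightarrow> nat list \<Rightarrow>
    (nat list \<times> nat list) list list \<Rightarrow> 'a list \<Rightarrow> nat \<Rightarrow> bool" where
  "app_check P m e gens ks Rs fs k \<longleftrightarrow>
     (let els = normal_forms m e gens ks in
       length fs = length els \<and> list_all (\<lambda>y. y \<in> set els) fs \<and>
       all_assignments (P k) m e els Rs els [])"

section \<open>Soundness of the enumeration\<close>

lemma lmult_list_eq_map: "lmult_list m g xs = map (m g) xs"
  by (induction xs) auto

lemma quotients_eq_map2: "quotients m iv bs as = map2 (\<lambda>b a. m b (iv a)) bs as"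
  by (induction m iv bs as rule: quotients.induct) auto

lemma at_most_iff: "at_most k g xs \<longleftrightarrow> length (filter ((=) g) xs) \<le> k"
  by (induction k g xs rule: at_most.induct) (auto split: nat.splits)

lemma all_at_most_Suc_iff: "all_at_most_Suc k xs \<longleftrightarrow> (\<forall>g. length (filter ((=) g) xs) \<le> Suc k)"
proof (induction xs)
  case (Cons x xs)
  show ?case
  proof
    assume "all_at_most_Suc k (x # xs)"
    then show "\<forall>g. length (filter ((=) g) (x # xs)) \<le> Suc k"
      using Cons by (auto simp: at_most_iff split: if_splits)
  next
    assume *: "\<forall>g. length (filter ((=) g) (x # xs)) \<le> Suc k"
    have "length (filter ((=) g) xs) \<le> Suc k" for g
      using *[rule_format, of g] by (auto split: if_splits)
    moreover have "length (filter ((=) x) xs) \<le> k"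
      using *[rule_format, of x] by simp
    ultimately show "all_at_most_Suc k (x # xs)"
      using Cons by (simp add: at_most_iff)
  qed
qed auto

lemma satisfies_iff: "satisfies m e R ys \<longleftrightarrow> (\<forall>(u, v)\<in>set R. eval_word m e ys u = eval_word m e ys v)"
  by (induction m e R ys rule: satisfies.induct) auto

lemma eval_word_append:
  assumes "\<forall>j\<in>set w. j < length ys"
  shows "eval_word m e (ys @ zs) w = eval_word m e ys w"
  using assms by (induction w) (auto simp: nth_append)

text \<open>The list \<open>ys\<close> of remaining candidates restricts the first entry of the
  extension \<open>q\<close> only; all later entries range over \<open>els\<close> again. As each
  prefix of \<open>q\<close> satisfies its relations, the search never discards it.\<close>

lemma all_assignmentsD:
  assumes "all_assignments P m e els Rs ys p" "length q = length Rs"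
    and "set q \<subseteq> set els" "q \<noteq> [] \<Longrightarrow> hd q \<in> set ys"
    and "\<And>i. i < length Rs \<Longrightarrow> satisfies m e (Rs ! i) (p @ take (Suc i) q)"
  shows "P (p @ q)"
  using assms
proof (induction P m e els Rs ys p arbitrary: q rule: all_assignments.induct)
  case (3 P m e els R Rs y ys p)
  obtain z q' where q: "q = z # q'" using "3.prems"(2) by (cases q) auto
  show ?case
  proof (cases "z = y")
    case True
    have "satisfies m e R (p @ [y])" using "3.prems"(5)[of 0] q True by simp
    then show ?thesis
      using "3.prems"(1,2,3) q True "3.prems"(5)[of "Suc _"]
        "3.IH"(1)[of q'] by (cases q') (auto split: if_splits)
  next
    case False
    then show ?thesis
      using "3.prems" q "3.IH"(2)[of q] by (auto split: if_splits)
  qed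
qed (auto simp: length_Suc_conv)

lemma presentedD:
  assumes "presented m e gens Rs n"
  shows "n + length Rs = length gens"
    and "i < length Rs \<Longrightarrow> satisfies m e (Rs ! i) gens"
    and "i < length Rs \<Longrightarrow> (u, v) \<in> set (Rs ! i) \<Longrightarrow> \<forall>j\<in>set (u @ v). j \<le> n + i"
proof -
  show "n + length Rs = length gens"
    using assms by (induction m e gens Rs n rule: presented.induct) auto
  show "i < length Rs \<Longrightarrow> satisfies m e (Rs ! i) gens"
    using assms
    by (induction m e gens Rs n arbitrary: i rule: presented.induct) (auto simp: nth_Cons split: nat.splits)
  show "i < length Rs \<Longrightarrow> (u, v) \<in> set (Rs ! i) \<Longrightarrow> \<forall>j\<in>set (u @ v). j \<le> n + i"
    using assms
    by (induction m e gens Rs n arbitrary: i rule: presented.induct)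
      (fastforce simp: nth_Cons list_all_iff split: nat.splits)+
qed

text \<open>The evaluable operations stand beside those of the group and need to agree with them on
  the carrier. The equation \<open>order\<close> lets distinctness of the normal forms replace any
  argument that they exhaust the group.\<close>

locale presented_group = group M for M (structure) +
  fixes m :: "'a \<Rightarrow> 'a \<Rightarrow> 'a" and iv :: "'a \<Rightarrow> 'a" and gens :: "'a list" and ks :: "nat list"
    and Rs :: "(nat list \<times> nat list) list list"
  assumes m: "\<And>x y. x \<in> carrier M \<Longrightarrow> y \<in> carrier M \<Longrightarrow> m x y = x \<otimes> y"
    and gens: "set gens \<subseteq> carrier M" and fin: "finite (carrier M)"
    and order: "length (normal_forms m \<one> gens ks) = order M"
    and well_presented: "well_presented m \<one> iv gens ks Rs"
begin

abbreviation "els \<equiv> normal_forms m \<one> gens ks"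

lemma eval_word_hom:
  assumes "\<phi> \<in> hom M M" "\<forall>i\<in>set w. i < length gens"
  shows "eval_word m \<one> (map \<phi> gens) w = \<phi> (eval_word m \<one> gens w)"
proof -
  have "eval_word m \<one> gens w \<in> carrier M \<and>
    eval_word m \<one> (map \<phi> gens) w = \<phi> (eval_word m \<one> gens w)"
    using assms(2)
  proof (induction w)
    case Nil
    then show ?case using hom_one[OF assms(1)] group_axioms by simp
  next
    case (Cons i w)
    then have i: "gens ! i \<in> carrier M" "i < length gens" using gens by auto
    then have "\<phi> (gens ! i) \<in> carrier M" using assms(1) by (simp add: hom_in_carrier)
    then show ?case
      using Cons i m assms(1) by (auto simp: hom_mult hom_in_carrier)
  qed
  then show ?thesis by simp
qed

lemma power_blocks_hom:
  assumes "\<phi> \<in> hom M M" "g \<in> carrier M" "set xs \<subseteq> carrier M"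
  shows "set (power_blocks m g k xs) \<subseteq> carrier M \<and>
    power_blocks m (\<phi> g) k (map \<phi> xs) = map \<phi> (power_blocks m g k xs)"
  using assms(3)
proof (induction k arbitrary: xs)
  case (Suc k)
  have in_carrier: "set (lmult_list m g xs) \<subseteq> carrier M"
    using Suc.prems assms(2) m by (auto simp: lmult_list_eq_map)
  have "lmult_list m (\<phi> g) (map \<phi> xs) = map \<phi> (lmult_list m g xs)"
    using Suc.prems assms(1,2) m by (auto simp: lmult_list_eq_map hom_mult hom_in_carrier subset_iff)
  then show ?case using Suc.IH[OF in_carrier] Suc.prems by simp
qed auto

text \<open>Normal forms are words in the generators, so a homomorphism acts on the list position by
  position. This is what allows a table to be compared with an endomorphism known only on the
  generators.\<close>

lemma normal_forms_hom:
  assumes "\<phi> \<in> hom M M" "set gs \<subseteq> carrier M"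
  shows "set (normal_forms m \<one> gs ks') \<subseteq> carrier M \<and>
    normal_forms m \<one> (map \<phi> gs) ks' = map \<phi> (normal_forms m \<one> gs ks')"
  using assms(2)
proof (induction gs arbitrary: ks')
  case (Cons g gs)
  then show ?case
    using power_blocks_hom[OF assms(1)] by (cases ks') (auto simp: hom_one[OF assms(1)] group_axioms)
qed (simp add: hom_one[OF assms(1)] group_axioms)

text \<open>A list of distinct elements of the carrier, as long as the order of the group.
  Membership in the carrier is the instance of \<open>normal_forms_hom\<close> for the
  identity.\<close>

lemma set_els: "set els = carrier M" and distinct_els: "distinct els"
proof -
  show "distinct els" using well_presented by (simp add: well_presented_def Let_def)
  then have "card (set els) = card (carrier M)"
    using distinct_card order by (metis order_def)
  then show "set els = carrier M"
    using normal_forms_hom[OF hom_self_nonempty gens] fin by (simp add: card_subset_eq)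
qed

lemma iv_eq: "x \<in> carrier M \<Longrightarrow> iv x = inv x"
  using well_presented set_els m inv_equality[of "iv x" x]
  by (auto simp: well_presented_def Let_def list_all_iff) (metis inv_char inv_comm)

text \<open>An endomorphism preserves the relations of the generators, so the tuple of its values at
  the generators survives every pruning step and is tested by \<open>P\<close>.\<close>

lemma assignments_hom:
  assumes "all_assignments P m \<one> els Rs els []" and \<phi>: "\<phi> \<in> hom M M"
  shows "P (map \<phi> gens)"
proof -
  have pres: "presented m \<one> gens Rs 0" using well_presented by (simp add: well_presented_def Let_def)
  have img: "set (map \<phi> gens) \<subseteq> set els"
    using gens \<phi> set_els by (auto simp: hom_in_carrier)
  have "satisfies m \<one> (Rs ! i) ([] @ take (Suc i) (map \<phi> gens))" if i: "i < length Rs" for i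
    unfolding satisfies_iff
  proof clarify
    fix u v assume uv: "(u, v) \<in> set (Rs ! i)"
    have len: "length (take (Suc i) (map \<phi> gens)) = Suc i"
      using presentedD(1)[OF pres] i by simp
    \<comment> \<open>Relations of the list \<open>i\<close> mention the generators up to
      \<open>i\<close> only, so the prefix of length \<open>Suc i\<close> already determines their
      evaluation.\<close>
    have "eval_word m \<one> ([] @ take (Suc i) (map \<phi> gens)) w = \<phi> (eval_word m \<one> gens w)"
      if "w = u \<or> w = v" for w
    proof -
      have w: "\<forall>j\<in>set w. j < Suc i"
        using presentedD(3)[OF pres i uv] that by (auto simp: less_Suc_eq_le)
      then have "eval_word m \<one> ([] @ take (Suc i) (map \<phi> gens)) w = eval_word m \<one> (map \<phi> gens) w"
        using eval_word_append[of w "take (Suc i) (map \<phi> gens)" m \<one> "drop (Suc i) (map \<phi> gens)"] len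
        by (simp only: append_take_drop_id append_Nil)
      also have "\<dots> = \<phi> (eval_word m \<one> gens w)"
        using w i presentedD(1)[OF pres] by (intro eval_word_hom[OF \<phi>]) auto
      finally show ?thesis .
    qed
    moreover have "eval_word m \<one> gens u = eval_word m \<one> gens v"
      using presentedD(2)[OF pres i] uv by (auto simp: satisfies_iff)
    ultimately show "eval_word m \<one> ([] @ take (Suc i) (map \<phi> gens)) u
      = eval_word m \<one> ([] @ take (Suc i) (map \<phi> gens)) v" by metis
  qed
  then have "P ([] @ map \<phi> gens)"
    using img presentedD(1)[OF pres] hd_in_set[of "map \<phi> gens"]
    by (intro all_assignmentsD[OF assms(1)]) auto
  then show ?thesis by simp
qed

definition table_fun :: "'a list \<Rightarrow> 'a \<Rightarrow> 'a" where
  "table_fun fs x = the (map_of (zip els fs) x)"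

lemma table_fun_nth: "length fs = length els \<Longrightarrow> i < length els \<Longrightarrow> table_fun fs (els ! i) = fs ! i"
  unfolding table_fun_def using distinct_els by (simp add: map_of_zip_nth)

lemma table_fun_carrier:
  assumes "length fs = length els" "set fs \<subseteq> carrier M"
  shows "table_fun fs \<in> carrier M \<rightarrow> carrier M"
proof
  fix x assume "x \<in> carrier M"
  then obtain i where "i < length els" "x = els ! i" using set_els by (metis in_set_conv_nth)
  then show "table_fun fs x \<in> carrier M" using table_fun_nth[OF assms(1)] assms by auto
qed

lemma agreement_eq:
  assumes fs: "length fs = length els" "set fs \<subseteq> carrier M" and g: "g \<in> carrier M" and \<phi>: "\<phi> \<in> hom M M"
  shows "agreement M (\<lambda>x. g \<otimes> \<phi> x) (table_fun fs)
    = length (filter ((=) g) (quotients m iv fs (normal_forms m \<one> (map \<phi> gens) ks)))"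
    (is "_ = length (filter _ ?q)")
proof -
  let ?f = "table_fun fs"
  have \<phi>_carrier: "\<phi> x \<in> carrier M" if "x \<in> carrier M" for x using \<phi> that by (rule hom_in_carrier)
  have "?q = map2 (\<lambda>b a. m b (iv a)) fs (map \<phi> els)"
    using normal_forms_hom[OF \<phi> gens] by (simp add: quotients_eq_map2)
  also have "\<dots> = map (\<lambda>x. ?f x \<otimes> inv (\<phi> x)) els"
  proof (rule nth_equalityI)
    fix i assume "i < length (map2 (\<lambda>b a. m b (iv a)) fs (map \<phi> els))"
    then have i: "i < length fs" "i < length els" by auto
    then have "\<phi> (els ! i) \<in> carrier M" "fs ! i \<in> carrier M"
      using \<phi>_carrier[of "els ! i"] set_els fs nth_mem by blast+
    then show "map2 (\<lambda>b a. m b (iv a)) fs (map \<phi> els) ! i = map (\<lambda>x. ?f x \<otimes> inv (\<phi> x)) els ! i"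
      using i table_fun_nth[OF fs(1)] m iv_eq by simp
  qed (use fs in simp)
  finally have q: "?q = map (\<lambda>x. ?f x \<otimes> inv (\<phi> x)) els" .
  have "g \<otimes> \<phi> x = ?f x \<longleftrightarrow> g = ?f x \<otimes> inv (\<phi> x)" if "x \<in> carrier M" for x
    using that g \<phi>_carrier table_fun_carrier[OF fs] inv_solve_right[of g "?f x" "\<phi> x"]
    by (auto simp: Pi_iff)
  then have "{x \<in> carrier M. g \<otimes> \<phi> x = ?f x} = set (filter (\<lambda>x. g = ?f x \<otimes> inv (\<phi> x)) els)"
    using set_els by auto
  then show ?thesis
    unfolding agreement_def q filter_map length_map
    using distinct_card[OF distinct_filter[OF distinct_els]] by (simp add: comp_def)
qed

lemma endapp_le_check:
  assumes "app_check (end_small m \<one> iv ks fs) m \<one> gens ks Rs fs k"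
  shows "endapp M \<le> k"
proof -
  have fs: "length fs = length els" "set fs \<subseteq> carrier M"
    and all: "all_assignments (end_small m \<one> iv ks fs k) m \<one> els Rs els []"
    using assms set_els by (auto simp: app_check_def Let_def list_all_iff)
  show ?thesis
  proof (rule endapp_le[OF group_axioms fin table_fun_carrier[OF fs]])
    fix \<phi> assume \<phi>: "\<phi> \<in> hom M M"
    \<comment> \<open>An endomorphism is the affine map with translation \<open>\<one>\<close>, so
      that one counting lemma serves both invariants.\<close>
    have "agreement M \<phi> (table_fun fs) = agreement M (\<lambda>x. \<one> \<otimes> \<phi> x) (table_fun fs)"
      unfolding agreement_def using \<phi>
      by (intro arg_cong[of _ _ card] Collect_cong conj_cong refl) (simp add: hom_in_carrier)
    then show "agreement M \<phi> (table_fun fs) \<le> k"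
      using agreement_eq[OF fs one_closed \<phi>] assignments_hom[OF all \<phi>]
      by (simp add: end_small_def at_most_iff)
  qed
qed

lemma affapp_le_check:
  assumes "app_check (aff_small m \<one> iv ks fs) m \<one> gens ks Rs fs k"
  shows "affapp M \<le> Suc k"
proof -
  have fs: "length fs = length els" "set fs \<subseteq> carrier M"
    and all: "all_assignments (aff_small m \<one> iv ks fs k) m \<one> els Rs els []"
    using assms set_els by (auto simp: app_check_def Let_def list_all_iff)
  show ?thesis
  proof (rule affapp_le[OF group_axioms fin table_fun_carrier[OF fs]])
    fix g \<phi> assume g: "g \<in> carrier M" and \<phi>: "\<phi> \<in> hom M M"
    show "agreement M (\<lambda>x. g \<otimes> \<phi> x) (table_fun fs) \<le> Suc k"
      using agreement_eq[OF fs g \<phi>] assignments_hom[OF all \<phi>]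
      by (simp add: aff_small_def all_at_most_Suc_iff)
  qed
qed

end

lemma length_normal_forms:
  "length gens = length ks \<Longrightarrow> length (normal_forms m e gens ks) = prod_list ks"
proof (induction m e gens ks rule: normal_forms.induct)
  case (1 m e g gs k ks)
  have "length (power_blocks m g k xs) = k * length xs" for xs
    by (induction k arbitrary: xs) (auto simp: lmult_list_eq_map)
  then show ?case using 1 by simp
qed auto

lemma app_le_check:
  assumes "group M" "finite (carrier M)" "e = \<one>\<^bsub>M\<^esub>"
    and "\<And>x y. x \<in> carrier M \<Longrightarrow> y \<in> carrier M \<Longrightarrow> m x y = x \<otimes>\<^bsub>M\<^esub> y"
    and "set gens \<subseteq> carrier M" "length gens = length ks" "order M = prod_list ks"
    and "well_presented m e iv gens ks Rs"
    and "app_check (end_small m e iv ks fe) m e gens ks Rs fe ke"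
    and "app_check (aff_small m e iv ks fa) m e gens ks Rs fa ka"
  shows "endapp M \<le> ke \<and> affapp M \<le> Suc ka"
proof -
  interpret presented_group M m iv gens ks Rs
    using assms
    by (auto intro!: presented_group.intro presented_group_axioms.intro simp: length_normal_forms)
  show ?thesis using assms endapp_le_check affapp_le_check by blast
qed

section \<open>Arithmetic of the models on reduced representatives\<close>

definition add_mod :: "int \<Rightarrow> int \<Rightarrow> int \<Rightarrow> int" where
  "add_mod n x y = (if x + y < n then x + y else x + y - n)"

definition neg_mod :: "int \<Rightarrow> int \<Rightarrow> int" where
  "neg_mod n x = (if x = 0 then 0 else n - x)"

lemma add_mod_eq: "0 \<le> x \<Longrightarrow> x < n \<Longrightarrow> 0 \<le> y \<Longrightarrow> y < n \<Longrightarrow> add_mod n x y = (x + y) mod n"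
  by (auto simp: add_mod_def not_less mod_pos_pos_trivial
      intro!: int_mod_pos_eq[symmetric, where q = 1])

lemma neg_mod_bounds: "0 \<le> x \<Longrightarrow> x < n \<Longrightarrow> 0 \<le> neg_mod n x \<and> neg_mod n x < n"
  by (auto simp: neg_mod_def)

lemma neg_mod_eq: "(i + neg_mod n x) mod n = (i - x) mod n"
  by (auto simp: neg_mod_def) (metis add_diff_eq diff_add_eq mod_add_self2)

fun prod_mult :: "('a \<Rightarrow> 'a \<Rightarrow> 'a) \<Rightarrow> ('b \<Rightarrow> 'b \<Rightarrow> 'b) \<Rightarrow> 'a \<times> 'b \<Rightarrow> 'a \<times> 'b \<Rightarrow> 'a \<times> 'b" where
  "prod_mult m m' (x, y) (x', y') = (m x x', m' y y')"

text \<open>Products of normal forms \<open>r^i s^a\<close> with \<open>s^2 = r^t\<close> and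
  exponents modulo \<open>n\<close>, for reduced arguments.\<close>

fun twisted_mult_mod :: "int \<Rightarrow> int \<Rightarrow> int \<times> bool \<Rightarrow> int \<times> bool \<Rightarrow> int \<times> bool" where
  "twisted_mult_mod n t (i, False) (j, b) = (add_mod n i j, b)"
| "twisted_mult_mod n t (i, True) (j, False) = (add_mod n i (neg_mod n j), True)"
| "twisted_mult_mod n t (i, True) (j, True) = (add_mod n (add_mod n i (neg_mod n j)) t, False)"

text \<open>From \<open>r^i s r^j s = r^(i - j + t)\<close>, the inverse of \<open>r^i s\<close> is
  \<open>r^(i + t) s\<close>.\<close>

fun twisted_inv_mod :: "int \<Rightarrow> int \<Rightarrow> int \<times> bool \<Rightarrow> int \<times> bool" where
  "twisted_inv_mod n t (i, a) = (if a then (add_mod n i t, a) else (neg_mod n i, a))"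

text \<open>The inverse of \<open>v c^k\<close> with \<open>v\<close> in the four-group is
  \<open>v' c^(-k)\<close>, where \<open>v'\<close> is \<open>v\<close> conjugated by
  \<open>c^(-k)\<close>; each element of the four-group is its own inverse.\<close>

fun tetra_inv :: "bool \<times> bool \<times> int \<Rightarrow> bool \<times> bool \<times> int" where
  "tetra_inv (p, q, k) =
     (if k = 0 then (p, q, 0) else if k = 1 then (p \<noteq> q, p, 2) else (q, p \<noteq> q, 1))"

fun tetra_mult :: "bool \<times> bool \<times> int \<Rightarrow> bool \<times> bool \<times> int \<Rightarrow> bool \<times> bool \<times> int" where
  "tetra_mult (p, q, k) (p', q', k') =
     (if k = 0 then (p \<noteq> p', q \<noteq> q', k') else
      if k = 1 then (p \<noteq> q', q \<noteq> (p' \<noteq> q'), add_mod 3 1 k') else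
        (p \<noteq> (p' \<noteq> q'), q \<noteq> p', add_mod 3 2 k'))"

lemma dihedral_mult:
  assumes "x \<in> carrier (dihedral n)" "y \<in> carrier (dihedral n)"
  shows "twisted_mult_mod (int n) 0 x y = x \<otimes>\<^bsub>dihedral n\<^esub> y"
  using assms neg_mod_bounds[of "fst y" "int n"]
  by (cases "(int n, 0 :: int, x, y)" rule: twisted_mult_mod.cases)
    (auto simp: dihedral_def add_mod_eq neg_mod_eq)

lemma dicyclic_mult:
  assumes "x \<in> carrier (dicyclic n)" "y \<in> carrier (dicyclic n)"
  shows "twisted_mult_mod (2 * int n) (int n) x y = x \<otimes>\<^bsub>dicyclic n\<^esub> y"
  using assms neg_mod_bounds[of "fst y" "2 * int n"]
    mod_add_left_eq[of "fst x + neg_mod (2 * int n) (fst y)" "2 * int n" "int n"]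
    mod_add_left_eq[of "fst x - fst y" "2 * int n" "int n"]
  by (cases "(2 * int n, int n, x, y)" rule: twisted_mult_mod.cases)
    (auto simp: dicyclic_def add_mod_eq neg_mod_eq)

lemma tetra_mult_eq:
  assumes "x \<in> carrier tetra" "y \<in> carrier tetra"
  shows "tetra_mult x y = x \<otimes>\<^bsub>tetra\<^esub> y"
  using assms int_less_3_cases[of "snd (snd x)"]
  by (cases "(x, y)" rule: tetra_mult.cases) (auto simp: tetra_def tetra_rot_def add_mod_eq)

text \<open>The generator carries no relation: every element of a cyclic group is the image of 1
  under some endomorphism.\<close>

lemma app_le_integer_mod_group:
  assumes "n > 1"
    and "well_presented (add_mod (int n)) 0 (neg_mod (int n)) [1] [n] [[]]"
    and "app_check (end_small (add_mod (int n)) 0 (neg_mod (int n)) [n] fe)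
      (add_mod (int n)) 0 [1] [n] [[]] fe ke"
    and "app_check (aff_small (add_mod (int n)) 0 (neg_mod (int n)) [n] fa)
      (add_mod (int n)) 0 [1] [n] [[]] fa ka"
  shows "endapp (integer_mod_group n) \<le> ke \<and> affapp (integer_mod_group n) \<le> Suc ka"
  using assms
  by (intro app_le_check[where m = "add_mod (int n)"])
    (auto simp: carrier_integer_mod_group order_def add_mod_eq)

text \<open>The reflection \<open>s\<close> comes first, so \<open>s^2 = 1\<close> prunes its images
  before an image of \<open>r\<close> is chosen. Accordingly the tables list the values at
  \<open>1, r, ..., r^(n-1)\<close> and then at \<open>s, s r, ..., s r^(n-1)\<close>.\<close>

lemma app_le_dihedral:
  fixes n defines "m \<equiv> twisted_mult_mod (int n) 0" and "iv \<equiv> twisted_inv_mod (int n) 0"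
    and "gens \<equiv> [(0, True), (1, False)]"
    and "Rs \<equiv> [[([0, 0], [])], [(replicate n 1, []), ([0, 1, 0, 1], [])]]"
  assumes "n > 1" "well_presented m (0, False) iv gens [2, n] Rs"
    and "app_check (end_small m (0, False) iv [2, n] fe) m (0, False) gens [2, n] Rs fe ke"
    and "app_check (aff_small m (0, False) iv [2, n] fa) m (0, False) gens [2, n] Rs fa ka"
  shows "endapp (dihedral n) \<le> ke \<and> affapp (dihedral n) \<le> Suc ka"
  using assms(5-)
  by (intro app_le_check[where m = m])
    (auto simp: group_dihedral order_dihedral m_def dihedral_mult, auto simp: dihedral_def gens_def)

text \<open>The relation \<open>s^4 = 1\<close>, a consequence of the other two, involves
  \<open>s\<close> alone and so prunes the images of \<open>s\<close> before those of
  \<open>r\<close> are considered.\<close>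

lemma app_le_dicyclic:
  fixes n defines "m \<equiv> twisted_mult_mod (2 * int n) (int n)"
    and "iv \<equiv> twisted_inv_mod (2 * int n) (int n)"
    and "gens \<equiv> [(0, True), (1, False)]"
    and "Rs \<equiv> [[([0, 0, 0, 0], [])], [(replicate n 1, [0, 0]), ([1, 0, 1], [0])]]"
  assumes "n > 0" "well_presented m (0, False) iv gens [2, 2 * n] Rs"
    and "app_check (end_small m (0, False) iv [2, 2 * n] fe) m (0, False) gens [2, 2 * n] Rs fe ke"
    and "app_check (aff_small m (0, False) iv [2, 2 * n] fa) m (0, False) gens [2, 2 * n] Rs fa ka"
  shows "endapp (dicyclic n) \<le> ke \<and> affapp (dicyclic n) \<le> Suc ka"
  using assms(5-)
  by (intro app_le_check[where m = m])
    (auto simp: group_dicyclic order_dicyclic m_def dicyclic_mult, auto simp: dicyclic_def gens_def)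

text \<open>Commutation is automatic in an abelian group, and in the groups below \<open>k\<close>
  divides \<open>n\<close>, so that the order of the first generator restricts nothing. What remains
  is that the image of the second generator is killed by \<open>k\<close>.\<close>

lemma app_le_DirProd:
  fixes n k defines "m \<equiv> prod_mult (add_mod (int n)) (add_mod (int k))"
    and "iv \<equiv> map_prod (neg_mod (int n)) (neg_mod (int k))"
    and "gens \<equiv> [(1, 0), (0, 1)]" and "Rs \<equiv> [[], [(replicate k 1, [])]]"
  assumes "n > 1" "k > 1" "well_presented m (0, 0) iv gens [n, k] Rs"
    and "app_check (end_small m (0, 0) iv [n, k] fe) m (0, 0) gens [n, k] Rs fe ke"
    and "app_check (aff_small m (0, 0) iv [n, k] fa) m (0, 0) gens [n, k] Rs fa ka"
  shows "endapp (integer_mod_group n \<times>\<times> integer_mod_group k) \<le> ke \<and>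
    affapp (integer_mod_group n \<times>\<times> integer_mod_group k) \<le> Suc ka"
  using assms(5-)
  by (intro app_le_check[where m = m])
    (auto simp: m_def gens_def DirProd_group order_def card_cartesian_product
      carrier_integer_mod_group add_mod_eq)

section \<open>Tables witnessing the upper bounds\<close>

lemma app_le_Z2_Z2:
  "endapp (integer_mod_group 2 \<times>\<times> integer_mod_group 2) \<le> 2 \<and>
    affapp (integer_mod_group 2 \<times>\<times> integer_mod_group 2) \<le> Suc 2"
  by (rule app_le_DirProd[where
      fe = "[(0, 1), (1, 1), (1, 0), (1, 1)]" and
      fa = "[(0, 1), (1, 1), (1, 0), (1, 1)]"];
    code_simp)

lemma app_le_Z4_Z2:
  "endapp (integer_mod_group 4 \<times>\<times> integer_mod_group 2) \<le> 1 \<and>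
    affapp (integer_mod_group 4 \<times>\<times> integer_mod_group 2) \<le> Suc 1"
  by (rule app_le_DirProd[where
      fe = "[(2, 0), (1, 0), (0, 1), (3, 0), (2, 1), (1, 1), (2, 0), (3, 1)]" and
      fa = "[(2, 0), (1, 0), (0, 1), (3, 0), (2, 1), (1, 1), (2, 0), (3, 1)]"];
    code_simp)

lemma app_le_Z3_Z3:
  "endapp (integer_mod_group 3 \<times>\<times> integer_mod_group 3) \<le> 2 \<and>
    affapp (integer_mod_group 3 \<times>\<times> integer_mod_group 3) \<le> Suc 2"
  by (rule app_le_DirProd[where
      fe = "[(2, 0), (0, 2), (0, 0), (0, 0), (2, 1), (2, 2), (2, 2), (0, 1), (2, 1)]" and
      fa = "[(2, 2), (1, 1), (1, 0), (2, 1), (1, 1), (1, 1), (0, 2), (2, 0), (2, 1)]"];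
    code_simp)

lemma app_le_Z6_Z2:
  "endapp (integer_mod_group 6 \<times>\<times> integer_mod_group 2) \<le> 1 \<and>
    affapp (integer_mod_group 6 \<times>\<times> integer_mod_group 2) \<le> Suc 2"
  by (rule app_le_DirProd[where
      fe = "[(3, 0), (1, 1), (4, 0), (5, 0), (2, 1), (3, 0), (1, 1), (2, 0), (4, 1), (0, 0), (5, 0),
        (1, 1)]" and
      fa = "[(3, 0), (1, 1), (4, 0), (5, 0), (2, 1), (3, 0), (1, 1), (2, 0), (4, 1), (0, 0), (5, 0),
        (1, 1)]"];
    code_simp)

lemma app_le_Z2_Z2_Z2:
  "endapp (integer_mod_group 2 \<times>\<times> integer_mod_group 2 \<times>\<times> integer_mod_group 2) \<le> 3 \<and>
    affapp (integer_mod_group 2 \<times>\<times> integer_mod_group 2 \<times>\<times> integer_mod_group 2) \<le> Suc 3"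
proof -
  let ?m = "prod_mult (add_mod 2) (prod_mult (add_mod 2) (add_mod 2))" and ?iv = "map_prod (neg_mod 2) (map_prod (neg_mod 2) (neg_mod 2))"
  let ?gens = "[(1, 0, 0), (0, 1, 0), (0, 0, 1)]"
  let ?Rs = "[[], [], []]"
  let ?fe = "[(1, 0, 0), (0, 0, 1), (0, 1, 1), (1, 0, 1), (1, 1, 1), (1, 1, 1), (0, 0, 1), (1, 1, 0)]"
  let ?fa = "[(0, 0, 0), (0, 0, 0), (1, 1, 1), (0, 0, 1), (0, 0, 1), (1, 1, 0), (1, 0, 0), (1, 0, 1)]"
  have "well_presented ?m (0, 0, 0) ?iv ?gens [2, 2, 2] ?Rs"
    by code_simp
  moreover have "app_check (end_small ?m (0, 0, 0) ?iv [2, 2, 2] ?fe) ?m (0, 0, 0)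
      ?gens [2, 2, 2] ?Rs ?fe 3"
    by code_simp
  moreover have "app_check (aff_small ?m (0, 0, 0) ?iv [2, 2, 2] ?fa) ?m (0, 0, 0)
      ?gens [2, 2, 2] ?Rs ?fa 3"
    by code_simp
  ultimately show ?thesis
    by (intro app_le_check[where m = ?m])
      (auto simp: DirProd_group order_def card_cartesian_product carrier_integer_mod_group add_mod_eq)
qed

text \<open>In \<open>fe\<close> the order of the value at \<open>x\<close> never divides the order
  of \<open>x\<close>: rotations go to reflections and reflections to rotations of order 3. In
  \<open>fa\<close> every reflection is taken exactly twice; as constant maps are affine, no value
  could occur more often. The tables for \<open>dihedral 5\<close> and \<open>dihedral 7\<close>
  follow the same pattern, except that the latter sends the identity to a rotation in
  \<open>fe\<close>.\<close>

lemma app_le_D6: "endapp (dihedral 3) \<le> 0 \<and> affapp (dihedral 3) \<le> Suc 1"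
  by (rule app_le_dihedral[where
      fe = "[(1, True), (1, True), (0, True), (2, False), (1, False), (2, False)]" and
      fa = "[(0, True), (0, True), (1, True), (1, True), (2, True), (2, True)]"];
    code_simp)

lemma app_le_D8: "endapp (dihedral 4) \<le> 1 \<and> affapp (dihedral 4) \<le> Suc 1"
  by (rule app_le_dihedral[where
      fe = "[(3, False), (0, True), (2, True), (3, True), (3, False), (3, False), (1, False), (3,
        False)]" and
      fa = "[(1, False), (1, False), (3, False), (3, False), (0, False), (0, False), (2, False), (2,
        False)]"];
    code_simp)

lemma app_le_D10: "endapp (dihedral 5) \<le> 0 \<and> affapp (dihedral 5) \<le> Suc 1"
  by (rule app_le_dihedral[where
      fe = "[(1, True), (3, True), (4, True), (2, True), (2, True), (3, False), (4, False), (1,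
        False), (3, False), (3, False)]" and
      fa = "[(4, True), (1, True), (4, True), (3, True), (3, True), (0, True), (2, True), (1, True),
        (2, True), (0, True)]"];
    code_simp)

lemma app_le_D12: "endapp (dihedral 6) \<le> 1 \<and> affapp (dihedral 6) \<le> Suc 2"
  by (rule app_le_dihedral[where
      fe = "[(5, True), (0, False), (0, True), (4, False), (5, False), (3, False), (2, False), (5,
        False), (4, False), (1, False), (1, False), (2, False)]" and
      fa = "[(5, True), (0, False), (0, True), (4, False), (5, False), (3, False), (2, False), (5,
        False), (4, False), (1, False), (1, False), (2, False)]"];
    code_simp)

lemma app_le_D14: "endapp (dihedral 7) \<le> 0 \<and> affapp (dihedral 7) \<le> Suc 1"
  by (rule app_le_dihedral[where
      fe = "[(4, False), (0, True), (5, True), (5, True), (6, True), (0, True), (2, True), (3,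
        False), (6, False), (6, False), (3, False), (2, False), (6, False), (6, False)]" and
      fa = "[(4, True), (6, True), (5, True), (1, True), (1, True), (5, True), (6, True), (2, True),
        (2, True), (0, True), (3, True), (4, True), (3, True), (0, True)]"];
    code_simp)

lemma app_le_Dic8: "endapp (dicyclic 2) \<le> 1 \<and> affapp (dicyclic 2) \<le> Suc 2"
  by (rule app_le_dicyclic[where
      fe = "[(0, True), (0, True), (1, False), (0, True), (0, True), (0, False), (0, True), (2,
        False)]" and
      fa = "[(0, False), (1, False), (1, False), (0, True), (3, True), (0, True), (0, True), (2,
        False)]"];
    code_simp)

lemma app_le_Dic12: "endapp (dicyclic 3) \<le> 0 \<and> affapp (dicyclic 3) \<le> Suc 1"
  by (rule app_le_dicyclic[where
      fe = "[(2, False), (0, True), (1, False), (2, True), (5, False), (2, False), (5, False), (5,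
        False), (5, False), (1, False), (5, False), (1, False)]" and
      fa = "[(2, True), (0, False), (4, False), (3, True), (1, False), (5, False), (2, True), (2,
        False), (0, False), (1, True), (1, False), (4, True)]"];
    code_simp)

text \<open>In \<open>?fe\<close> the identity and the involutions go to elements of order 3, and
  elements of order 3 go to involutions. No endomorphism does this at any element, since the order
  of the value would have to divide that of the argument.\<close>

lemma app_le_tetra: "endapp (tetra) \<le> 0 \<and> affapp (tetra) \<le> Suc 2"
proof -
  let ?m = "tetra_mult" and ?iv = "tetra_inv"
  let ?gens = "[(True, False, 0), (False, True, 0), (False, False, 1)]"
  let ?Rs = "[[([0, 0], [])], [([1, 1], []), ([0, 1], [1, 0])],
        [([2, 2, 2], []), ([2, 0], [1, 2]), ([2, 1], [0, 1, 2])]]"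
  let ?fe = "[(True, False, 1), (False, True, 0), (False, True, 0), (False, True, 2), (True, True,
        0), (True, False, 0), (False, False, 1), (False, True, 0), (False, True, 0),
        (True, False, 2), (True, True, 0), (True, False, 0)]"
  let ?fa = "[(True, True, 0), (False, True, 0), (True, False, 0), (True, False, 0), (True, True, 2),
        (True, True, 2), (False, True, 2), (True, False, 0), (True, False, 1), (True,
        False, 1), (False, True, 0), (False, True, 0)]"
  have "well_presented ?m (False, False, 0) ?iv ?gens [2, 2, 3] ?Rs"
    by code_simp
  moreover have "app_check (end_small ?m (False, False, 0) ?iv [2, 2, 3] ?fe) ?m (False, False, 0)
      ?gens [2, 2, 3] ?Rs ?fe 0"
    by code_simp
  moreover have "app_check (aff_small ?m (False, False, 0) ?iv [2, 2, 3] ?fa) ?m (False, False, 0)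
      ?gens [2, 2, 3] ?Rs ?fa 2"
    by code_simp
  ultimately show ?thesis
    by (intro app_le_check[where m = ?m])
      (auto simp: group_tetra order_tetra tetra_mult_eq, auto simp: tetra_def)
qed

lemma app_le_Z2:
  "endapp (integer_mod_group 2) \<le> 1 \<and>
    affapp (integer_mod_group 2) \<le> Suc 1"
  by (rule app_le_integer_mod_group[where
      fe = "[1, 0]" and
      fa = "[1, 0]"];
    code_simp)

text \<open>The table \<open>fa\<close> is the polynomial \<open>2x^2 + 2x + 2\<close> over the
  field with three elements. An affine map is a polynomial of degree at most 1 and meets a quadratic
  one in at most two points. The tables \<open>fa\<close> for 5, 7, 11 and 13 below are quadratic as
  well.\<close>

lemma app_le_Z3:
  "endapp (integer_mod_group 3) \<le> 1 \<and>
    affapp (integer_mod_group 3) \<le> Suc 1"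
  by (rule app_le_integer_mod_group[where
      fe = "[2, 0, 2]" and
      fa = "[2, 0, 2]"];
    code_simp)

lemma app_le_Z4:
  "endapp (integer_mod_group 4) \<le> 1 \<and>
    affapp (integer_mod_group 4) \<le> Suc 1"
  by (rule app_le_integer_mod_group[where
      fe = "[2, 2, 1, 3]" and
      fa = "[2, 2, 1, 3]"];
    code_simp)

lemma app_le_Z5:
  "endapp (integer_mod_group 5) \<le> 1 \<and>
    affapp (integer_mod_group 5) \<le> Suc 1"
  by (rule app_le_integer_mod_group[where
      fe = "[1, 0, 3, 4, 3]" and
      fa = "[4, 3, 3, 4, 1]"];
    code_simp)

lemma app_le_Z6:
  "endapp (integer_mod_group 6) \<le> 1 \<and>
    affapp (integer_mod_group 6) \<le> Suc 1"
  by (rule app_le_integer_mod_group[where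
      fe = "[3, 4, 4, 2, 5, 5]" and
      fa = "[3, 4, 4, 2, 5, 5]"];
    code_simp)

lemma app_le_Z7:
  "endapp (integer_mod_group 7) \<le> 1 \<and>
    affapp (integer_mod_group 7) \<le> Suc 1"
  by (rule app_le_integer_mod_group[where
      fe = "[6, 0, 4, 1, 3, 5, 4]" and
      fa = "[3, 4, 0, 5, 5, 0, 4]"];
    code_simp)

lemma app_le_Z8:
  "endapp (integer_mod_group 8) \<le> 1 \<and>
    affapp (integer_mod_group 8) \<le> Suc 1"
  by (rule app_le_integer_mod_group[where
      fe = "[4, 2, 7, 3, 6, 0, 1, 1]" and
      fa = "[4, 2, 7, 3, 6, 0, 1, 1]"];
    code_simp)

lemma app_le_Z9:
  "endapp (integer_mod_group 9) \<le> 1 \<and>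
    affapp (integer_mod_group 9) \<le> Suc 1"
  by (rule app_le_integer_mod_group[where
      fe = "[3, 8, 8, 1, 1, 6, 5, 6, 4]" and
      fa = "[3, 8, 8, 1, 1, 6, 5, 6, 4]"];
    code_simp)

lemma app_le_Z10:
  "endapp (integer_mod_group 10) \<le> 1 \<and>
    affapp (integer_mod_group 10) \<le> Suc 1"
  by (rule app_le_integer_mod_group[where
      fe = "[5, 4, 7, 7, 5, 1, 2, 1, 8, 2]" and
      fa = "[5, 4, 7, 7, 5, 1, 2, 1, 8, 2]"];
    code_simp)

lemma app_le_Z11:
  "endapp (integer_mod_group 11) \<le> 1 \<and>
    affapp (integer_mod_group 11) \<le> Suc 1"
  by (rule app_le_integer_mod_group[where
      fe = "[3, 4, 0, 9, 9, 8, 4, 3, 1, 4, 10]" and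
      fa = "[10, 1, 4, 8, 2, 8, 4, 1, 10, 9, 9]"];
    code_simp)

lemma app_le_Z12:
  "endapp (integer_mod_group 12) \<le> 1 \<and>
    affapp (integer_mod_group 12) \<le> Suc 1"
  by (rule app_le_integer_mod_group[where
      fe = "[6, 8, 3, 5, 0, 10, 3, 10, 6, 7, 1, 11]" and
      fa = "[6, 8, 3, 5, 0, 10, 3, 10, 6, 7, 1, 11]"];
    code_simp)

text \<open>Here \<open>fa\<close> is \<open>x^2\<close>. In \<open>fe\<close> the value at 0 is not
  0, and the quotients of \<open>fe\<close> at \<open>x\<close> by \<open>x\<close>, for
  \<open>x\<close> not 0, are pairwise distinct, so no multiplication map agrees with it
  twice.\<close>

lemma app_le_Z13:
  "endapp (integer_mod_group 13) \<le> 1 \<and>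
    affapp (integer_mod_group 13) \<le> Suc 1"
  by (rule app_le_integer_mod_group[where
      fe = "[11, 9, 10, 0, 4, 8, 10, 10, 12, 5, 4, 5, 2]" and
      fa = "[0, 1, 4, 9, 3, 12, 10, 10, 12, 3, 9, 4, 1]"];
    code_simp)

lemma app_le_Z14:
  "endapp (integer_mod_group 14) \<le> 1 \<and>
    affapp (integer_mod_group 14) \<le> Suc 1"
  by (rule app_le_integer_mod_group[where
      fe = "[13, 2, 11, 1, 13, 9, 1, 11, 1, 7, 3, 6, 13, 13]" and
      fa = "[6, 12, 11, 13, 10, 12, 11, 3, 3, 10, 0, 9, 13, 6]"];
    code_simp)

lemma app_le_Z15:
  "endapp (integer_mod_group 15) \<le> 1 \<and>
    affapp (integer_mod_group 15) \<le> Suc 1"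
  by (rule app_le_integer_mod_group[where
      fe = "[3, 3, 11, 8, 13, 8, 2, 14, 2, 9, 4, 9, 13, 2, 7]" and
      fa = "[8, 11, 11, 6, 3, 2, 13, 7, 3, 2, 6, 7, 0, 10, 0]"];
    code_simp)

section \<open>Recognizing groups\<close>

context group
begin

section \<open>Consequences of the theorems of Lagrange and Sylow; powers of an element\<close>

lemma subgroup_card_dvd:
  assumes "subgroup K G" "subgroup S G" "K \<subseteq> S"
  shows "card K dvd card S"
proof -
  interpret S: group "G\<lparr>carrier := S\<rparr>" using assms(2) by (rule subgroup_imp_group)
  have "subgroup K (G\<lparr>carrier := S\<rparr>)" using assms by (simp add: subgroup_incl)
  from S.lagrange[OF this] show ?thesis by (simp add: order_def) (metis dvd_triv_right)
qed

text \<open>The order of the image is a multiple of \<open>card K\<close> and divides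
  \<open>q * card K\<close>, so its quotient by \<open>card K\<close> is 1 or \<open>q\<close>. The
  element \<open>s\<close> excludes 1; hence the homomorphism is onto, and bijective because the
  orders agree.\<close>

lemma iso_by_extension:
  assumes "group M" and fin: "finite (carrier G)" and \<phi>: "\<phi> \<in> hom M G" and "order M = order G"
    and K: "subgroup K G" "K \<subseteq> \<phi> ` carrier M" and s: "s \<in> \<phi> ` carrier M" "s \<notin> K"
    and order: "order G = q * card K" and q: "Factorial_Ring.prime q"
  shows "G \<cong> M"
proof -
  interpret M: group M by fact
  interpret \<phi>: group_hom M G \<phi> by unfold_locales (rule \<phi>)
  let ?S = "\<phi> ` carrier M"
  have S: "subgroup ?S G" by (rule \<phi>.img_is_subgroup)
  then have sub: "?S \<subseteq> carrier G" by (rule subgroup.subset)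
  have finS: "finite ?S" and finK: "finite K" using fin sub K(2) by (meson finite_subset)+
  obtain k where k: "card ?S = card K * k"
    using subgroup_card_dvd[OF K(1) S K(2)] by (elim dvdE)
  have "card K > 0" using K(1) finK subgroup.one_closed card_gt_0_iff by blast
  moreover have "card ?S dvd order G" using lagrange[OF S] by (metis dvd_triv_right)
  ultimately have "k dvd q" using k order by (simp add: mult.commute)
  moreover have "card K < card ?S" using K(2) s finS by (intro psubset_card_mono) auto
  then have "k \<noteq> 1" using k by auto
  ultimately have "k = q" using q by (meson prime_nat_iff)
  then have "card ?S = card (carrier G)" using k order by (simp add: order_def mult.commute)
  then have eq: "?S = carrier G" using sub fin by (simp add: card_subset_eq)
  have "card (carrier M) = card (carrier G)" using assms(4) by (simp add: order_def)
  moreover have "finite (carrier M)"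
    using calculation fin by (metis card.infinite card_0_eq ex_in_conv one_closed)
  ultimately have "inj_on \<phi> (carrier M)" using eq by (simp add: eq_card_imp_inj_on)
  then have "\<phi> \<in> iso M G" using \<phi> eq by (simp add: iso_def bij_betw_def)
  then show ?thesis using M.iso_sym is_isoI by blast
qed

text \<open>Sylow's theorem with exponent 1 yields a subgroup of order \<open>p\<close>, in which
  any nontrivial element has order \<open>p\<close>.\<close>

lemma cauchy:
  assumes fin: "finite (carrier G)" and p: "Factorial_Ring.prime p" "p dvd order G"
  obtains x where "x \<in> carrier G" "ord x = p"
proof -
  obtain m where "order G = p ^ 1 * m" using p(2) by auto
  then obtain H where H: "subgroup H G" "card H = p"
    using sylow_thm[OF p(1) group_axioms _ fin] by (metis power_one_right)
  interpret H: group "G\<lparr>carrier := H\<rparr>" using H(1) by (rule subgroup_imp_group)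
  have "1 < card H" using p(1) H(2) prime_gt_1_nat by simp
  then obtain x where x: "x \<in> H" "x \<noteq> \<one>" by (metis card_le_Suc0_iff_eq card.infinite not_less One_nat_def H(1) subgroup.one_closed zero_le)
  then have xG: "x \<in> carrier G" using subgroup.mem_carrier[OF H(1)] by blast
  have "generate G {x} \<subseteq> H" using x by (simp add: generate_subgroup_incl H(1))
  then have "card (generate G {x}) dvd card H"
    using subgroup_card_dvd[OF generate_is_subgroup H(1)] xG by simp
  then have "ord x dvd p" using generate_pow_card[OF xG] H(2) by simp
  moreover have "ord x \<noteq> 1" using x xG ord_eq_1 by simp
  ultimately show ?thesis using that xG p(1) by (meson prime_nat_iff)
qed

lemma ord_mult_coprime:
  assumes "x \<in> carrier G" "y \<in> carrier G" "x \<otimes> y = y \<otimes> x" "coprime (ord x) (ord y)"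
  shows "ord (x \<otimes> y) = ord x * ord y"
proof (rule dvd_antisym)
  have pow: "(x \<otimes> y) [^] (n::nat) = x [^] n \<otimes> y [^] n" for n
    using assms by (intro pow_mult_distrib) auto
  have "x [^] (ord x * ord y) = \<one>" "y [^] (ord x * ord y) = \<one>"
    using assms by (simp_all add: pow_eq_id)
  then show "ord (x \<otimes> y) dvd ord x * ord y"
    using pow[of "ord x * ord y"] assms(1,2) pow_eq_id[of "x \<otimes> y" "ord x * ord y"] by simp
  let ?n = "ord (x \<otimes> y)"
  have one: "(x \<otimes> y) [^] (?n * k) = \<one>" for k
    by (rule pow_eq_id[THEN iffD2]) (use assms(1,2) in auto)
  \<comment> \<open>An exponent divisible by \<open>ord y\<close> removes the factor
    \<open>y\<close> and leaves a trivial power of \<open>x\<close>; likewise with the roles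
    exchanged.\<close>
  have "x [^] (?n * ord y) \<otimes> y [^] (?n * ord y) = \<one>"
    "x [^] (?n * ord x) \<otimes> y [^] (?n * ord x) = \<one>"
    using pow one by metis+
  moreover have "y [^] (?n * ord y) = \<one>" "x [^] (?n * ord x) = \<one>"
    using assms(1,2) pow_eq_id dvd_triv_right by blast+
  ultimately have "ord x dvd ?n * ord y" "ord y dvd ?n * ord x"
    using assms(1,2) pow_eq_id[of x "?n * ord y"] pow_eq_id[of y "?n * ord x"]
    by (metis nat_pow_closed r_one, metis nat_pow_closed l_one)
  then have "ord x dvd ?n" "ord y dvd ?n"
    using assms(4) by (simp_all add: coprime_dvd_mult_left_iff coprime_commute)
  then show "ord x * ord y dvd ?n" using assms(4) by (simp add: divides_mult)
qed

lemma powers_subgroup: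
  assumes "x \<in> carrier G"
  shows "subgroup (range (\<lambda>i::int. x [^] i)) G" and "card (range (\<lambda>i::int. x [^] i)) = ord x"
proof -
  have eq: "generate G {x} = range (\<lambda>i::int. x [^] i)"
    using generate_pow[OF assms] by auto
  show "subgroup (range (\<lambda>i::int. x [^] i)) G"
    using generate_is_subgroup[of "{x}"] assms eq by simp
  show "card (range (\<lambda>i::int. x [^] i)) = ord x"
    using generate_pow_card[OF assms] eq by simp
qed

lemma int_pow_in_range_nat:
  assumes "finite (carrier G)" "x \<in> carrier G" "y \<in> range (\<lambda>i::int. x [^] i)"
  obtains k where "k < ord x" "y = x [^] (k::nat)"
proof -
  obtain i :: int where i: "y = x [^] i" using assms by auto
  have pos: "ord x > 0" using ord_ge_1 assms by fastforce
  have "x [^] i = x [^] (i mod int (ord x))" using assms by (simp add: int_pow_mod)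
  also have "\<dots> = x [^] nat (i mod int (ord x))"
    using pos by (metis int_pow_int nat_0_le of_nat_0_less_iff pos_mod_sign)
  finally show ?thesis using that[of "nat (i mod int (ord x))"] i pos by (simp add: nat_less_iff)
qed

lemma iso_cyclic:
  assumes "finite (carrier G)" "x \<in> carrier G" "ord x = order G"
  shows "G \<cong> integer_mod_group (order G)"
proof -
  have pos: "order G > 0" using assms(1) order_gt_0_iff_finite by blast
  let ?\<phi> = "\<lambda>i::int. x [^] i"
  have hom: "?\<phi> \<in> hom (integer_mod_group (order G)) G"
    using hom_integer_mod_group[OF assms(2), of "order G"] assms by (metis pow_ord_eq_1)
  have "range ?\<phi> = carrier G"
    using powers_subgroup[OF assms(2)] subgroup.subset assms by (metis card_subset_eq order_def)
  moreover have "range ?\<phi> = ?\<phi> ` carrier (integer_mod_group (order G))"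
  proof
    show "range ?\<phi> \<subseteq> ?\<phi> ` carrier (integer_mod_group (order G))"
    proof
      fix y assume "y \<in> range ?\<phi>"
      then obtain k where "k < ord x" "y = x [^] (k::nat)"
        using int_pow_in_range_nat assms by metis
      then show "y \<in> ?\<phi> ` carrier (integer_mod_group (order G))"
        using assms pos by (auto simp: carrier_integer_mod_group image_iff intro!: bexI[of _ "int k"] simp: int_pow_int)
    qed
  qed auto
  moreover have "card (carrier (integer_mod_group (order G))) = card (carrier G)"
    using pos by (simp add: carrier_integer_mod_group order_def)
  ultimately have "inj_on ?\<phi> (carrier (integer_mod_group (order G)))"
    using pos by (intro eq_card_imp_inj_on) (auto simp: carrier_integer_mod_group)
  then have "?\<phi> \<in> iso (integer_mod_group (order G)) G"
    using hom \<open>range ?\<phi> = carrier G\<close> \<open>range ?\<phi> = _ ` _\<close> by (simp add: iso_def bij_betw_def)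
  then show ?thesis using group.iso_sym[OF group_integer_mod_group] is_isoI by blast
qed

lemma conj_int_pow:
  assumes "y \<in> carrier G" "x \<in> carrier G"
  shows "y \<otimes> x [^] (i::int) \<otimes> inv y = (y \<otimes> x \<otimes> inv y) [^] i"
proof -
  have "(\<lambda>x. y \<otimes> x \<otimes> inv y) \<in> hom G G"
    using assms(1) by (intro homI) (simp_all add: m_assoc inv_solve_left)
  then show ?thesis using hom_int_pow[of _ G G x i] assms group_axioms by simp
qed

text \<open>The double coset of the cyclic group \<open>H = \<langle>c\<rangle>\<close> at an element not normalizing it has \<open>p\<^sup>2\<close>
  elements, none of them in \<open>H\<close>.\<close>

lemma double_coset:
  fixes c y defines "H \<equiv> range (\<lambda>i::int. c [^] i)"
    and "D \<equiv> (\<lambda>(i::int, j::int). c [^] i \<otimes> y \<otimes> c [^] j) ` (UNIV \<times> UNIV)"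
  assumes fin: "finite (carrier G)" and c: "c \<in> carrier G" and p: "Factorial_Ring.prime (ord c)"
    and y: "y \<in> carrier G" "y \<otimes> c \<otimes> inv y \<notin> H"
  shows "ord c ^ 2 + ord c \<le> order G"
    and "order G \<le> ord c ^ 2 + ord c \<Longrightarrow> carrier G = H \<union> D"
proof -
  let ?p = "int (ord c)"
  let ?f = "\<lambda>(i::int, j::int). c [^] i \<otimes> y \<otimes> c [^] j"
  let ?D = "?f ` ({0..<?p} \<times> {0..<?p})"
  have pos: "?p > 0" using p prime_gt_0_nat by auto
  have H: "subgroup H G" "card H = ord c" unfolding H_def using powers_subgroup[OF c] by auto
  have pow_eq: "c [^] (i::int) = c [^] j \<longleftrightarrow> ?p dvd i - j" for i j
    using int_pow_eq[OF c, of i j] by (metis dvd_minus_iff minus_diff_eq)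
  have "inj_on ?f ({0..<?p} \<times> {0..<?p})"
  proof (rule inj_onI, clarsimp)
    fix i j k l
    assume bounds: "0 \<le> i" "i < ?p" "0 \<le> j" "j < ?p" "0 \<le> k" "k < ?p" "0 \<le> l" "l < ?p"
      and eq: "c [^] i \<otimes> y \<otimes> c [^] j = c [^] k \<otimes> y \<otimes> c [^] l"
    have "c [^] (- k) \<otimes> (c [^] i \<otimes> y \<otimes> c [^] j) \<otimes> c [^] (- j) \<otimes> inv y
      = c [^] (- k) \<otimes> (c [^] k \<otimes> y \<otimes> c [^] l) \<otimes> c [^] (- j) \<otimes> inv y"
      by (simp add: eq)
    moreover have "c [^] (- k) \<otimes> (c [^] i \<otimes> y \<otimes> c [^] j) \<otimes> c [^] (- j) \<otimes> inv y = c [^] (i - k)"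
    proof -
      have "c [^] (- k) \<otimes> (c [^] i \<otimes> y \<otimes> c [^] j) \<otimes> c [^] (- j) \<otimes> inv y
        = c [^] (- k) \<otimes> c [^] i \<otimes> (y \<otimes> (c [^] j \<otimes> c [^] (- j)) \<otimes> inv y)"
        using c y by (simp add: m_assoc)
      then show ?thesis using c y by (simp add: int_pow_mult[symmetric])
    qed
    moreover have "c [^] (- k) \<otimes> (c [^] k \<otimes> y \<otimes> c [^] l) \<otimes> c [^] (- j) \<otimes> inv y
      = y \<otimes> c [^] (l - j) \<otimes> inv y"
    proof -
      have "c [^] (- k) \<otimes> (c [^] k \<otimes> y \<otimes> c [^] l) \<otimes> c [^] (- j) \<otimes> inv y
        = c [^] (- k) \<otimes> c [^] k \<otimes> (y \<otimes> (c [^] l \<otimes> c [^] (- j)) \<otimes> inv y)"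
        using c y by (simp add: m_assoc)
      then show ?thesis using c y by (simp add: int_pow_mult[symmetric])
    qed
    ultimately have eq': "c [^] (i - k) = (y \<otimes> c \<otimes> inv y) [^] (l - j)"
      using conj_int_pow[OF y(1) c] by simp
    \<comment> \<open>If \<open>l - j\<close> were invertible modulo the prime \<open>?p\<close>, a
      suitable power of \<open>eq'\<close> would put the conjugate of \<open>c\<close> itself into
      \<open>H\<close>.\<close>
    have "?p dvd l - j"
    proof (rule ccontr)
      assume "\<not> ?p dvd l - j"
      then have "coprime ?p (l - j)" using p by (simp add: prime_imp_coprime)
      then obtain u v where "u * (l - j) + v * ?p = 1"
        by (metis bezout_int coprime_commute coprime_imp_gcd_eq_1)
      then have "(l - j) * u = 1 + ?p * (- v)" by (simp add: algebra_simps)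
      then have "c [^] ((i - k) * u) = (y \<otimes> c \<otimes> inv y) [^] (1 + ?p * (- v))"
        using eq' c y by (metis int_pow_pow m_closed inv_closed)
      also have "\<dots> = y \<otimes> c [^] (1 + ?p * (- v)) \<otimes> inv y"
        using conj_int_pow[OF y(1) c] by simp
      also have "c [^] (1 + ?p * (- v)) = c"
        using pow_eq[of "1 + ?p * (- v)" 1] c by simp
      finally show False using y(2) unfolding H_def by (metis rangeI)
    qed
    then have "l = j" using bounds by (metis mod_pos_pos_trivial mod_eq_dvd_iff)
    moreover from this have "c [^] (i - k) = c [^] (0::int)" using eq' y c by simp
    then have "?p dvd i - k" using pow_eq[of "i - k" 0] by simp
    then have "i = k" using bounds by (metis mod_pos_pos_trivial mod_eq_dvd_iff)
    ultimately show "i = k \<and> j = l" by simp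
  qed
  then have "card ?D = ord c ^ 2"
    by (simp add: card_image card_cartesian_product power2_eq_square)
  moreover have "?D \<inter> H = {}"
  proof (rule ccontr)
    assume "?D \<inter> H \<noteq> {}"
    then obtain i j k :: int where "c [^] i \<otimes> y \<otimes> c [^] j = c [^] k" by (auto simp: H_def)
    moreover have "c [^] (- i) \<otimes> (c [^] i \<otimes> y \<otimes> c [^] j) \<otimes> c [^] (- j) = y"
    proof -
      have "c [^] (- i) \<otimes> (c [^] i \<otimes> y \<otimes> c [^] j) \<otimes> c [^] (- j)
        = c [^] (- i) \<otimes> c [^] i \<otimes> (y \<otimes> (c [^] j \<otimes> c [^] (- j)))"
        using c y(1) by (simp add: m_assoc)
      then show ?thesis using c y(1) by (simp add: int_pow_mult[symmetric])
    qed
    ultimately have "y = c [^] (- i) \<otimes> c [^] k \<otimes> c [^] (- j)" by simp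
    \<comment> \<open>A meeting point would make \<open>y\<close> a power of \<open>c\<close>, which
      then commutes with \<open>c\<close> and normalizes \<open>H\<close>.\<close>
    then have "y = c [^] (k - i - j)" using c by (simp add: int_pow_mult[symmetric])
    then have "y \<otimes> c \<otimes> inv y = c"
      using c by (metis int_pow_1 int_pow_mult add.commute inv_solve_right int_pow_closed m_closed)
    then show False using y(2) c unfolding H_def by (metis int_pow_1 rangeI)
  qed
  moreover have sub: "H \<union> ?D \<subseteq> carrier G" using c y H by (auto simp: H_def)
  moreover have "finite H" "finite ?D" using sub fin by (auto intro: finite_subset)
  ultimately have card: "card (H \<union> ?D) = ord c ^ 2 + ord c"
    using H(2) by (subst card_Un_disjoint) auto
  then show "ord c ^ 2 + ord c \<le> order G"
    using card_mono[OF fin sub] by (simp add: order_def)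
  assume "order G \<le> ord c ^ 2 + ord c"
  then have "H \<union> ?D = carrier G"
    using card_mono[OF fin sub] card by (intro card_subset_eq fin sub) (simp add: order_def)
  moreover have "?D \<subseteq> D" "D \<subseteq> carrier G" using c y by (auto simp: D_def)
  ultimately show "carrier G = H \<union> D" using H(1) subgroup.subset by blast
qed

end

section \<open>Isomorphisms with the models; groups of order p, p^2, 2p and 15\<close>

context group
begin

lemma iso_by_powers:
  assumes "group M" "finite (carrier G)" and \<phi>: "\<phi> \<in> hom M G" and "order M = order G"
    and c: "c \<in> \<phi> ` carrier M" and s: "s \<in> \<phi> ` carrier M" "s \<notin> range (\<lambda>i::int. c [^] i)"
    and "order G = q * ord c" "Factorial_Ring.prime q"
  shows "G \<cong> M"
proof -
  interpret M: group M by fact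
  interpret \<phi>: group_hom M G \<phi> by unfold_locales (rule \<phi>)
  have cG: "c \<in> carrier G" using c by auto
  have sub: "range (\<lambda>i::int. c [^] i) \<subseteq> \<phi> ` carrier M"
  proof -
    obtain x where x: "x \<in> carrier M" "c = \<phi> x" using c by auto
    then have "c [^] i = \<phi> (x [^]\<^bsub>M\<^esub> i)" for i :: int by (simp add: \<phi>.hom_int_pow)
    then show ?thesis using x by auto
  qed
  show ?thesis
    using iso_by_extension[OF assms(1-4) powers_subgroup(1)[OF cG] sub s, of q] assms
      powers_subgroup(2)[OF cG] by simp
qed

lemma conj_eq_iff: "y \<in> carrier G \<Longrightarrow> x \<in> carrier G \<Longrightarrow> z \<in> carrier G \<Longrightarrow>
    y \<otimes> x \<otimes> inv y = z \<longleftrightarrow> y \<otimes> x = z \<otimes> y"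
  by (metis inv_solve_right m_closed)

lemma conj_iterate:
  assumes y: "y \<in> carrier G" and c: "c \<in> carrier G" and "y \<otimes> c \<otimes> inv y = c [^] (k::int)"
  shows "y [^] n \<otimes> c \<otimes> inv (y [^] (n::nat)) = c [^] (k ^ n)"
proof (induction n)
  case (Suc n)
  have "y [^] Suc n \<otimes> c \<otimes> inv (y [^] Suc n) = y [^] n \<otimes> (y \<otimes> c \<otimes> inv y) \<otimes> inv (y [^] n)"
    using c y by (simp add: m_assoc inv_mult_group)
  also have "\<dots> = (c [^] (k ^ n)) [^] k"
    using assms Suc conj_int_pow[of "y [^] n" c k] by simp
  finally show ?case using c by (simp add: int_pow_pow mult.commute)
qed (use c in simp)

text \<open>There is no room for a double coset beside the cyclic group of \<open>c\<close>, so this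
  group is normal and \<open>y\<close> acts on it as a \<open>k\<close>-th power map. Conjugation by
  \<open>y\<close> iterated \<open>ord y\<close> times is the identity, hence the
  congruence.\<close>

lemma conj_prime_order:
  assumes fin: "finite (carrier G)" and c: "c \<in> carrier G" and p: "Factorial_Ring.prime (ord c)"
    and "order G < ord c ^ 2 + ord c" and y: "y \<in> carrier G"
  obtains k :: int where "y \<otimes> c = c [^] k \<otimes> y" "k ^ ord y mod int (ord c) = 1 mod int (ord c)"
proof -
  have "y \<otimes> c \<otimes> inv y \<in> range (\<lambda>i::int. c [^] i)"
    using double_coset(1)[OF fin c p y] assms(4) by linarith
  then obtain k :: int where k: "y \<otimes> c \<otimes> inv y = c [^] k" by auto
  have "c [^] (k ^ ord y) = c [^] (1::int)"
    using conj_iterate[OF y c k, of "ord y"] c y by simp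
  then have "int (ord c) dvd 1 - k ^ ord y" using int_pow_eq[OF c] by blast
  then have "k ^ ord y mod int (ord c) = 1 mod int (ord c)"
    by (metis mod_eq_dvd_iff)
  then show ?thesis using that k conj_eq_iff[of y c "c [^] k"] c y by simp
qed

lemma cong_int_pow:
  assumes "x \<in> carrier G" "i mod int (ord x) = j mod int (ord x)"
  shows "x [^] i = x [^] j"
  using assms int_pow_eq[of x i j] by (metis mod_eq_dvd_iff dvd_diff_commute)

lemma iso_DirProd:
  assumes "finite (carrier G)" "x \<in> carrier G" "y \<in> carrier G" "x \<otimes> y = y \<otimes> x"
    and "ord x = n" "n > 1" "y [^] m = \<one>" "Factorial_Ring.prime m" "order G = n * m"
    and "y \<notin> range (\<lambda>i::int. x [^] i)"
  shows "G \<cong> integer_mod_group n \<times>\<times> integer_mod_group m"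
proof (rule iso_by_powers[where c = x and s = y])
  let ?\<phi> = "\<lambda>(a::int, b::int). x [^] a \<otimes> y [^] b"
  have m: "m > 1" using assms(8) prime_gt_1_nat by auto
  \<comment> \<open>Commutation spreads to powers one factor at a time: conjugation by
    \<open>y\<close> fixes the powers of \<open>x\<close>, so conjugation by a power of
    \<open>x\<close> fixes \<open>y\<close> and then its powers.\<close>
  have comm: "y [^] (b::int) \<otimes> x [^] (a::int) = x [^] a \<otimes> y [^] b" for a b
  proof -
    have "y \<otimes> x \<otimes> inv y = x" using assms conj_eq_iff[of y x x] by simp
    then have "y \<otimes> x [^] a \<otimes> inv y = x [^] a"
      using conj_int_pow[of y x a] assms by simp
    then have "x [^] a \<otimes> y \<otimes> inv (x [^] a) = y"
      using assms conj_eq_iff[of y "x [^] a" "x [^] a"] conj_eq_iff[of "x [^] a" y y] by simp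
    then have "x [^] a \<otimes> y [^] b \<otimes> inv (x [^] a) = y [^] b"
      using conj_int_pow[of "x [^] a" y b] assms by simp
    then show ?thesis using assms conj_eq_iff[of "x [^] a" "y [^] b" "y [^] b"] by simp
  qed
  show "?\<phi> \<in> hom (integer_mod_group n \<times>\<times> integer_mod_group m) G"
    using assms hom_integer_mod_group[of x n] hom_integer_mod_group[of y m]
    by (intro hom_DirProd comm) auto
  have "?\<phi> (1, 0) = x" "?\<phi> (0, 1) = y" using assms by simp_all
  moreover have "(1, 0) \<in> carrier (integer_mod_group n \<times>\<times> integer_mod_group m)"
    "(0, 1) \<in> carrier (integer_mod_group n \<times>\<times> integer_mod_group m)"
    using assms m by (auto simp: carrier_integer_mod_group)
  ultimately show "x \<in> ?\<phi> ` carrier (integer_mod_group n \<times>\<times> integer_mod_group m)"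
    "y \<in> ?\<phi> ` carrier (integer_mod_group n \<times>\<times> integer_mod_group m)" by (metis imageI)+
  show "order (integer_mod_group n \<times>\<times> integer_mod_group m) = order G"
    using assms m by (simp add: order_def card_cartesian_product carrier_integer_mod_group)
qed (use assms in \<open>auto simp: DirProd_group mult.commute\<close>)

lemma iso_dihedral:
  assumes "finite (carrier G)" "r \<in> carrier G" "s \<in> carrier G" "ord r = n" "n > 1"
    and "s \<otimes> s = \<one>" "s \<otimes> r = inv r \<otimes> s" "order G = 2 * n" "s \<notin> range (\<lambda>i::int. r [^] i)"
  shows "G \<cong> dihedral n"
proof (rule iso_by_powers[where c = r and s = s])
  let ?\<phi> = "\<lambda>(i::int, a). r [^] i \<otimes> (if a then s else \<one>)"
  show "?\<phi> \<in> hom (dihedral n) G"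
    using assms by (intro hom_dihedral) auto
  have "?\<phi> (1, False) = r" "?\<phi> (0, True) = s" using assms by simp_all
  moreover have "(1, False) \<in> carrier (dihedral n)" "(0, True) \<in> carrier (dihedral n)"
    using assms by (auto simp: dihedral_def)
  ultimately show "r \<in> ?\<phi> ` carrier (dihedral n)" "s \<in> ?\<phi> ` carrier (dihedral n)"
    by (metis imageI)+
qed (use assms in \<open>auto simp: group_dihedral order_dihedral\<close>)

lemma iso_dicyclic:
  assumes "finite (carrier G)" "r \<in> carrier G" "s \<in> carrier G" "ord r = 2 * n" "n > 0"
    and "s \<otimes> s = r [^] n" "s \<otimes> r = inv r \<otimes> s" "order G = 4 * n" "s \<notin> range (\<lambda>i::int. r [^] i)"
  shows "G \<cong> dicyclic n"
proof (rule iso_by_powers[where c = r and s = s])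
  let ?\<phi> = "\<lambda>(i::int, a). r [^] i \<otimes> (if a then s else \<one>)"
  show "?\<phi> \<in> hom (dicyclic n) G"
    using assms pow_ord_eq_1[of r] by (intro hom_dicyclic) auto
  have "?\<phi> (1, False) = r" "?\<phi> (0, True) = s" using assms by simp_all
  moreover have "(1, False) \<in> carrier (dicyclic n)" "(0, True) \<in> carrier (dicyclic n)"
    using assms by (auto simp: dicyclic_def)
  ultimately show "r \<in> ?\<phi> ` carrier (dicyclic n)" "s \<in> ?\<phi> ` carrier (dicyclic n)"
    by (metis imageI)+
qed (use assms in \<open>auto simp: group_dicyclic order_dicyclic\<close>)

lemma square_eq_one_commute:
  assumes "x \<in> carrier G" "y \<in> carrier G"
    and "x \<otimes> x = \<one>" "y \<otimes> y = \<one>" "(x \<otimes> y) \<otimes> (x \<otimes> y) = \<one>"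
  shows "x \<otimes> y = y \<otimes> x"
  using assms by (metis inv_equality inv_mult_group m_closed)

lemma not_in_powers:
  assumes "finite (carrier G)" "x \<in> carrier G" "ord x < order G"
  obtains y where "y \<in> carrier G" "y \<notin> range (\<lambda>i::int. x [^] i)"
proof -
  have "range (\<lambda>i::int. x [^] i) \<noteq> carrier G"
    using powers_subgroup(2)[OF assms(2)] assms(3) by (auto simp: order_def)
  then show ?thesis using that subgroup.subset[OF powers_subgroup(1)[OF assms(2)]] by blast
qed

lemma order_prime:
  assumes "finite (carrier G)" "Factorial_Ring.prime (order G)"
  shows "G \<cong> integer_mod_group (order G)"
  using cauchy[OF assms(1,2)] iso_cyclic[OF assms(1)] by (metis dvd_refl)

lemma not_cyclic_prime_square:
  assumes "finite (carrier G)" "order G = p * p" "Factorial_Ring.prime p"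
    and "\<not> G \<cong> integer_mod_group (order G)" "y \<in> carrier G"
  shows "y [^] p = \<one>"
proof -
  have "ord y dvd p ^ 2" using ord_dvd_group_order[of y] assms by (simp add: power2_eq_square)
  then obtain i where "i \<le> 2" "ord y = p ^ i" using assms(3) by (metis divides_primepow_nat)
  moreover have "ord y \<noteq> p ^ 2"
    using iso_cyclic[of y] assms by (auto simp: power2_eq_square)
  ultimately have "ord y dvd p" by (auto simp: le_Suc_eq numeral_2_eq_2)
  then show ?thesis using assms(5) by (simp add: pow_eq_id)
qed

lemma order_prime_square:
  assumes fin: "finite (carrier G)" and p: "p \<in> {2, 3}" and order: "order G = p * p"
  shows "G \<cong> integer_mod_group (p * p) \<or> G \<cong> integer_mod_group p \<times>\<times> integer_mod_group p"
proof (rule disjCI)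
  assume nc: "\<not> G \<cong> integer_mod_group p \<times>\<times> integer_mod_group p"
  have prime: "Factorial_Ring.prime p" using p by auto
  show "G \<cong> integer_mod_group (p * p)"
  proof (rule ccontr)
    assume "\<not> G \<cong> integer_mod_group (p * p)"
    then have pow: "y [^] p = \<one>" if "y \<in> carrier G" for y
      using not_cyclic_prime_square[OF fin order prime] order that by simp
    obtain c where c: "c \<in> carrier G" "ord c = p"
      using cauchy[OF fin prime] order by auto
    have "ord c < order G" using c p order by auto
    then obtain y where y: "y \<in> carrier G" "y \<notin> range (\<lambda>i::int. c [^] i)"
      using not_in_powers[OF fin c(1)] by blast
    obtain k :: int where k: "y \<otimes> c = c [^] k \<otimes> y" "k ^ ord y mod int (ord c) = 1 mod int (ord c)"
      using conj_prime_order[OF fin c(1) _ _ y(1)] c order prime prime_gt_0_nat[OF prime]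
      by (metis less_add_same_cancel1 power2_eq_square)
    have "ord y dvd p" using pow y by (simp add: pow_eq_id)
    moreover have "ord y \<noteq> 1" using y ord_eq_1[OF y(1)] by (metis int_pow_0 rangeI)
    ultimately have "ord y = p" using prime by (meson prime_nat_iff)
    then have "k ^ p mod int p = 1 mod int p" using k(2) c by simp
    \<comment> \<open>This is Fermat's congruence of \<open>k^p\<close> and \<open>k\<close> modulo
      \<open>p\<close>, read off from the residues for the two primes in question.\<close>
    then have "k mod int p = 1 mod int p"
    proof -
      have "k mod int p = 0 \<or> k mod int p = 1 \<or> k mod int p = 2"
        using p by auto
      moreover have "(k mod int p) ^ p mod int p = 1 mod int p"
        using \<open>k ^ p mod int p = 1 mod int p\<close> by (simp add: power_mod)
      ultimately show ?thesis using p by auto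
    qed
    then have "c [^] k = c" using cong_int_pow[of c k 1] c by simp
    then have "c \<otimes> y = y \<otimes> c" using k by simp
    then show False
      using nc iso_DirProd[OF fin c(1) y(1), of p p] c y pow prime order prime_gt_1_nat by auto
  qed
qed

text \<open>An element \<open>d\<close> of order 3 acts on the group of order 5 through an exponent
  with cube 1 modulo 5. The unit group modulo 5 has order 4, prime to 3, so the exponent is 1, and
  \<open>c \<otimes> d\<close> has order 15.\<close>

lemma order_15:
  assumes fin: "finite (carrier G)" and order: "order G = 15"
  shows "G \<cong> integer_mod_group 15"
proof -
  obtain c where c: "c \<in> carrier G" "ord c = 5" using cauchy[OF fin, of 5] order by auto
  obtain d where d: "d \<in> carrier G" "ord d = 3" using cauchy[OF fin, of 3] order by auto
  obtain k :: int where k: "d \<otimes> c = c [^] k \<otimes> d" "k ^ ord d mod int (ord c) = 1 mod int (ord c)"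
    using conj_prime_order[OF fin c(1) _ _ d(1)] c order by auto
  have "(k mod 5) ^ 3 mod 5 = 1 mod 5" using k(2) c d by (simp add: power_mod)
  moreover have "k mod 5 \<in> {0, 1, 2, 3, 4}" by auto
  ultimately have "k mod 5 = 1 mod 5" by auto
  then have "c [^] k = c" using cong_int_pow[of c k 1] c by simp
  moreover have "coprime (5::nat) 3" by (simp add: coprime_iff_gcd_eq_1 gcd_non_0_nat)
  ultimately have "ord (c \<otimes> d) = 15"
    using ord_mult_coprime[OF c(1) d(1)] k c d by simp
  then show ?thesis using iso_cyclic[OF fin, of "c \<otimes> d"] c d order by simp
qed

lemma order_2p:
  assumes fin: "finite (carrier G)" and order: "order G = 2 * p"
    and p: "Factorial_Ring.prime p" "odd p"
  shows "G \<cong> integer_mod_group (2 * p) \<or> G \<cong> dihedral p"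
proof -
  obtain c where c: "c \<in> carrier G" "ord c = p" using cauchy[OF fin p(1)] order by auto
  obtain d where d: "d \<in> carrier G" "ord d = 2" using cauchy[OF fin two_is_prime_nat] order by auto
  have d2: "d \<otimes> d = \<one>" using d pow_ord_eq_1[OF d(1)] by (simp add: numeral_2_eq_2)
  have "2 < p" using p prime_gt_1_nat[OF p(1)] by (cases "p = 2") auto
  then have "order G < ord c ^ 2 + ord c"
    using c order by (simp add: power2_eq_square)
  then obtain k :: int where k: "d \<otimes> c = c [^] k \<otimes> d" "k ^ ord d mod int (ord c) = 1 mod int (ord c)"
    using conj_prime_order[OF fin c(1) _ _ d(1)] c p by auto
  \<comment> \<open>The involution acts through a square root of 1 modulo the prime, which is 1 or
    -1: the cyclic and the dihedral case.\<close>
  have "int p dvd (k - 1) * (k + 1)"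
    using k(2) c d by (simp add: mod_eq_dvd_iff algebra_simps power2_eq_square)
  then have "int p dvd k - 1 \<or> int p dvd k - (- 1)"
    using p(1) by (simp add: prime_dvd_mult_iff)
  then have "c [^] k = c \<or> c [^] k = inv c"
    using cong_int_pow[OF c(1), of k 1] cong_int_pow[OF c(1), of k "- 1"] c
    by (auto simp: mod_eq_dvd_iff int_pow_neg)
  then show ?thesis
  proof
    assume "c [^] k = c"
    then have "ord (c \<otimes> d) = 2 * p"
      using ord_mult_coprime[OF c(1) d(1)] k c d p by simp
    then show ?thesis using iso_cyclic[OF fin, of "c \<otimes> d"] c d order by simp
  next
    assume inv: "c [^] k = inv c"
    \<comment> \<open>A power of \<open>c\<close> satisfies \<open>d^p = 1\<close>, which is
      impossible for an involution and odd \<open>p\<close>.\<close>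
    have "d \<notin> range (\<lambda>i::int. c [^] i)"
    proof
      assume "d \<in> range (\<lambda>i::int. c [^] i)"
      then obtain j where j: "d = c [^] (j::nat)" using int_pow_in_range_nat[OF fin c(1)] by metis
      then have "d [^] p = \<one>" using c by (metis nat_pow_pow nat_pow_one pow_ord_eq_1 mult.commute)
      then show False using d p by (simp add: pow_eq_id)
    qed
    then show ?thesis
      using iso_dihedral[OF fin c(1) d(1)] c d d2 k inv order \<open>2 < p\<close> by auto
  qed
qed

end

section \<open>Groups of order 8\<close>

context group
begin

text \<open>By counting, the coset \<open>x K\<close> is the complement of \<open>K\<close>. If
  \<open>x \<otimes> y\<close> lay there too, it would equal \<open>x \<otimes> k\<close> with
  \<open>k\<close> in \<open>K\<close>, and cancellation would give \<open>y = k\<close>.\<close>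

lemma mult_in_subgroup_index_2:
  assumes fin: "finite (carrier G)" and K: "subgroup K G" "order G = 2 * card K"
    and xy: "x \<in> carrier G" "x \<notin> K" "y \<in> carrier G" "y \<notin> K"
  shows "x \<otimes> y \<in> K"
proof (rule ccontr)
  assume "x \<otimes> y \<notin> K"
  have sub: "K \<subseteq> carrier G" using K(1) by (rule subgroup.subset)
  have inj: "inj_on (\<lambda>k. x \<otimes> k) K" using xy sub by (auto simp: inj_on_def subset_iff)
  have img: "(\<lambda>k. x \<otimes> k) ` K \<subseteq> carrier G - K"
  proof clarify
    fix k assume k: "k \<in> K"
    have "x = (x \<otimes> k) \<otimes> inv k" using xy k sub by (simp add: m_assoc subset_iff)
    then have "x \<otimes> k \<notin> K" using xy(2) K(1) k by (metis subgroup.m_closed subgroup.m_inv_closed)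
    then show "x \<otimes> k \<in> carrier G - K" using xy k sub by auto
  qed
  have "card (carrier G - K) = card K"
    using K sub fin by (simp add: card_Diff_subset finite_subset order_def)
  then have "(\<lambda>k. x \<otimes> k) ` K = carrier G - K"
    using img fin inj by (intro card_subset_eq) (auto simp: card_image)
  moreover have "x \<otimes> y \<in> carrier G - K" using xy \<open>x \<otimes> y \<notin> K\<close> by simp
  ultimately obtain k where "k \<in> K" "x \<otimes> y = x \<otimes> k" by auto
  then have "y = k" using xy sub by (simp add: subset_iff)
  then show False using \<open>k \<in> K\<close> xy by simp
qed

lemma order_8_involutive:
  assumes fin: "finite (carrier G)" and order: "order G = 8"
    and sq: "\<And>x. x \<in> carrier G \<Longrightarrow> x \<otimes> x = \<one>"
  shows "G \<cong> integer_mod_group 2 \<times>\<times> integer_mod_group 2 \<times>\<times> integer_mod_group 2"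
proof -
  let ?V = "integer_mod_group 2 \<times>\<times> integer_mod_group 2"
  have comm: "x \<otimes> y = y \<otimes> x" if "x \<in> carrier G" "y \<in> carrier G" for x y
    using that sq square_eq_one_commute by simp
  have pow2: "x [^] (2::nat) = \<one>" if "x \<in> carrier G" for x
    using sq that by (simp add: numeral_2_eq_2)
  obtain x where x: "x \<in> carrier G" "ord x = 2" using cauchy[OF fin two_is_prime_nat] order by auto
  then obtain y where y: "y \<in> carrier G" "y \<notin> range (\<lambda>i::int. x [^] i)"
    using not_in_powers[OF fin x(1)] order by auto
  let ?\<psi> = "\<lambda>(a::int, b::int). x [^] a \<otimes> y [^] b"
  have \<psi>: "?\<psi> \<in> hom ?V G"
    using x y pow2 by (intro hom_DirProd hom_integer_mod_group comm) auto
  interpret \<psi>: group_hom ?V G ?\<psi>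
    by (rule group_hom.intro[OF DirProd_group[OF group_integer_mod_group group_integer_mod_group]
          group_axioms group_hom_axioms.intro[OF \<psi>]])
  let ?K = "?\<psi> ` carrier ?V"
  have K: "subgroup ?K G" by (rule \<psi>.img_is_subgroup)
  have "?\<psi> (1, 0) \<in> ?K" "?\<psi> (0, 1) \<in> ?K" by (intro imageI; simp add: carrier_integer_mod_group)+
  then have xyK: "x \<in> ?K" "y \<in> ?K" using x y by simp_all
  have finK: "finite ?K" by (simp add: carrier_integer_mod_group)
  have "card ?K \<le> card (carrier ?V)" by (rule card_image_le) (simp add: carrier_integer_mod_group)
  then have "card ?K \<le> 4" by (simp add: carrier_integer_mod_group card_cartesian_product)
  \<comment> \<open>The image has at most four elements, properly contains a subgroup of order 2 and
    has even order, hence exactly four elements.\<close>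
  moreover have powK: "range (\<lambda>i::int. x [^] i) \<subset> ?K"
  proof -
    have "generate G {x} \<subseteq> ?K" using xyK K by (simp add: generate_subgroup_incl)
    moreover have "generate G {x} = range (\<lambda>i::int. x [^] i)" using generate_pow[OF x(1)] by auto
    ultimately show ?thesis using xyK(2) y(2) by blast
  qed
  then have "card (range (\<lambda>i::int. x [^] i)) < card ?K" using finK by (rule psubset_card_mono[rotated])
  then have "2 < card ?K" using powers_subgroup(2)[OF x(1)] x by simp
  moreover have "2 dvd card ?K"
    using subgroup_card_dvd[OF powers_subgroup(1)[OF x(1)] K] powK powers_subgroup(2)[OF x(1)] x by auto
  moreover have "n = 4" if "n \<le> 4" "2 < n" "even n" for n :: nat using that by presburger
  ultimately have cardK: "card ?K = 4" by blast
  then obtain z where z: "z \<in> carrier G" "z \<notin> ?K"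
  proof -
    have "?K \<noteq> carrier G" using cardK order by (auto simp: order_def)
    then show ?thesis using that subgroup.subset[OF K] by blast
  qed
  let ?\<phi> = "\<lambda>(c::int, v). z [^] c \<otimes> ?\<psi> v"
  have \<phi>: "?\<phi> \<in> hom (integer_mod_group 2 \<times>\<times> ?V) G"
    using z pow2 x y
    by (intro hom_DirProd hom_integer_mod_group comm \<psi>) (auto simp: DirProd_group)
  show ?thesis
  proof (rule iso_by_extension[OF _ fin \<phi> _ K, of z 2])
    show "?K \<subseteq> ?\<phi> ` carrier (integer_mod_group 2 \<times>\<times> ?V)"
    proof clarify
      fix a b :: int assume ab: "(a, b) \<in> carrier ?V"
      have "x [^] a \<otimes> y [^] b = ?\<phi> (0, a, b)" using x y by simp
      moreover have "(0, a, b) \<in> carrier (integer_mod_group 2 \<times>\<times> ?V)" using ab by simp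
      ultimately show "x [^] a \<otimes> y [^] b \<in> ?\<phi> ` carrier (integer_mod_group 2 \<times>\<times> ?V)"
        by (rule image_eqI)
    qed
    have "z = ?\<phi> (1, 0, 0)" using z by simp
    moreover have "(1, 0, 0) \<in> carrier (integer_mod_group 2 \<times>\<times> ?V)" by simp
    ultimately show "z \<in> ?\<phi> ` carrier (integer_mod_group 2 \<times>\<times> ?V)" by (rule image_eqI)
  qed (use z order cardK in \<open>auto simp: DirProd_group order_def card_cartesian_product carrier_integer_mod_group\<close>)
qed

lemma order_8:
  assumes fin: "finite (carrier G)" and order: "order G = 8"
  shows "G \<cong> integer_mod_group 8 \<or> G \<cong> integer_mod_group 4 \<times>\<times> integer_mod_group 2 \<or>
    G \<cong> dihedral 4 \<or> G \<cong> dicyclic 2 \<or>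
    G \<cong> integer_mod_group 2 \<times>\<times> integer_mod_group 2 \<times>\<times> integer_mod_group 2"
proof (cases "\<exists>x\<in>carrier G. ord x = 8")
  case True
  then show ?thesis using iso_cyclic[OF fin] order by force
next
  case no8: False
  have ord: "ord x dvd 4" if x: "x \<in> carrier G" for x
  proof -
    have "ord x dvd 2 ^ 3" using ord_dvd_group_order[OF x] order by simp
    then obtain i where i: "i \<le> 3" "ord x = 2 ^ i" using two_is_prime_nat by (metis divides_primepow_nat)
    then have "i \<noteq> 3" using no8 x by auto
    then have "(2::nat) ^ i dvd 2 ^ 2" using i by (intro le_imp_power_dvd) simp
    then show ?thesis using i by simp
  qed
  show ?thesis
  proof (cases "\<exists>x\<in>carrier G. x \<otimes> x \<noteq> \<one>")
    case False
    then show ?thesis using order_8_involutive[OF fin order] by blast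
  next
    case True
    then obtain r where r: "r \<in> carrier G" "r \<otimes> r \<noteq> \<one>" by blast
    have "\<not> ord r dvd 2" using r pow_eq_id[of r 2] by (simp add: numeral_2_eq_2)
    moreover have "ord r \<in> {0, 1, 2, 3, 4}"
      using dvd_imp_le[OF ord[OF r(1)]] by auto
    ultimately have r4: "ord r = 4"
      using ord[OF r(1)] by auto
    have rpow: "r [^] (4::nat) = \<one>" using r r4 pow_ord_eq_1 by metis
    let ?K = "range (\<lambda>i::int. r [^] i)"
    have K: "subgroup ?K G" "order G = 2 * card ?K" "r \<in> ?K"
      using powers_subgroup[OF r(1)] r4 order r(1) int_pow_1 by (auto intro: range_eqI[of _ _ 1])
    obtain s where s: "s \<in> carrier G" "s \<notin> ?K" using not_in_powers[OF fin r(1)] r4 order by auto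
    have "s \<otimes> s \<in> ?K" using mult_in_subgroup_index_2[OF fin K(1,2) s s] .
    then obtain j where j: "j < 4" "s \<otimes> s = r [^] (j::nat)"
      using int_pow_in_range_nat[OF fin r(1)] r4 by metis
    \<comment> \<open>Every order divides 4, so \<open>s^4 = 1\<close>; this leaves 1 and
      \<open>r^2\<close> for the square of \<open>s\<close>.\<close>
    have "(s \<otimes> s) \<otimes> (s \<otimes> s) = \<one>"
      using ord[OF s(1)] s pow_eq_id[of s 4] by (simp add: numeral_eq_Suc m_assoc)
    then have "r [^] (j + j) = \<one>" using j r by (simp add: nat_pow_mult)
    then have "4 dvd j + j" using r r4 by (simp add: pow_eq_id)
    then have j02: "j = 0 \<or> j = 2" using j(1) by presburger
    have sr: "s \<otimes> r \<in> carrier G" "s \<otimes> r \<notin> ?K"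
    proof -
      show "s \<otimes> r \<in> carrier G" using s r by simp
      show "s \<otimes> r \<notin> ?K"
      proof
        assume "s \<otimes> r \<in> ?K"
        then have "s \<otimes> r \<otimes> inv r \<in> ?K" using K by (meson subgroup.m_closed subgroup.m_inv_closed)
        then show False using s r by (simp add: m_assoc)
      qed
    qed
    have "inv s \<notin> ?K" using s K(1) by (metis inv_inv subgroup.m_inv_closed)
    then have "s \<otimes> r \<otimes> inv s \<in> ?K"
      using mult_in_subgroup_index_2[OF fin K(1,2) sr, of "inv s"] s by simp
    then obtain k where k: "k < 4" "s \<otimes> r \<otimes> inv s = r [^] (k::nat)"
      using int_pow_in_range_nat[OF fin r(1)] r4 by metis
    \<comment> \<open>An even \<open>k\<close> would conjugate \<open>r^2\<close> to
      \<open>r^(2k) = 1\<close>, although \<open>r\<close> has order 4.\<close>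
    have "odd k"
    proof
      assume "even k"
      then have "4 dvd k * 2" by presburger
      then have "r [^] (k * 2) = \<one>" using r r4 by (simp add: pow_eq_id)
      moreover have "r [^] (k * 2) = s \<otimes> (r \<otimes> r) \<otimes> inv s"
      proof -
        have "x [^] (2::int) = x \<otimes> x" if "x \<in> carrier G" for x
          using int_pow_mult[of x 1 1] that by simp
        then have "s \<otimes> (r \<otimes> r) \<otimes> inv s = (r [^] k) \<otimes> (r [^] k)"
          using conj_int_pow[OF s(1) r(1), of 2] k(2) r s by simp
        then show ?thesis using r by (simp add: nat_pow_mult mult_2_right)
      qed
      ultimately have "s \<otimes> (r \<otimes> r) = \<one> \<otimes> s" using conj_eq_iff[of s "r \<otimes> r" \<one>] s r by simp
      then show False using r s by simp
    qed
    then have "k = 1 \<or> k = 3" using k(1) by presburger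
    then show ?thesis
    proof
      assume "k = 1"
      then have comm: "r \<otimes> s = s \<otimes> r" using conj_eq_iff[of s r r] k r s by simp
      have prod: "G \<cong> integer_mod_group 4 \<times>\<times> integer_mod_group 2"
        if "t \<in> carrier G" "t \<notin> ?K" "r \<otimes> t = t \<otimes> r" "t \<otimes> t = \<one>" for t
      proof -
        have "t [^] (2::nat) = \<one>" using that by (simp add: numeral_2_eq_2)
        then show ?thesis
          using iso_DirProd[OF fin r(1) that(1,3) r4, of 2] that order by simp
      qed
      show ?thesis
      proof (cases "j = 0")
        case True
        then show ?thesis using prod[OF s] comm j by simp
      next
        case False
        \<comment> \<open>If \<open>s^2 = r^2\<close>, replacing \<open>s\<close> by
          \<open>s r\<close> yields an involution outside the powers of \<open>r\<close>, which
          splits the abelian group as a direct product.\<close>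
        then have "(s \<otimes> r) \<otimes> (s \<otimes> r) = (s \<otimes> s) \<otimes> (r \<otimes> r)"
          using comm r s by (metis m_assoc m_closed)
        also have "\<dots> = r [^] (4::nat)" using j j02 False r by (simp add: numeral_eq_Suc m_assoc)
        finally have "(s \<otimes> r) \<otimes> (s \<otimes> r) = \<one>" using rpow by simp
        moreover have "r \<otimes> (s \<otimes> r) = (s \<otimes> r) \<otimes> r" using comm r s by (metis m_assoc)
        ultimately show ?thesis using prod[OF sr] by simp
      qed
    next
      assume "k = 3"
      have "r [^] (3::nat) \<otimes> r = \<one>" using rpow by (simp add: numeral_eq_Suc)
      then have "r [^] (3::nat) = inv r" using r inv_equality by simp
      then have inv: "s \<otimes> r = inv r \<otimes> s" using conj_eq_iff[of s r "inv r"] k \<open>k = 3\<close> r s by simp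
      show ?thesis
        using iso_dihedral[OF fin r(1) s(1) r4] iso_dicyclic[OF fin r(1) s(1), of 2]
          j j02 inv s order r4 by auto
    qed
  qed
qed

end

section \<open>Groups of order 12\<close>

context group
begin

lemma conj_cancel:
  assumes "l \<in> carrier G" "x \<in> carrier G"
  shows "inv l \<otimes> (l \<otimes> x \<otimes> inv l) \<otimes> l = x"
proof -
  have "l \<otimes> x \<otimes> inv l \<otimes> l = l \<otimes> x" using assms by (simp add: m_assoc)
  then have "inv l \<otimes> (l \<otimes> x \<otimes> inv l \<otimes> l) = x" using assms by (simp add: m_assoc[symmetric])
  then show ?thesis using assms by (simp add: m_assoc)
qed

lemma ord_eq_prime:
  assumes "x \<in> carrier G" "x \<noteq> \<one>" "x [^] p = \<one>" "Factorial_Ring.prime (p::nat)"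
  shows "ord x = p"
  using assms pow_eq_id[of x p] ord_eq_1[of x] by (metis prime_nat_iff)

lemma ord_dvd_card_subgroup:
  assumes "subgroup K G" "x \<in> K"
  shows "ord x dvd card K"
proof -
  have x: "x \<in> carrier G" by (rule subgroup.mem_carrier[OF assms])
  have "subgroup (generate G {x}) G" using x by (intro generate_is_subgroup) auto
  moreover have "generate G {x} \<subseteq> K"
    using generate_subgroup_incl[of "{x}" K] assms by blast
  ultimately have "card (generate G {x}) dvd card K" using subgroup_card_dvd assms(1) by blast
  then show ?thesis using generate_pow_card[OF x] by metis
qed

text \<open>The element \<open>r = c z\<close> has order 6 and \<open>z\<close> is the only
  involution among its powers, so \<open>s\<close> lies outside them. Then \<open>s\<close>
  centralizes or inverts \<open>r\<close> according to what it does with \<open>c\<close>.\<close>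

lemma order_12_klein_normal:
  assumes fin: "finite (carrier G)" and order: "order G = 12"
    and c: "c \<in> carrier G" "ord c = 3"
    and z: "z \<in> carrier G" "z \<noteq> \<one>" "z \<otimes> z = \<one>" "c \<otimes> z = z \<otimes> c"
    and s: "s \<in> carrier G" "s \<noteq> \<one>" "s \<noteq> z" "s \<otimes> s = \<one>" "s \<otimes> z = z \<otimes> s"
    and conj: "s \<otimes> c = c \<otimes> s \<or> s \<otimes> c = inv c \<otimes> s"
  shows "G \<cong> integer_mod_group 6 \<times>\<times> integer_mod_group 2 \<or> G \<cong> dihedral 6"
proof -
  have z2: "z [^] (2::nat) = \<one>" and s2: "s [^] (2::nat) = \<one>"
    using z s by (simp_all add: numeral_2_eq_2)
  have ordz: "ord z = 2" using ord_eq_prime[OF z(1,2) z2] by simp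
  define r where "r = c \<otimes> z"
  have r: "r \<in> carrier G" using c z by (simp add: r_def)
  have "coprime (3::nat) 2" by simp
  then have ordr: "ord r = 6"
    using ord_mult_coprime[OF c(1) z(1,4)] c ordz by (simp add: r_def)
  have c3: "c [^] (3::nat) = \<one>" using c pow_ord_eq_1 by metis
  have r3: "r [^] (3::nat) = z"
  proof -
    have "r [^] (3::nat) = c [^] (3::nat) \<otimes> z [^] (3::nat)"
      unfolding r_def using c z by (intro pow_mult_distrib) auto
    then show ?thesis using c3 z by (simp add: numeral_eq_Suc)
  qed
  have s_notin: "s \<notin> range (\<lambda>i::int. r [^] i)"
  proof
    assume "s \<in> range (\<lambda>i::int. r [^] i)"
    then obtain k where k: "k < 6" "s = r [^] (k::nat)"
      using int_pow_in_range_nat[OF fin r] ordr by metis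
    then have "r [^] (k * 2) = \<one>" using s2 r by (simp add: nat_pow_pow)
    then have "6 dvd k * 2" using ordr r by (simp add: pow_eq_id)
    then have "k = 0 \<or> k = 3" using k(1) by presburger
    then show False using k r3 s by auto
  qed
  show ?thesis
    using conj
  proof
    assume "s \<otimes> c = c \<otimes> s"
    then have "r \<otimes> s = s \<otimes> r" using c z s unfolding r_def by (metis m_assoc)
    then show ?thesis using iso_DirProd[OF fin r s(1) _ ordr _ s2] order s_notin by simp
  next
    assume inv: "s \<otimes> c = inv c \<otimes> s"
    have "inv r = inv c \<otimes> z"
      unfolding r_def using c z inv_equality[of z z] by (simp add: inv_mult_group z(4))
    moreover have "s \<otimes> r = inv c \<otimes> (s \<otimes> z)"
      unfolding r_def using inv c(1) z(1) s(1) by (metis m_assoc inv_closed)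
    ultimately have "s \<otimes> r = inv r \<otimes> s" using s c z by (simp add: m_assoc)
    then show ?thesis using iso_dihedral[OF fin r s(1) ordr] s order s_notin by simp
  qed
qed

text \<open>Every element centralizes or inverts \<open>c\<close>, and the subgroup \<open>K\<close>
  of order 4 is cyclic or a Klein four-group. A generator of a cyclic \<open>K\<close> that inverts
  \<open>c\<close> gives the dicyclic group: its square \<open>z\<close> centralizes
  \<open>c\<close>, and \<open>r = c z\<close> has cube \<open>z\<close>.\<close>

lemma order_12_normal:
  assumes fin: "finite (carrier G)" and order: "order G = 12"
    and c: "c \<in> carrier G" "ord c = 3" and K: "subgroup K G" "card K = 4"
    and normal: "\<And>y. y \<in> carrier G \<Longrightarrow> y \<otimes> c \<otimes> inv y \<in> range (\<lambda>i::int. c [^] i)"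
  shows "G \<cong> integer_mod_group 12 \<or> G \<cong> dicyclic 3 \<or>
    G \<cong> integer_mod_group 6 \<times>\<times> integer_mod_group 2 \<or> G \<cong> dihedral 6"
proof -
  have c3: "c [^] (3::nat) = \<one>" using c pow_ord_eq_1 by metis
  have conj: "y \<otimes> c = c \<otimes> y \<or> y \<otimes> c = inv c \<otimes> y" if y: "y \<in> carrier G" for y
  proof -
    obtain k where k: "k < 3" "y \<otimes> c \<otimes> inv y = c [^] (k::nat)"
      using int_pow_in_range_nat[OF fin c(1) normal[OF y]] c by metis
    have "k \<noteq> 0"
    proof
      assume "k = 0"
      then have "y \<otimes> c = \<one> \<otimes> y" using conj_eq_iff[of y c \<one>] k c y by simp
      then have "c = \<one>" using c y by simp
      then show False using c by simp
    qed
    moreover have "c [^] (2::nat) \<otimes> c = \<one>" using c3 by (simp add: numeral_eq_Suc)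
    then have "c [^] (2::nat) = inv c" using c inv_equality by simp
    moreover have "k = 0 \<or> k = 1 \<or> k = 2" using k(1) by auto
    ultimately show ?thesis
      using conj_eq_iff[of y c "c [^] k"] k c y by auto
  qed
  have twist: "y \<otimes> inv c = c \<otimes> y" if "y \<in> carrier G" "y \<otimes> c = inv c \<otimes> y" for y
    using twisted_commute_int_pow[of c y "- 1"] that c by (simp add: int_pow_neg)
  have KG: "x \<in> carrier G" if "x \<in> K" for x using subgroup.mem_carrier[OF K(1) that] .
  show ?thesis
  proof (cases "\<exists>d\<in>K. d \<otimes> d \<noteq> \<one>")
    case True
    then obtain d where d: "d \<in> K" "d \<otimes> d \<noteq> \<one>" by blast
    note dG = KG[OF d(1)]
    have dvd4: "ord d dvd 4" using ord_dvd_card_subgroup[OF K(1) d(1)] K(2) by simp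
    then have "ord d \<in> {0, 1, 2, 3, 4}" using dvd_imp_le[OF dvd4] by auto
    moreover have "\<not> ord d dvd 2" using d dG pow_eq_id[of d 2] by (simp add: numeral_2_eq_2)
    ultimately have d4: "ord d = 4" using dvd4 by auto
    show ?thesis
      using conj[OF dG]
    proof
      assume "d \<otimes> c = c \<otimes> d"
      moreover have "coprime (3::nat) 4" by (simp add: coprime_iff_gcd_eq_1 gcd_non_0_nat)
      ultimately have "ord (c \<otimes> d) = 12" using ord_mult_coprime[OF c(1) dG] c d4 by simp
      then show ?thesis using iso_cyclic[OF fin, of "c \<otimes> d"] c dG order by simp
    next
      assume inv: "d \<otimes> c = inv c \<otimes> d"
      define z where "z = d \<otimes> d"
      have z: "z \<in> carrier G" "z \<otimes> z = \<one>" "z \<noteq> \<one>"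
        using dG d d4 pow_ord_eq_1[OF dG] by (auto simp: z_def numeral_eq_Suc m_assoc)
      have "d \<otimes> d \<otimes> c = c \<otimes> (d \<otimes> d)"
        using inv twist[OF dG inv] dG c by (metis inv_closed m_assoc)
      then have cz: "c \<otimes> z = z \<otimes> c" by (simp add: z_def)
      have z2: "z [^] (2::nat) = \<one>" using z by (simp add: numeral_2_eq_2)
      have ordz: "ord z = 2" using ord_eq_prime[OF z(1,3) z2] by simp
      define r where "r = c \<otimes> z"
      have r: "r \<in> carrier G" using c z by (simp add: r_def)
      have "coprime (3::nat) 2" by simp
      then have ordr: "ord r = 6" using ord_mult_coprime[OF c(1) z(1) cz] c ordz by (simp add: r_def)
      have "r [^] (3::nat) = c [^] (3::nat) \<otimes> z [^] (3::nat)"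
        unfolding r_def using c z cz by (intro pow_mult_distrib) auto
      then have r3: "d \<otimes> d = r [^] (3::nat)"
        using c3 z by (simp add: numeral_eq_Suc z_def[symmetric])
      have "inv r = inv c \<otimes> z"
        unfolding r_def using c z cz inv_equality[of z z] by (metis inv_mult_group)
      moreover have "d \<otimes> r = inv c \<otimes> (d \<otimes> z)"
        unfolding r_def using inv c(1) z(1) dG by (metis m_assoc inv_closed)
      moreover have "d \<otimes> z = z \<otimes> d" using dG by (simp add: z_def m_assoc)
      ultimately have dr: "d \<otimes> r = inv r \<otimes> d" using dG c z by (simp add: m_assoc)
      have "d \<notin> range (\<lambda>i::int. r [^] i)"
      proof
        assume "d \<in> range (\<lambda>i::int. r [^] i)"
        then have "ord d dvd 6"
          using ord_dvd_card_subgroup[OF powers_subgroup(1)[OF r]] powers_subgroup(2)[OF r] ordr by metis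
        then show False using d4 by simp
      qed
      then show ?thesis using iso_dicyclic[OF fin r dG, of 3] ordr r3 dr order by simp
    qed
  next
    case False
    then have sq: "x \<otimes> x = \<one>" if "x \<in> K" for x using that by blast
    have prod: "x \<otimes> y \<in> K" if "x \<in> K" "y \<in> K" for x y using that K(1) by (simp add: subgroup.m_closed)
    have comm: "x \<otimes> y = y \<otimes> x" if "x \<in> K" "y \<in> K" for x y
      using square_eq_one_commute[of x y] that KG sq prod by blast
    have "\<not> K \<subseteq> {\<one>}" using card_mono[of "{\<one>}" K] K(2) by auto
    then obtain a where a: "a \<in> K" "a \<noteq> \<one>" by blast
    have "\<not> K \<subseteq> {\<one>, a}" using card_mono[of "{\<one>, a}" K] a K(2) by auto
    then obtain b where b: "b \<in> K" "b \<noteq> \<one>" "b \<noteq> a" by blast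
    note aG = KG[OF a(1)] and bG = KG[OF b(1)]
    consider "a \<otimes> c = c \<otimes> a" | "b \<otimes> c = c \<otimes> b"
      | "a \<otimes> c = inv c \<otimes> a" "b \<otimes> c = inv c \<otimes> b"
      using conj aG bG by blast
    then show ?thesis
    proof cases
      case 1
      then show ?thesis
        using order_12_klein_normal[OF fin order c aG a(2) sq[OF a(1)] _ bG b(2,3) sq[OF b(1)]]
          comm a b conj[OF bG] by auto
    next
      case 2
      then show ?thesis
        using order_12_klein_normal[OF fin order c bG b(2) sq[OF b(1)] _ aG a(2) _ sq[OF a(1)]]
          comm a b conj[OF aG] by auto
    next
      case 3
      \<comment> \<open>Two involutions that invert \<open>c\<close> have a product that centralizes
        it, so some involution of \<open>K\<close> always can serve as \<open>z\<close>.\<close>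
      have "a \<otimes> b \<otimes> c = a \<otimes> inv c \<otimes> b" using 3 aG bG c by (simp add: m_assoc)
      also have "\<dots> = c \<otimes> (a \<otimes> b)" using twist[OF aG 3(1)] aG bG c by (simp add: m_assoc)
      finally have "c \<otimes> (a \<otimes> b) = a \<otimes> b \<otimes> c" by simp
      moreover have "a \<otimes> b \<noteq> \<one>" using sq[OF a(1)] b(3) aG bG by (metis inv_equality inv_inv)
      moreover have "a \<noteq> a \<otimes> b" using b(2) aG bG by simp
      ultimately show ?thesis
        using order_12_klein_normal[OF fin order c KG[OF prod[OF a(1) b(1)]] _
            sq[OF prod[OF a(1) b(1)]] _ aG a(2) _ sq[OF a(1)]]
          comm[OF a(1) prod[OF a(1) b(1)]] conj[OF aG] by auto
    qed
  qed
qed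

text \<open>The bound \<open>3^2 + 3\<close> of the double coset is attained, which makes the cyclic
  group of \<open>c\<close> its own normalizer. Its conjugates under \<open>K\<close> then supply
  eight elements of order 3, filling the complement of \<open>K\<close>. So \<open>K\<close> is
  invariant under conjugation by \<open>c\<close>, which permutes its nontrivial elements
  cyclically.\<close>

lemma order_12_not_normal:
  assumes fin: "finite (carrier G)" and order: "order G = 12"
    and c: "c \<in> carrier G" "ord c = 3" and K: "subgroup K G" "card K = 4"
    and y: "y \<in> carrier G" "y \<otimes> c \<otimes> inv y \<notin> range (\<lambda>i::int. c [^] i)"
  shows "G \<cong> tetra"
proof -
  let ?H = "range (\<lambda>i::int. c [^] i)"
  have H: "subgroup ?H G" "card ?H = 3" using powers_subgroup[OF c(1)] c by auto
  have KG: "x \<in> carrier G" if "x \<in> K" for x using subgroup.mem_carrier[OF K(1) that] .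
  \<comment> \<open>Outside \<open>?H\<close>, an element has the form \<open>c^i y c^j\<close> and
    conjugates \<open>c\<close> into \<open>?H\<close> only if \<open>y\<close> does.\<close>
  have self_norm: "z \<in> ?H" if z: "z \<in> carrier G" "z \<otimes> c \<otimes> inv z \<in> ?H" for z
  proof (rule ccontr)
    assume "z \<notin> ?H"
    then obtain i j :: int where zy: "z = c [^] i \<otimes> y \<otimes> c [^] j"
      using double_coset(2)[OF fin c(1) _ y] c order z(1) by auto
    have "z \<otimes> c \<otimes> inv z = c [^] i \<otimes> (y \<otimes> (c [^] j \<otimes> c \<otimes> c [^] (- j)) \<otimes> inv y) \<otimes> c [^] (- i)"
      unfolding zy using c y by (simp add: m_assoc inv_mult_group int_pow_neg)
    also have "c [^] j \<otimes> c \<otimes> c [^] (- j) = c"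
    proof -
      have "c [^] j \<otimes> c [^] (1::int) \<otimes> c [^] (- j) = c [^] (1::int)"
        using c(1) by (simp only: int_pow_mult[symmetric]) simp
      then show ?thesis using c by simp
    qed
    finally have eq: "c [^] i \<otimes> (y \<otimes> c \<otimes> inv y) \<otimes> c [^] (- i) = z \<otimes> c \<otimes> inv z" by simp
    have "c [^] (- i) \<otimes> (c [^] i \<otimes> (y \<otimes> c \<otimes> inv y) \<otimes> c [^] (- i)) \<otimes> c [^] i = y \<otimes> c \<otimes> inv y"
    proof -
      have "c [^] (- i) \<otimes> (c [^] i \<otimes> (y \<otimes> c \<otimes> inv y) \<otimes> c [^] (- i)) \<otimes> c [^] i
        = c [^] (- i) \<otimes> c [^] i \<otimes> (y \<otimes> c \<otimes> inv y) \<otimes> (c [^] (- i) \<otimes> c [^] i)"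
        using c y by (simp add: m_assoc)
      then show ?thesis using c y by (simp add: int_pow_mult[symmetric])
    qed
    moreover have "c [^] (- i) \<otimes> (z \<otimes> c \<otimes> inv z) \<otimes> c [^] i \<in> ?H"
      using z(2) H(1) by (meson rangeI subgroup.m_closed)
    ultimately show False using y(2) eq by simp
  qed
  have KH: "x = \<one>" if "x \<in> K" "x \<in> ?H" for x
  proof -
    have "ord x dvd 4" "ord x dvd 3"
      using ord_dvd_card_subgroup[OF K(1) that(1)] ord_dvd_card_subgroup[OF H(1) that(2)] K H by auto
    then have "ord x dvd 4 - 3" by (rule dvd_diff_nat)
    then have "ord x = 1" by simp
    then show ?thesis using ord_eq_1 KG that by blast
  qed
  have c_pow: "c [^] (e::int) = c [^] (f::int) \<longleftrightarrow> 3 dvd e - f" for e f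
    using int_pow_eq[OF c(1), of e f] c by (metis dvd_diff_commute of_nat_numeral)
  let ?t = "\<lambda>(k, e::int). k \<otimes> c [^] e \<otimes> inv k"
  have inj: "inj_on ?t (K \<times> {1, 2})"
  proof (rule inj_onI, clarify)
    fix k l e f assume kl: "k \<in> K" "l \<in> K" and ef: "e \<in> {1::int, 2}" "f \<in> {1::int, 2}"
      and eq: "k \<otimes> c [^] e \<otimes> inv k = l \<otimes> c [^] f \<otimes> inv l"
    note G = KG[OF kl(1)] KG[OF kl(2)]
    define z where "z = inv l \<otimes> k"
    have z: "z \<in> K" "z \<in> carrier G"
      using kl K(1) KG unfolding z_def by (simp_all add: subgroup.m_closed subgroup.m_inv_closed)
    have "z \<otimes> c [^] e \<otimes> inv z = inv l \<otimes> (k \<otimes> c [^] e \<otimes> inv k) \<otimes> l"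
      using G c by (simp add: z_def m_assoc inv_mult_group)
    also have "\<dots> = c [^] f" unfolding eq using conj_cancel G c(1) by simp
    finally have ze: "(z \<otimes> c \<otimes> inv z) [^] e = c [^] f"
      using G c z conj_int_pow[OF z(2) c(1)] by simp
    then have "(z \<otimes> c \<otimes> inv z) [^] (e * e) = c [^] (f * e)"
      using c z by (metis int_pow_pow m_closed inv_closed)
    \<comment> \<open>Both 1 and 2 are their own inverses modulo 3, so raising to the power
      \<open>e\<close> recovers the conjugate of \<open>c\<close> itself.\<close>
    moreover have "c [^] (e * e) = c [^] (1::int)" unfolding c_pow using ef by auto
    then have "(z \<otimes> c \<otimes> inv z) [^] (e * e) = z \<otimes> c \<otimes> inv z"
      using conj_int_pow[OF z(2) c(1), of "e * e"] c by simp
    ultimately have "z \<otimes> c \<otimes> inv z \<in> ?H" by simp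
    then have "z = \<one>" using self_norm KH z by blast
    then have "k = l" using G unfolding z_def by (metis inv_equality inv_inv inv_closed)
    moreover have "c [^] e = c [^] f" using ze \<open>z = \<one>\<close> c by simp
    then have "e = f" using ef by (auto simp: c_pow)
    ultimately show "k = l \<and> e = f" by simp
  qed
  have disj: "?t ` (K \<times> {1, 2}) \<inter> K = {}"
  proof (rule ccontr)
    assume "?t ` (K \<times> {1, 2}) \<inter> K \<noteq> {}"
    then obtain k e where ke: "k \<in> K" "e \<in> {1::int, 2}" "k \<otimes> c [^] e \<otimes> inv k \<in> K" by auto
    note kG = KG[OF ke(1)]
    have "inv k \<otimes> (k \<otimes> c [^] e \<otimes> inv k) \<otimes> k \<in> K"
      using ke K(1) by (simp add: subgroup.m_closed subgroup.m_inv_closed)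
    moreover have "inv k \<otimes> (k \<otimes> c [^] e \<otimes> inv k) \<otimes> k = c [^] e"
      using conj_cancel kG c(1) by simp
    ultimately have "c [^] e \<in> K" using kG c by simp
    then have "c [^] e = c [^] (0::int)" using KH[of "c [^] e"] by simp
    then show False unfolding c_pow using ke by auto
  qed
  have cube: "g \<otimes> (g \<otimes> g) = \<one>" if g: "g \<in> carrier G" "g \<notin> K" for g
  proof -
    have finK: "finite K" using K(2) by (simp add: card_ge_0_finite)
    have "?t ` (K \<times> {1, 2}) \<union> K = carrier G"
    proof (rule card_subset_eq[OF fin])
      show "?t ` (K \<times> {1, 2}) \<union> K \<subseteq> carrier G" using KG c by auto
      have "card (?t ` (K \<times> {1, 2}) \<union> K) = card (?t ` (K \<times> {1, 2})) + card K"
        using disj finK by (intro card_Un_disjoint) auto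
      then show "card (?t ` (K \<times> {1, 2}) \<union> K) = card (carrier G)"
        using K(2) order inj by (simp add: card_image card_cartesian_product order_def)
    qed
    then have "g \<in> ?t ` (K \<times> {1, 2})" using g by blast
    then obtain k e where ke: "k \<in> K" "g = k \<otimes> c [^] (e::int) \<otimes> inv k" by auto
    then have "g [^] (3::int) = k \<otimes> (c [^] e) [^] (3::int) \<otimes> inv k"
      using conj_int_pow[OF KG[OF ke(1)], of "c [^] e" 3] c by simp
    also have "(c [^] e) [^] (3::int) = c [^] (0::int)" using c_pow[of "e * 3" 0] c by (simp add: int_pow_pow)
    finally have "g [^] (3::int) = \<one>" using KG[OF ke(1)] by simp
    then have "g [^] (3::nat) = \<one>" using int_pow_int[of G g 3] by simp
    then show ?thesis using g by (simp add: numeral_eq_Suc m_assoc)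
  qed
  let ?s = "\<lambda>x. c \<otimes> x \<otimes> inv c"
  have s_hom: "?s (x \<otimes> x') = ?s x \<otimes> ?s x'" if "x \<in> carrier G" "x' \<in> carrier G" for x x'
    using that c(1) by (simp add: m_assoc inv_solve_left)
  have s_one: "?s \<one> = \<one>" using c by simp
  have s_K: "?s x \<in> K" if x: "x \<in> K" for x
  proof (rule ccontr)
    note xG = KG[OF x]
    assume n: "?s x \<notin> K"
    \<comment> \<open>A conjugate outside \<open>K\<close> has cube 1, hence so has
      \<open>x\<close>. The order of \<open>x\<close> then divides both 3 and 4.\<close>
    then have "?s x \<otimes> (?s x \<otimes> ?s x) = \<one>" using cube xG c by simp
    then have "?s (x \<otimes> (x \<otimes> x)) = \<one>" using s_hom xG by simp
    then have "x \<otimes> (x \<otimes> x) = \<one>" using xG c conj_eq_iff[of c "x \<otimes> (x \<otimes> x)" \<one>] by simp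
    then have "x [^] (3::nat) = \<one>" using xG by (simp add: numeral_eq_Suc m_assoc)
    then have "ord x dvd 3" using xG by (simp add: pow_eq_id)
    moreover have "ord x dvd 4" using ord_dvd_card_subgroup[OF K(1) x] K by simp
    ultimately have "ord x dvd 4 - 3" by (metis dvd_diff_nat)
    then have "ord x = 1" by simp
    then have "x = \<one>" using ord_eq_1 xG by blast
    then show False using n s_one K(1) by (simp add: subgroup.one_closed)
  qed
  have s_ne: "?s x \<noteq> x" if "x \<in> K" "x \<noteq> \<one>" for x
  proof
    note xG = KG[OF that(1)]
    assume "?s x = x"
    then have "x \<otimes> c \<otimes> inv x = c" using conj_eq_iff[of c x x] conj_eq_iff[of x c c] xG c by simp
    moreover have "c \<in> ?H" using c(1) by (intro range_eqI[of _ _ 1]) simp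
    ultimately have "x \<in> ?H" using self_norm[OF xG] by simp
    then show False using KH that by blast
  qed
  have s_ne_one: "?s x \<noteq> \<one>" if "x \<in> K" "x \<noteq> \<one>" for x
    using that KG c conj_eq_iff[of c x \<one>] by auto
  have "\<not> K \<subseteq> {\<one>}" using card_mono[of "{\<one>}" K] K(2) by auto
  then obtain a where a: "a \<in> K" "a \<noteq> \<one>" by blast
  define b where "b = ?s a"
  define d where "d = ?s b"
  have b: "b \<in> K" "b \<noteq> \<one>" "b \<noteq> a" unfolding b_def using s_K s_ne s_ne_one a by auto
  have d: "d \<in> K" "d \<noteq> \<one>" "d \<noteq> b" unfolding d_def using s_K s_ne s_ne_one b by auto
  note aG = KG[OF a(1)] and bG = KG[OF b(1)] and dG = KG[OF d(1)]
  have c3: "c \<otimes> (c \<otimes> c) = \<one>"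
    using c pow_ord_eq_1[OF c(1)] by (simp add: numeral_eq_Suc m_assoc)
  have sd: "?s d = a"
  proof -
    have "?s d = c \<otimes> (c \<otimes> c) \<otimes> a \<otimes> inv (c \<otimes> (c \<otimes> c))"
      unfolding d_def b_def using aG c(1) by (simp add: m_assoc inv_mult_group)
    then show ?thesis using c3 aG by simp
  qed
  have "d \<noteq> a" using sd s_ne[OF d(1,2)] by auto
  have K_eq: "K = {\<one>, a, b, d}"
  proof (rule card_subset_eq[symmetric])
    show "finite K" using K(2) by (simp add: card_ge_0_finite)
    show "{\<one>, a, b, d} \<subseteq> K" using a b d K(1) by (simp add: subgroup.one_closed)
    show "card {\<one>, a, b, d} = card K" using a b d \<open>d \<noteq> a\<close> K(2) by auto
  qed
  have inv_s: "?s (inv x) = inv (?s x)" if "x \<in> K" for x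
    using KG[OF that] c(1) by (simp add: m_assoc inv_mult_group)
  \<comment> \<open>Inversion commutes with the cycle from \<open>a\<close> to \<open>b\<close> to
    \<open>d\<close> and back to \<open>a\<close>. If it moved \<open>a\<close> one or two steps
    along, it would do so everywhere, and its square could not be the identity.\<close>
  have "inv a = a"
  proof -
    have "inv a \<in> K" "inv a \<noteq> \<one>" using a K(1) aG by (auto simp: subgroup.m_inv_closed inv_eq_1_iff)
    then have "inv a = a \<or> inv a = b \<or> inv a = d" using K_eq by auto
    moreover have "inv a \<noteq> b"
    proof
      assume ab: "inv a = b"
      then have "inv b = d" using inv_s[OF a(1)] by (simp add: b_def[symmetric] d_def[symmetric])
      then show False using ab aG \<open>d \<noteq> a\<close> by (metis inv_inv)
    qed
    moreover have "inv a \<noteq> d"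
    proof
      assume ad: "inv a = d"
      then have "inv b = a" using inv_s[OF a(1)] sd by (simp add: b_def[symmetric])
      then show False using ad bG d(3) by (metis inv_inv)
    qed
    ultimately show ?thesis by blast
  qed
  then have a2: "a \<otimes> a = \<one>" using aG by (metis l_inv)
  have b2: "b \<otimes> b = \<one>" using s_hom[OF aG aG] a2 s_one by (simp add: b_def)
  have prod_d: "x \<otimes> x' = d" if "x = a \<and> x' = b \<or> x = b \<and> x' = a" for x x'
  proof -
    have xK: "x \<in> K" "x' \<in> K" "x \<noteq> \<one>" "x' \<noteq> \<one>" "x \<noteq> x'" "x' \<otimes> x' = \<one>"
      using that a b a2 b2 by auto
    then have "x \<otimes> x' \<in> K" using K(1) by (simp add: subgroup.m_closed)
    moreover have "x \<otimes> x' \<noteq> \<one>" using xK KG by (metis inv_equality)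
    moreover have "x \<otimes> x' \<noteq> x" "x \<otimes> x' \<noteq> x'" using xK KG by simp_all
    ultimately show ?thesis using K_eq that by auto
  qed
  have ba: "b \<otimes> a = a \<otimes> b" and ab: "a \<otimes> b = d" using prod_d by metis+
  have ca: "c \<otimes> a = b \<otimes> c" using conj_eq_iff[of c a b] aG bG c by (simp add: b_def)
  have "c \<otimes> b = d \<otimes> c" using conj_eq_iff[of c b d] dG bG c by (simp add: d_def)
  then have cb: "c \<otimes> b = a \<otimes> (b \<otimes> c)" using ab aG bG c by (simp add: m_assoc[symmetric])
  let ?\<phi> = "\<lambda>(p, q, k::int). (if p then a else \<one>) \<otimes> ((if q then b else \<one>) \<otimes> c [^] k)"
  have \<phi>: "?\<phi> \<in> hom tetra G" by (rule hom_tetra[OF aG bG c(1) a2 b2 ba c3 ca cb])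
  have in_img: "?\<phi> (p, q, k) \<in> ?\<phi> ` carrier tetra" if "k \<in> {0, 1}" for p q k
    by (rule imageI) (use that in \<open>auto simp: tetra_def\<close>)
  have img: "{\<one>, a, b, d, c} \<subseteq> ?\<phi> ` carrier tetra"
    using in_img[of 0 False False] in_img[of 0 True False] in_img[of 0 False True]
      in_img[of 0 True True] in_img[of 1 False False] aG bG c ab by simp
  have "c \<notin> K"
  proof
    assume "c \<in> K"
    then have "ord c dvd 4" using ord_dvd_card_subgroup[OF K(1)] K by metis
    then show False using c by simp
  qed
  then show ?thesis
    using iso_by_extension[OF group_tetra fin \<phi> _ K(1), of c 3] img K_eq K(2) order order_tetra by auto
qed

lemma order_12:
  assumes fin: "finite (carrier G)" and order: "order G = 12"
  shows "G \<cong> integer_mod_group 12 \<or> G \<cong> dicyclic 3 \<or>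
    G \<cong> integer_mod_group 6 \<times>\<times> integer_mod_group 2 \<or> G \<cong> dihedral 6 \<or> G \<cong> tetra"
proof -
  obtain c where c: "c \<in> carrier G" "ord c = 3" using cauchy[OF fin, of 3] order by auto
  have "order G = 2 ^ 2 * 3" using order by simp
  then obtain K where K: "subgroup K G" "card K = 4"
    using sylow_thm[OF two_is_prime_nat group_axioms _ fin] by (metis power2_eq_square mult_2 numeral_Bit0)
  show ?thesis
    using order_12_normal[OF fin order c K] order_12_not_normal[OF fin order c K] by blast
qed

end

section \<open>Lower bounds\<close>

lemma pow_DirProd:
  "(a, b) [^]\<^bsub>G \<times>\<times> H\<^esub> (n::nat) = (a [^]\<^bsub>G\<^esub> n, b [^]\<^bsub>H\<^esub> n)"
  by (induction n) auto

lemma comm_group_DirProd: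
  assumes "comm_group G" "comm_group H"
  shows "comm_group (G \<times>\<times> H)"
proof -
  interpret G: comm_group G by fact
  interpret H: comm_group H by fact
  show ?thesis
    by (rule group.group_comm_groupI[OF DirProd_group[OF G.group_axioms H.group_axioms]])
      (auto simp: G.m_comm H.m_comm)
qed

lemma app_ge_integer_mod_group:
  assumes "n > 1"
  shows "1 \<le> endapp (integer_mod_group n) \<and> 2 \<le> affapp (integer_mod_group n)"
proof -
  let ?M = "integer_mod_group n"
  interpret group ?M by simp
  have "\<exists>\<phi>\<in>hom ?M ?M. \<forall>x\<in>{1}. \<phi> x = w x" if w: "w \<in> {1} \<rightarrow> carrier ?M" for w
  proof -
    have "w 1 [^]\<^bsub>?M\<^esub> n = \<one>\<^bsub>?M\<^esub>" by simp
    then have "(\<lambda>i. w 1 [^]\<^bsub>?M\<^esub> i) \<in> hom ?M ?M"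
      using w by (intro hom_integer_mod_group) auto
    then show ?thesis using w by (intro bexI) auto
  qed
  then show ?thesis
    using free_set_le_app[of ?M "{1}" 1] assms by (simp add: carrier_integer_mod_group)
qed

text \<open>As \<open>k\<close> divides \<open>n\<close>, every element is killed by
  \<open>n\<close>. So the generator of the first factor can be sent anywhere, by a homomorphism
  that factors through the first projection.\<close>

lemma app_ge_DirProd_dvd:
  assumes "n > 1" "k dvd n"
  shows "1 \<le> endapp (integer_mod_group n \<times>\<times> integer_mod_group k) \<and>
    2 \<le> affapp (integer_mod_group n \<times>\<times> integer_mod_group k)"
proof -
  let ?M = "integer_mod_group n \<times>\<times> integer_mod_group k"
  have k: "k > 0" using assms by (auto intro: Nat.gr0I)
  interpret group ?M by (simp add: DirProd_group)
  have "\<exists>\<phi>\<in>hom ?M ?M. \<forall>x\<in>{(1, 0)}. \<phi> x = w x" if w: "w \<in> {(1, 0)} \<rightarrow> carrier ?M" for w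
  proof -
    obtain a b where ab: "w (1, 0) = (a, b)" by fastforce
    obtain l where "n = k * l" using assms by auto
    then have "w (1, 0) [^]\<^bsub>?M\<^esub> n = \<one>\<^bsub>?M\<^esub>" by (simp add: ab pow_DirProd mult.assoc)
    then have "(\<lambda>i. w (1, 0) [^]\<^bsub>?M\<^esub> i) \<in> hom (integer_mod_group n) ?M"
      using w by (intro hom_integer_mod_group) auto
    then have "(\<lambda>i. w (1, 0) [^]\<^bsub>?M\<^esub> i) \<circ> fst \<in> hom ?M ?M"
      by (subst hom_of_fst) (auto simp: DirProd_group)
    then show ?thesis using w by (intro bexI) auto
  qed
  moreover have "finite (carrier ?M)" using assms k by (simp add: carrier_integer_mod_group)
  ultimately show ?thesis
    using free_set_le_app[of ?M "{(1, 0)}" 1] assms k group_axioms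
    by (simp add: carrier_integer_mod_group numeral_2_eq_2)
qed

lemma app_ge_prime_square:
  assumes "p > 1"
  shows "2 \<le> endapp (integer_mod_group p \<times>\<times> integer_mod_group p) \<and>
    3 \<le> affapp (integer_mod_group p \<times>\<times> integer_mod_group p)"
proof -
  let ?M = "integer_mod_group p \<times>\<times> integer_mod_group p"
  interpret comm_group ?M by (simp add: comm_group_DirProd)
  let ?E = "{(1, 0), (0, 1)}"
  have "\<exists>\<phi>\<in>hom ?M ?M. \<forall>x\<in>?E. \<phi> x = w x" if w: "w \<in> ?E \<rightarrow> carrier ?M" for w
  proof -
    have pow: "x [^]\<^bsub>?M\<^esub> p = \<one>\<^bsub>?M\<^esub>" for x by (cases x) (simp add: pow_DirProd)
    have "(\<lambda>(a::int, b::int). w (1, 0) [^]\<^bsub>?M\<^esub> a \<otimes>\<^bsub>?M\<^esub> w (0, 1) [^]\<^bsub>?M\<^esub> b) \<in> hom ?M ?M"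
      using w pow by (intro hom_DirProd hom_integer_mod_group m_comm int_pow_closed) auto
    then show ?thesis using w r_one[of "w (1, 0)"] l_one[of "w (0, 1)"] by (intro bexI) auto
  qed
  moreover have "finite (carrier ?M)" using assms by (simp add: carrier_integer_mod_group)
  ultimately show ?thesis
    using free_set_le_app[of ?M ?E 2] assms group_axioms
    by (simp add: carrier_integer_mod_group numeral_2_eq_2 numeral_3_eq_3)
qed

lemma app_ge_Z2_Z2_Z2:
  "3 \<le> endapp (integer_mod_group 2 \<times>\<times> integer_mod_group 2 \<times>\<times> integer_mod_group 2) \<and>
    4 \<le> affapp (integer_mod_group 2 \<times>\<times> integer_mod_group 2 \<times>\<times> integer_mod_group 2)"
proof -
  let ?V = "integer_mod_group 2 \<times>\<times> integer_mod_group 2"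
  let ?M = "integer_mod_group 2 \<times>\<times> ?V"
  interpret comm_group ?M by (simp add: comm_group_DirProd)
  let ?E = "{(1, 0, 0), (0, 1, 0), (0, 0, 1)}"
  have "\<exists>\<phi>\<in>hom ?M ?M. \<forall>x\<in>?E. \<phi> x = w x" if w: "w \<in> ?E \<rightarrow> carrier ?M" for w
  proof -
    have pow: "x [^]\<^bsub>?M\<^esub> (2::nat) = \<one>\<^bsub>?M\<^esub>" for x by (cases x) (simp add: pow_DirProd)
    have wM: "w (1, 0, 0) \<in> carrier ?M" "w (0, 1, 0) \<in> carrier ?M" "w (0, 0, 1) \<in> carrier ?M"
      using w by (blast dest: Pi_mem)+
    have \<psi>: "(\<lambda>(a::int, b::int). w (0, 1, 0) [^]\<^bsub>?M\<^esub> a \<otimes>\<^bsub>?M\<^esub> w (0, 0, 1) [^]\<^bsub>?M\<^esub> b) \<in> hom ?V ?M"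
      using wM pow by (intro hom_DirProd hom_integer_mod_group m_comm int_pow_closed) auto
    have "(\<lambda>(c::int, v). w (1, 0, 0) [^]\<^bsub>?M\<^esub> c \<otimes>\<^bsub>?M\<^esub>
        (case v of (a::int, b::int) \<Rightarrow> w (0, 1, 0) [^]\<^bsub>?M\<^esub> a \<otimes>\<^bsub>?M\<^esub> w (0, 0, 1) [^]\<^bsub>?M\<^esub> b)) \<in> hom ?M ?M"
      using wM pow
      by (intro hom_DirProd \<psi> hom_integer_mod_group m_comm int_pow_closed hom_in_carrier[OF \<psi>])
        (auto simp: DirProd_group)
    moreover have "w (1, 0, 0) [^]\<^bsub>?M\<^esub> (1::int) \<otimes>\<^bsub>?M\<^esub> (\<one>\<^bsub>?M\<^esub> \<otimes>\<^bsub>?M\<^esub> \<one>\<^bsub>?M\<^esub>) = w (1, 0, 0)"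
      "\<one>\<^bsub>?M\<^esub> \<otimes>\<^bsub>?M\<^esub> (w (0, 1, 0) [^]\<^bsub>?M\<^esub> (1::int) \<otimes>\<^bsub>?M\<^esub> \<one>\<^bsub>?M\<^esub>) = w (0, 1, 0)"
      "\<one>\<^bsub>?M\<^esub> \<otimes>\<^bsub>?M\<^esub> (\<one>\<^bsub>?M\<^esub> \<otimes>\<^bsub>?M\<^esub> w (0, 0, 1) [^]\<^bsub>?M\<^esub> (1::int)) = w (0, 0, 1)"
      using wM by (simp_all only: int_pow_1 r_one l_one one_closed)
    ultimately show ?thesis by (intro bexI) (simp_all del: one_DirProd)
  qed
  moreover have "finite (carrier ?M)" by (simp add: carrier_integer_mod_group)
  ultimately show ?thesis
    using free_set_le_app[of ?M ?E 3] group_axioms by (simp add: carrier_integer_mod_group)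
qed

text \<open>The rotation \<open>r\<close> can be sent to \<open>r^j\<close> by a map that fixes
  \<open>s\<close>. For even \<open>n\<close> it can also be sent to a reflection, with
  \<open>s\<close> going to \<open>\<one>\<close>, through the Klein four-group quotient.\<close>

lemma app_ge_dihedral_even:
  assumes "even n" "n > 1"
  shows "1 \<le> endapp (dihedral n) \<and> 2 \<le> affapp (dihedral n)"
proof -
  let ?M = "dihedral n"
  have gr: "group ?M" using assms by (simp add: group_dihedral)
  have fin: "finite (carrier ?M)" by (simp add: dihedral_def)
  interpret group ?M by fact
  have "\<exists>\<phi>\<in>hom ?M ?M. \<forall>x\<in>{(1, False)}. \<phi> x = w x" if w: "w \<in> {(1, False)} \<rightarrow> carrier ?M" for w
  proof -
    obtain j b where jb: "w (1, False) = (j, b)" by fastforce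
    have jb_in: "(j, b) \<in> carrier ?M" using w jb by auto
    show ?thesis
    proof (cases b)
      case False
      have "(\<lambda>(i, a). (i * j mod int n, a)) \<in> hom ?M ?M"
        using assms by (auto simp: hom_def dihedral_def mod_simps algebra_simps)
      then show ?thesis
        using jb jb_in False by (intro bexI) (auto simp: dihedral_def)
    next
      case True
      have sq: "(j, b) \<otimes>\<^bsub>?M\<^esub> (j, b) = \<one>\<^bsub>?M\<^esub>" using True by (simp add: dihedral_def)
      have "(\<lambda>(i, a). (j, b) [^]\<^bsub>?M\<^esub> i \<otimes>\<^bsub>?M\<^esub> (if a then \<one>\<^bsub>?M\<^esub> else \<one>\<^bsub>?M\<^esub>)) \<in> hom ?M ?M"
        using jb_in sq assms by (intro hom_klein) auto
      then show ?thesis using jb jb_in by (intro bexI) auto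
    qed
  qed
  then show ?thesis
    using free_set_le_app[OF gr fin, of "{(1, False)}" 1] assms by (simp add: dihedral_def)
qed

text \<open>Two values of an affine map can be prescribed at \<open>x\<close> and \<open>y\<close> iff some endomorphism maps
  \<open>x\<^sup>-\<^sup>1 y\<close> to the quotient of the values; similarly for three values.\<close>

lemma affine_agreement_ge:
  fixes M (structure)
  assumes "group M" "finite (carrier M)" "f \<in> carrier M \<rightarrow> carrier M" "\<phi> \<in> hom M M"
    and "x \<in> carrier M" "E \<subseteq> carrier M" "x \<notin> E"
    and "\<And>y. y \<in> E \<Longrightarrow> \<phi> (inv x \<otimes> y) = inv (f x) \<otimes> f y"
  shows "\<exists>g\<in>carrier M. \<exists>\<phi>\<in>hom M M. Suc (card E) \<le> agreement M (\<lambda>x. g \<otimes> \<phi> x) f"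
proof -
  interpret group M by fact
  interpret \<phi>: group_hom M M \<phi> using assms by unfold_locales
  let ?g = "f x \<otimes> inv (\<phi> x)"
  have fx: "f x \<in> carrier M" using assms by auto
  have "?g \<otimes> \<phi> y = f y" if "y \<in> insert x E" for y
  proof (cases "y = x")
    case True
    then show ?thesis using assms fx by (simp add: m_assoc)
  next
    case False
    then have y: "y \<in> E" "y \<in> carrier M" using that assms by auto
    then have fy: "f y \<in> carrier M" using assms by auto
    have "?g \<otimes> \<phi> y = f x \<otimes> \<phi> (inv x \<otimes> y)" using assms(5) fx y by (simp add: m_assoc)
    also have "\<dots> = f x \<otimes> (inv (f x) \<otimes> f y)" using assms(8)[OF y(1)] by (simp only:)
    also have "\<dots> = f y" using fx fy by (simp add: m_assoc[symmetric])
    finally show ?thesis .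
  qed
  then have "Suc (card E) \<le> agreement M (\<lambda>x. ?g \<otimes> \<phi> x) f"
    using assms by (intro agreement_geI[of M "insert x E"]) (auto simp: finite_subset)
  then show ?thesis using assms fx by (intro bexI[of _ ?g] bexI[of _ \<phi>]) auto
qed

lemma affapp_ge_2I:
  fixes M (structure)
  assumes "group M" "finite (carrier M)"
    and "\<And>f. f \<in> carrier M \<rightarrow> carrier M \<Longrightarrow> \<exists>x\<in>carrier M. \<exists>y\<in>carrier M. \<exists>\<phi>\<in>hom M M.
      x \<noteq> y \<and> \<phi> (inv x \<otimes> y) = inv (f x) \<otimes> f y"
  shows "2 \<le> affapp M"
proof (rule affapp_geI[OF assms(1,2)])
  fix f assume f: "f \<in> carrier M \<rightarrow> carrier M"
  then obtain x y \<phi> where "x \<in> carrier M" "y \<in> carrier M" "\<phi> \<in> hom M M" "x \<noteq> y"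
    "\<phi> (inv x \<otimes> y) = inv (f x) \<otimes> f y" using assms(3) by meson
  then show "\<exists>g\<in>carrier M. \<exists>\<phi>\<in>hom M M. 2 \<le> agreement M (\<lambda>x. g \<otimes> \<phi> x) f"
    using affine_agreement_ge[OF assms(1,2) f, of \<phi> x "{y}"] by (simp add: numeral_2_eq_2)
qed

text \<open>Stated as a refutation: the absence of a triple becomes a rule that each case of the
  later arguments can invoke with its own points and endomorphism.\<close>

lemma affapp_ge_3I:
  fixes M (structure)
  assumes "group M" "finite (carrier M)"
    and "\<And>f. f \<in> carrier M \<rightarrow> carrier M \<Longrightarrow>
      (\<And>x y z \<phi>. x \<in> carrier M \<Longrightarrow> y \<in> carrier M \<Longrightarrow> z \<in> carrier M \<Longrightarrow> \<phi> \<in> hom M M \<Longrightarrow>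
        x \<noteq> y \<Longrightarrow> x \<noteq> z \<Longrightarrow> y \<noteq> z \<Longrightarrow> \<phi> (inv x \<otimes> y) = inv (f x) \<otimes> f y \<Longrightarrow>
        \<phi> (inv x \<otimes> z) = inv (f x) \<otimes> f z \<Longrightarrow> False) \<Longrightarrow> False"
  shows "3 \<le> affapp M"
proof (rule affapp_geI[OF assms(1,2)], rule ccontr)
  fix f assume f: "f \<in> carrier M \<rightarrow> carrier M"
    and none: "\<not> (\<exists>g\<in>carrier M. \<exists>\<phi>\<in>hom M M. 3 \<le> agreement M (\<lambda>x. g \<otimes> \<phi> x) f)"
  show False
  proof (rule assms(3)[OF f])
    fix x y z \<phi>
    assume "x \<in> carrier M" "y \<in> carrier M" "z \<in> carrier M" "\<phi> \<in> hom M M"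
      "x \<noteq> y" "x \<noteq> z" "y \<noteq> z" "\<phi> (inv x \<otimes> y) = inv (f x) \<otimes> f y"
      "\<phi> (inv x \<otimes> z) = inv (f x) \<otimes> f z"
    then show False
      using affine_agreement_ge[OF assms(1,2) f, of \<phi> x "{y, z}"] none
      by (auto simp: numeral_3_eq_3)
  qed
qed

text \<open>If no affine map agrees with \<open>f\<close> twice, then \<open>f\<close> is injective,
  because constant maps are affine. Points in different cosets of the index-2 subgroup must have
  values in the same coset, since otherwise \<open>hom\<close> applies to the two quotients. So all
  values lie in one coset, which is too small for an injective map.\<close>

lemma affapp_ge_2_index_2:
  fixes M :: "(int \<times> bool) monoid"
  assumes gr: "group M" and fin: "finite (carrier M)"
    and snd: "\<And>x y. x \<in> carrier M \<Longrightarrow> y \<in> carrier M \<Longrightarrow> snd (x \<otimes>\<^bsub>M\<^esub> y) \<longleftrightarrow> snd x \<noteq> snd y"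
    and half: "\<And>b. 2 * card {x \<in> carrier M. snd x = b} = order M"
    and hom: "\<And>u v. u \<in> carrier M \<Longrightarrow> v \<in> carrier M \<Longrightarrow> snd u \<Longrightarrow> snd v \<Longrightarrow> \<exists>\<phi>\<in>hom M M. \<phi> u = v"
  shows "2 \<le> affapp M"
proof (rule affapp_ge_2I[OF gr fin], rule ccontr)
  interpret group M by fact
  fix f assume f: "f \<in> carrier M \<rightarrow> carrier M"
    and none: "\<not> (\<exists>x\<in>carrier M. \<exists>y\<in>carrier M. \<exists>\<phi>\<in>hom M M.
      x \<noteq> y \<and> \<phi> (inv\<^bsub>M\<^esub> x \<otimes>\<^bsub>M\<^esub> y) = inv\<^bsub>M\<^esub> (f x) \<otimes>\<^bsub>M\<^esub> f y)"
  have snd_one: "\<not> snd \<one>\<^bsub>M\<^esub>" using snd[of "\<one>\<^bsub>M\<^esub>" "\<one>\<^bsub>M\<^esub>"] by simp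
  have snd_inv: "snd (inv\<^bsub>M\<^esub> x) = snd x" if "x \<in> carrier M" for x
    using snd[of "inv\<^bsub>M\<^esub> x" x] that snd_one by simp
  have inj: "inj_on f (carrier M)"
  proof (rule inj_onI, rule ccontr)
    fix x y assume "x \<in> carrier M" "y \<in> carrier M" "f x = f y" "x \<noteq> y"
    then show False using none f trivial_hom[of M M] gr by force
  qed
  have cross: "snd (f x) = snd (f y)" if "x \<in> carrier M" "y \<in> carrier M" "snd x \<noteq> snd y" for x y
  proof (rule ccontr)
    assume "snd (f x) \<noteq> snd (f y)"
    moreover have fxy: "f x \<in> carrier M" "f y \<in> carrier M" using that f by auto
    ultimately have "snd (inv\<^bsub>M\<^esub> (f x) \<otimes>\<^bsub>M\<^esub> f y)" "snd (inv\<^bsub>M\<^esub> x \<otimes>\<^bsub>M\<^esub> y)"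
      using that(1,2,3) snd[of "inv\<^bsub>M\<^esub> x" y] snd[of "inv\<^bsub>M\<^esub> (f x)" "f y"]
        snd_inv[of x] snd_inv[of "f x"] inv_closed by blast+
    moreover have "inv\<^bsub>M\<^esub> x \<otimes>\<^bsub>M\<^esub> y \<in> carrier M" "inv\<^bsub>M\<^esub> (f x) \<otimes>\<^bsub>M\<^esub> f y \<in> carrier M"
      using that(1,2) fxy by simp_all
    ultimately obtain \<phi> where "\<phi> \<in> hom M M" "\<phi> (inv\<^bsub>M\<^esub> x \<otimes>\<^bsub>M\<^esub> y) = inv\<^bsub>M\<^esub> (f x) \<otimes>\<^bsub>M\<^esub> f y"
      using hom by meson
    moreover have "x \<noteq> y" using that by auto
    ultimately show False using none that(1,2) by meson
  qed
  have "card {x \<in> carrier M. snd x = True} > 0"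
    using half[of True] order_gt_0_iff_finite fin by (metis mult_0_right neq0_conv)
  then obtain x0 where x0: "x0 \<in> carrier M" "snd x0" by (auto simp: card_gt_0_iff)
  have one: "snd (f \<one>\<^bsub>M\<^esub>) = snd (f x0)" using cross[of "\<one>\<^bsub>M\<^esub>" x0] x0 snd_one by simp
  have "snd (f x) = snd (f x0)" if "x \<in> carrier M" for x
    proof (cases "snd x")
    case True
    then show ?thesis using cross[OF that one_closed] snd_one one by simp
  next
    case False
    then show ?thesis using cross[OF that x0(1)] x0(2) by simp
  qed
  then have "f ` carrier M \<subseteq> {x \<in> carrier M. snd x = snd (f x0)}" using f by auto
  then have "card (carrier M) \<le> card {x \<in> carrier M. snd x = snd (f x0)}"
    using inj fin by (intro card_inj_on_le[of f]) auto
  then show False using half[of "snd (f x0)"] order_gt_0_iff_finite fin by (simp add: order_def)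
qed

lemma affapp_ge_dihedral:
  assumes "n > 0"
  shows "2 \<le> affapp (dihedral n)"
proof (rule affapp_ge_2_index_2)
  show gr: "group (dihedral n)" using assms by (rule group_dihedral)
  interpret group "dihedral n" by fact
  fix u v assume uv: "u \<in> carrier (dihedral n)" "v \<in> carrier (dihedral n)" "snd u" "snd v"
  have "v \<otimes>\<^bsub>dihedral n\<^esub> v = \<one>\<^bsub>dihedral n\<^esub>"
    using uv by (cases v) (auto simp: dihedral_def)
  \<comment> \<open>Killing the rotations sends every reflection to \<open>v\<close>.\<close>
  then have "(\<lambda>(i, a). \<one>\<^bsub>dihedral n\<^esub> [^]\<^bsub>dihedral n\<^esub> i \<otimes>\<^bsub>dihedral n\<^esub>
      (if a then v else \<one>\<^bsub>dihedral n\<^esub>)) \<in> hom (dihedral n) (dihedral n)"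
    using uv by (intro hom_dihedral) auto
  then show "\<exists>\<phi>\<in>hom (dihedral n) (dihedral n). \<phi> u = v"
    using uv by (intro bexI) (auto split: prod.splits)
next
  fix b
  have "{x \<in> carrier (dihedral n). snd x = b} = {0..<int n} \<times> {b}" by (auto simp: dihedral_def)
  then show "2 * card {x \<in> carrier (dihedral n). snd x = b} = order (dihedral n)"
    by (simp add: order_dihedral card_cartesian_product)
qed (auto simp: dihedral_def)

text \<open>Modulo \<open>r^2\<close> the group is cyclic of order 4, generated by \<open>s\<close>.
  The endomorphisms used factor through this quotient: \<open>r\<close> goes to the central
  involution \<open>z\<close> and \<open>s\<close> to an element with square \<open>z\<close>. Since
  \<open>u = r^i s\<close> goes to \<open>z^i\<close> times the image of \<open>s\<close>, this
  image is \<open>v\<close> or \<open>z v\<close> according to the parity of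
  \<open>i\<close>.\<close>

lemma affapp_ge_dicyclic_3: "2 \<le> affapp (dicyclic 3)"
proof (rule affapp_ge_2_index_2)
  let ?M = "dicyclic 3"
  show gr: "group ?M" by (simp add: group_dicyclic)
  interpret group ?M by fact
  fix u v assume uv: "u \<in> carrier ?M" "v \<in> carrier ?M" "snd u" "snd v"
  obtain i where u: "u = (i, True)" using uv by (cases u) auto
  define z where "z = v \<otimes>\<^bsub>?M\<^esub> v"
  define s where "s = (if even i then v else z \<otimes>\<^bsub>?M\<^esub> v)"
  have z: "z = (3, False)" using uv by (cases v) (auto simp: z_def dicyclic_def)
  have zM: "z \<in> carrier ?M" and z2: "z \<otimes>\<^bsub>?M\<^esub> z = \<one>\<^bsub>?M\<^esub>" by (auto simp: z dicyclic_def)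
  have zv: "v \<otimes>\<^bsub>?M\<^esub> z = z \<otimes>\<^bsub>?M\<^esub> v" using uv by (simp add: z_def m_assoc)
  have s: "s \<in> carrier ?M" using uv zM by (simp add: s_def)
  have ss: "s \<otimes>\<^bsub>?M\<^esub> s = z" and sz: "s \<otimes>\<^bsub>?M\<^esub> z = z \<otimes>\<^bsub>?M\<^esub> s"
    using uv(2) zM z2 zv unfolding s_def
    by (auto simp: z_def[symmetric]) (metis m_assoc m_closed l_one z_def)+
  have pow2: "z [^]\<^bsub>?M\<^esub> (2::nat) = \<one>\<^bsub>?M\<^esub>" using z2 zM by (simp add: numeral_2_eq_2)
  have "inv\<^bsub>?M\<^esub> z = z" using z2 zM by (simp add: inv_equality)
  moreover have "z [^]\<^bsub>?M\<^esub> (2 * 3 :: nat) = \<one>\<^bsub>?M\<^esub>"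
    using nat_pow_pow[OF zM, of 2 3] by (simp add: pow2)
  moreover have "z [^]\<^bsub>?M\<^esub> (3::nat) = z"
    using nat_pow_mult[OF zM, of 2 1] zM by (simp add: pow2)
  ultimately have hom: "(\<lambda>(i, a). z [^]\<^bsub>?M\<^esub> i \<otimes>\<^bsub>?M\<^esub> (if a then s else \<one>\<^bsub>?M\<^esub>)) \<in> hom ?M ?M"
    using zM s ss sz by (intro hom_dicyclic) auto
  have "z [^]\<^bsub>?M\<^esub> i = z [^]\<^bsub>?M\<^esub> (i mod 2)" using int_pow_mod[OF zM pow2, of i] by simp
  then have "z [^]\<^bsub>?M\<^esub> i = (if even i then \<one>\<^bsub>?M\<^esub> else z)" using zM by (simp add: even_iff_mod_2_eq_zero odd_iff_mod_2_eq_one)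
  moreover have "z \<otimes>\<^bsub>?M\<^esub> (z \<otimes>\<^bsub>?M\<^esub> v) = v" using z2 zM uv by (simp add: m_assoc[symmetric])
  ultimately have "z [^]\<^bsub>?M\<^esub> i \<otimes>\<^bsub>?M\<^esub> s = v" using uv by (simp add: s_def)
  then show "\<exists>\<phi>\<in>hom ?M ?M. \<phi> u = v"
    using hom u by (intro bexI) auto
next
  fix b
  have "{x \<in> carrier (dicyclic 3). snd x = b} = {0..<6} \<times> {b}" by (auto simp: dicyclic_def)
  then show "2 * card {x \<in> carrier (dicyclic 3). snd x = b} = order (dicyclic 3)"
    by (simp add: order_dicyclic card_cartesian_product)
qed (auto simp: dicyclic_def)

section \<open>Homomorphisms through the quotient by the powers of \<open>r^2\<close>, a Klein
  four-group for even n\<close>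

definition parity :: "int \<times> bool \<Rightarrow> bool \<times> bool" where
  "parity = (\<lambda>(i, a). (odd i, a))"

text \<open>Linear independence over the field with two elements: distinct nonzero images in the
  Klein four-group.\<close>

definition independent :: "int \<times> bool \<Rightarrow> int \<times> bool \<Rightarrow> bool" where
  "independent u v \<longleftrightarrow>
     parity u \<noteq> (False, False) \<and> parity v \<noteq> (False, False) \<and> parity u \<noteq> parity v"

lemma parity_mult:
  assumes "even n" "M \<in> {dihedral n, dicyclic n}"
  shows "parity (x \<otimes>\<^bsub>M\<^esub> y) = (fst (parity x) \<noteq> fst (parity y), snd (parity x) \<noteq> snd (parity y))"
proof -
  have "odd (k mod int n) \<longleftrightarrow> odd k" "odd (k mod (2 * int n)) \<longleftrightarrow> odd k" for k
    using assms(1) by (simp_all add: dvd_mod_iff)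
  then show ?thesis
    using assms by (cases x; cases y) (auto simp: parity_def dihedral_def dicyclic_def)
qed

lemma (in monoid) pow_two: "x \<in> carrier G \<Longrightarrow> x [^] (2::nat) = x \<otimes> x"
  by (simp add: numeral_2_eq_2)

lemma (in monoid) pow_three: "x \<in> carrier G \<Longrightarrow> x [^] (3::nat) = x \<otimes> (x \<otimes> x)"
  by (simp add: numeral_3_eq_3 m_assoc)

text \<open>Sending \<open>r\<close> and \<open>s\<close> to commuting elements of order at most 2
  gives a homomorphism. Its values at \<open>u\<close> and \<open>v\<close> are prescribed by
  inverting the matrix of their parities over the field with two elements, so \<open>p\<close> and
  \<open>q\<close> are taken among \<open>U\<close>, \<open>W\<close> and
  \<open>U \<otimes> W\<close>.\<close>

lemma (in group) ex_hom_klein: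
  assumes n: "even n" "M \<in> {dihedral n, dicyclic n}" and uv: "independent u v"
    and UW: "U \<in> carrier G" "W \<in> carrier G" "U \<otimes> U = \<one>" "W \<otimes> W = \<one>" "U \<otimes> W = W \<otimes> U"
  obtains \<phi> where "\<phi> \<in> hom M G" "\<phi> u = U" "\<phi> v = W" "\<And>x. parity x = (False, False) \<Longrightarrow> \<phi> x = \<one>"
proof -
  note result = that
  have cancel: "U \<otimes> (U \<otimes> W) = W" "W \<otimes> (W \<otimes> U) = U"
    using UW(1-4) by (simp_all add: m_assoc[symmetric])
  have UWUW: "(U \<otimes> W) \<otimes> (U \<otimes> W) = \<one>"
    using UW cancel by (metis m_assoc m_closed)
  have cancel': "U \<otimes> W \<otimes> W = U" "W \<otimes> (U \<otimes> W) = U" "U \<otimes> W \<otimes> U = W"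
    using UW cancel by (metis m_assoc r_one)+
  have hom: thesis
    if pq: "p \<in> {U, W, U \<otimes> W}" "q \<in> {U, W, U \<otimes> W}"
      and u: "(if fst (parity u) then p else \<one>) \<otimes> (if snd (parity u) then q else \<one>) = U"
      and v: "(if fst (parity v) then p else \<one>) \<otimes> (if snd (parity v) then q else \<one>) = W"
    for p q
  proof -
    have pqG: "p \<in> carrier G" "q \<in> carrier G" "p \<otimes> p = \<one>" "q \<otimes> q = \<one>"
      using pq UW UWUW by auto
    have "p \<otimes> q = q \<otimes> p"
      using pq UW cancel cancel' by auto
    then have h: "(\<lambda>(i, a). p [^] i \<otimes> (if a then q else \<one>)) \<in> hom M G"
      using hom_klein[OF n pqG(1,2)] pqG by blast
    have "p [^] (2::nat) = \<one>" using pqG by (simp add: numeral_2_eq_2)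
    then have mod: "p [^] (i mod 2) = p [^] i" for i :: int
      using int_pow_mod[OF pqG(1), of 2 i] by simp
    have pow: "p [^] i = (if odd i then p else \<one>)" for i :: int
      using mod[of i] pqG(1) by (cases "even i") (simp_all add: even_iff_mod_2_eq_zero odd_iff_mod_2_eq_one)
    show thesis
    proof (rule result[OF h])
      show "(case u of (i, a) \<Rightarrow> p [^] i \<otimes> (if a then q else \<one>)) = U"
        using u pow[of "fst u"] by (simp add: parity_def case_prod_beta)
      show "(case v of (i, a) \<Rightarrow> p [^] i \<otimes> (if a then q else \<one>)) = W"
        using v pow[of "fst v"] by (simp add: parity_def case_prod_beta)
      fix x assume "parity x = (False, False)"
      then show "(case x of (i, a) \<Rightarrow> p [^] i \<otimes> (if a then q else \<one>)) = \<one>"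
        using pow[of "fst x"] by (simp add: parity_def case_prod_beta)
    qed
  qed
  have comm: "W \<otimes> U = U \<otimes> W" using UW by simp
  obtain a b c d where ab: "parity u = (a, b)" "parity v = (c, d)" by fastforce
  \<comment> \<open>The six invertible 2 by 2 matrices over the field with two elements.\<close>
  consider "a" "\<not> b" "\<not> c" "d" | "a" "\<not> b" "c" "d" | "\<not> a" "b" "c" "\<not> d" | "\<not> a" "b" "c" "d"
    | "a" "b" "c" "\<not> d" | "a" "b" "\<not> c" "d"
    using uv ab unfolding independent_def by (metis (full_types))
  then show thesis
  proof cases
    case 1 show ?thesis using hom[of U W] 1 ab UW by simp
  next
    case 2 show ?thesis using hom[of U "U \<otimes> W"] 2 ab UW cancel by simp
  next
    case 3 show ?thesis using hom[of W U] 3 ab UW by simp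
  next
    case 4 show ?thesis using hom[of "U \<otimes> W" U] 4 ab UW cancel' by simp
  next
    case 5 show ?thesis using hom[of W "U \<otimes> W"] 5 ab UW cancel' by simp
  next
    case 6 show ?thesis using hom[of "U \<otimes> W" W] 6 ab UW cancel' by simp
  qed
qed

lemma (in group) klein_hom_exists:
  assumes "even n" "M \<in> {dihedral n, dicyclic n}" "independent u v"
    and "U \<in> carrier G" "W \<in> carrier G" "U \<otimes> U = \<one>" "W \<otimes> W = \<one>" "U \<otimes> W = W \<otimes> U"
  shows "\<exists>\<phi>\<in>hom M G. \<phi> u = U \<and> \<phi> v = W \<and> (\<forall>x. parity x = (False, False) \<longrightarrow> \<phi> x = \<one>)"
  by (rule ex_hom_klein[OF assms]) blast

text \<open>The automorphism groups of the quaternion group and of \<open>Alt(4)\<close> are isomorphic to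
  \<open>Sym(4)\<close>, whose exponent is 12. So the eleventh power of an automorphism is its inverse, which
  moves any generating pair of the kind considered below to the standard one.\<close>

fun iterate :: "nat \<Rightarrow> ('a \<Rightarrow> 'a) \<Rightarrow> 'a \<Rightarrow> 'a" where
  "iterate 0 f x = x"
| "iterate (Suc n) f x = iterate n f (f x)"

lemma iterate_hom: "f \<in> hom M M \<Longrightarrow> iterate n f \<in> hom M M"
proof (induction n)
  case (Suc n)
  then show ?case using hom_compose[of f M M "iterate n f" M] by (simp add: comp_def)
qed (auto simp: hom_def)

text \<open>On \<open>\<alpha> r\<close> and \<open>\<alpha> s\<close> the iterate
  \<open>iterate n \<alpha>\<close> acts as an inverse of \<open>\<alpha>\<close>, so composing it
  with \<open>\<beta>\<close> moves one pair to the other.\<close>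

lemma ex_hom_by_iterate:
  assumes \<alpha>: "\<alpha> \<in> hom M M" "iterate (Suc n) \<alpha> r = r" "iterate (Suc n) \<alpha> s = s"
    and \<beta>: "\<beta> \<in> hom M M"
  shows "\<exists>\<phi>\<in>hom M M. \<phi> (\<alpha> r) = \<beta> r \<and> \<phi> (\<alpha> s) = \<beta> s"
  using hom_compose[OF iterate_hom[OF \<alpha>(1), of n] \<beta>] \<alpha>(2,3)
  by (intro bexI[of _ "\<beta> \<circ> iterate n \<alpha>"]) auto

fun check_all :: "('a \<Rightarrow> 'b \<Rightarrow> bool) \<Rightarrow> 'a \<Rightarrow> 'b list \<Rightarrow> bool" where
  "check_all P x [] = True"
| "check_all P x (y # ys) = (if P x y then check_all P x ys else False)"

fun check_all_pairs :: "('a \<Rightarrow> 'b \<Rightarrow> bool) \<Rightarrow> 'a list \<Rightarrow> 'b list \<Rightarrow> bool" where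
  "check_all_pairs P [] ys = True"
| "check_all_pairs P (x # xs) ys = (if check_all P x ys then check_all_pairs P xs ys else False)"

lemma check_all_iff: "check_all P x ys \<longleftrightarrow> (\<forall>y\<in>set ys. P x y)"
  by (induction ys) auto

lemma check_all_pairs_iff: "check_all_pairs P xs ys \<longleftrightarrow> (\<forall>x\<in>set xs. \<forall>y\<in>set ys. P x y)"
  by (induction xs) (auto simp: check_all_iff)

subsection \<open>The quaternion group\<close>

abbreviation "q8_mult \<equiv> twisted_mult_mod 4 2"

text \<open>Evaluable form of the endomorphism with \<open>r\<close> going to \<open>P\<close> and
  \<open>s\<close> to \<open>Q\<close>, on normal forms \<open>r^i s^a\<close>.\<close>

fun q8_img :: "int \<times> bool \<Rightarrow> int \<times> bool \<Rightarrow> int \<times> bool \<Rightarrow> int \<times> bool" where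
  "q8_img P Q (i, a) = q8_mult
     (if i = 0 then (0, False) else if i = 1 then P else if i = 2 then q8_mult P P
      else q8_mult P (q8_mult P P)) (if a then Q else (0, False))"

fun q8_check :: "int \<times> bool \<Rightarrow> int \<times> bool \<Rightarrow> bool" where
  "q8_check (i, a) (j, b) =
     (if (odd i, a) = (False, False) \<or> (odd j, b) = (False, False) \<or> (odd i, a) = (odd j, b) then True
      else q8_mult (q8_mult (i, a) (i, a)) (q8_mult (i, a) (i, a)) = (0, False) \<and>
        q8_mult (j, b) (j, b) = q8_mult (i, a) (i, a) \<and>
        q8_mult (i, a) (q8_mult (j, b) (i, a)) = (j, b) \<and>
        iterate 12 (q8_img (i, a) (j, b)) (1, False) = (1, False) \<and>
        iterate 12 (q8_img (i, a) (j, b)) (0, True) = (0, True))"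

declare q8_img.simps [simp del] q8_check.simps [simp del] twisted_mult_mod.simps [simp del]

lemma q8_check_iff:
  "q8_check P Q \<longleftrightarrow> (independent P Q \<longrightarrow>
     q8_mult (q8_mult P P) (q8_mult P P) = (0, False) \<and> q8_mult Q Q = q8_mult P P \<and>
     q8_mult P (q8_mult Q P) = Q \<and> iterate 12 (q8_img P Q) (1, False) = (1, False) \<and>
     iterate 12 (q8_img P Q) (0, True) = (0, True))"
  by (cases P; cases Q) (auto simp: q8_check.simps independent_def parity_def simp del: iterate.simps)

lemma q8_check:
  assumes "P \<in> carrier (dicyclic 2)" "Q \<in> carrier (dicyclic 2)"
  shows "q8_check P Q"
proof -
  let ?els = "[(0, False), (1, False), (2, False), (3, False), (0, True), (1, True), (2, True), (3, True)]"
  have "check_all_pairs q8_check ?els ?els" by code_simp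
  then have "\<forall>x\<in>set ?els. \<forall>y\<in>set ?els. q8_check x y" by (simp only: check_all_pairs_iff)
  moreover have "carrier (dicyclic 2) \<subseteq> set ?els" by (auto simp: dicyclic_def)
  ultimately show ?thesis using assms by blast
qed

text \<open>The kernel of \<open>parity\<close> is the center here, so an independent pair consists
  of two elements of order 4 in different cyclic subgroups. Such a pair generates the group and
  satisfies the defining relations.\<close>

lemma q8_hom:
  assumes PQ: "P \<in> carrier (dicyclic 2)" "Q \<in> carrier (dicyclic 2)" "independent P Q"
  shows "\<exists>\<alpha>\<in>hom (dicyclic 2) (dicyclic 2). \<alpha> (1, False) = P \<and> \<alpha> (0, True) = Q \<and>
    iterate 12 \<alpha> (1, False) = (1, False) \<and> iterate 12 \<alpha> (0, True) = (0, True)"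
proof -
  let ?M = "dicyclic 2"
  interpret group ?M by (simp add: group_dicyclic)
  have mult: "q8_mult x y = x \<otimes>\<^bsub>?M\<^esub> y" if "x \<in> carrier ?M" "y \<in> carrier ?M" for x y
    using dicyclic_mult[OF that] by simp
  have one: "(0, False) = \<one>\<^bsub>?M\<^esub>" by (simp add: dicyclic_def)
  have check: "P \<otimes>\<^bsub>?M\<^esub> P \<otimes>\<^bsub>?M\<^esub> (P \<otimes>\<^bsub>?M\<^esub> P) = \<one>\<^bsub>?M\<^esub>" "Q \<otimes>\<^bsub>?M\<^esub> Q = P \<otimes>\<^bsub>?M\<^esub> P"
    "P \<otimes>\<^bsub>?M\<^esub> (Q \<otimes>\<^bsub>?M\<^esub> P) = Q"
    "iterate 12 (q8_img P Q) (1, False) = (1, False)" "iterate 12 (q8_img P Q) (0, True) = (0, True)"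
    using q8_check[OF PQ(1,2)] PQ by (simp_all add: q8_check_iff mult one del: iterate.simps)
  have 2: "P [^]\<^bsub>?M\<^esub> (2::nat) = P \<otimes>\<^bsub>?M\<^esub> P"
    using PQ(1) by (rule pow_two)
  have 3: "P [^]\<^bsub>?M\<^esub> (3::nat) = P \<otimes>\<^bsub>?M\<^esub> (P \<otimes>\<^bsub>?M\<^esub> P)"
    using PQ(1) by (rule pow_three)
  have 4: "P [^]\<^bsub>?M\<^esub> (2 * 2 :: nat) = \<one>\<^bsub>?M\<^esub>"
    using nat_pow_mult[OF PQ(1), of 2 2] 2 check(1) by simp
  have "Q \<otimes>\<^bsub>?M\<^esub> P = inv\<^bsub>?M\<^esub> P \<otimes>\<^bsub>?M\<^esub> Q"
  proof -
    have "inv\<^bsub>?M\<^esub> P \<otimes>\<^bsub>?M\<^esub> (P \<otimes>\<^bsub>?M\<^esub> (Q \<otimes>\<^bsub>?M\<^esub> P)) = Q \<otimes>\<^bsub>?M\<^esub> P"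
      using PQ(1,2) by (simp add: m_assoc[symmetric])
    then show ?thesis unfolding check(3) by simp
  qed
  then have hom: "(\<lambda>(i, a). P [^]\<^bsub>?M\<^esub> i \<otimes>\<^bsub>?M\<^esub> (if a then Q else \<one>\<^bsub>?M\<^esub>)) \<in> hom ?M ?M"
    (is "?\<alpha> \<in> _") using PQ 2 4 check(2) by (intro hom_dicyclic) auto
  have eq: "?\<alpha> x = q8_img P Q x" if "x \<in> carrier ?M" for x
  proof -
    obtain i a where x: "x = (i, a)" by fastforce
    have "i \<in> {0, 1, 2, 3}" using that x by (auto simp: dicyclic_def)
    then show ?thesis
      using PQ 2 3 int_pow_int[of ?M P 2] int_pow_int[of ?M P 3] unfolding x q8_img.simps one
      by (auto simp: mult)
  qed
  have iter: "iterate n ?\<alpha> x = iterate n (q8_img P Q) x" if "x \<in> carrier ?M" for n x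
    using that
  proof (induction n arbitrary: x)
    case (Suc n)
    then show ?case using eq[OF Suc.prems] hom_in_carrier[OF hom Suc.prems] by simp
  qed simp
  have "(1, False) \<in> carrier ?M" "(0, True) \<in> carrier ?M" by (auto simp: dicyclic_def)
  then show ?thesis using hom check(4,5) iter PQ by (intro bexI[of _ ?\<alpha>]) auto
qed

lemma q8_ex_hom:
  assumes "u \<in> carrier (dicyclic 2)" "v \<in> carrier (dicyclic 2)" "independent u v"
    and "U \<in> carrier (dicyclic 2)" "W \<in> carrier (dicyclic 2)" "independent U W"
  obtains \<phi> where "\<phi> \<in> hom (dicyclic 2) (dicyclic 2)" "\<phi> u = U" "\<phi> v = W"
proof -
  obtain \<alpha> where \<alpha>: "\<alpha> \<in> hom (dicyclic 2) (dicyclic 2)" "\<alpha> (1, False) = u" "\<alpha> (0, True) = v"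
    "iterate (Suc 11) \<alpha> (1, False) = (1, False)" "iterate (Suc 11) \<alpha> (0, True) = (0, True)"
    using q8_hom[OF assms(1-3)] by (auto simp del: iterate.simps)
  obtain \<beta> where \<beta>: "\<beta> \<in> hom (dicyclic 2) (dicyclic 2)" "\<beta> (1, False) = U" "\<beta> (0, True) = W"
    using q8_hom[OF assms(4-6)] by blast
  show ?thesis using ex_hom_by_iterate[OF \<alpha>(1,4,5) \<beta>(1)] \<alpha> \<beta> that by auto
qed

lemma parity_quotient:
  assumes "group M" "even n" "M \<in> {dihedral n, dicyclic n}" "x \<in> carrier M"
  shows "parity (inv\<^bsub>M\<^esub> x \<otimes>\<^bsub>M\<^esub> y) = (fst (parity x) \<noteq> fst (parity y), snd (parity x) \<noteq> snd (parity y))"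
proof -
  interpret group M by fact
  have "parity (inv\<^bsub>M\<^esub> x \<otimes>\<^bsub>M\<^esub> x) = (False, False)"
    using assms(3,4) by (auto simp: dihedral_def dicyclic_def parity_def)
  then have "parity (inv\<^bsub>M\<^esub> x) = parity x"
    using parity_mult[OF assms(2,3), of "inv\<^bsub>M\<^esub> x" x] by (simp add: prod_eq_iff)
  then show ?thesis using parity_mult[OF assms(2,3)] by simp
qed

lemma parity_quotient_trivial_iff:
  assumes "group M" "even n" "M \<in> {dihedral n, dicyclic n}" "x \<in> carrier M"
  shows "parity (inv\<^bsub>M\<^esub> x \<otimes>\<^bsub>M\<^esub> y) = (False, False) \<longleftrightarrow> parity x = parity y"
  unfolding parity_quotient[OF assms] prod_eq_iff fst_conv snd_conv by blast

lemma independent_quotients: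
  assumes "group M" "even n" "M \<in> {dihedral n, dicyclic n}" "x \<in> carrier M"
  shows "independent (inv\<^bsub>M\<^esub> x \<otimes>\<^bsub>M\<^esub> y) (inv\<^bsub>M\<^esub> x \<otimes>\<^bsub>M\<^esub> z) \<longleftrightarrow>
    parity x \<noteq> parity y \<and> parity x \<noteq> parity z \<and> parity y \<noteq> parity z"
  unfolding independent_def parity_quotient[OF assms] prod_eq_iff fst_conv snd_conv by blast

lemma ex_independent:
  assumes "parity u \<noteq> (False, False)"
  obtains v where "v \<in> {(1, False), (0, True)}" "independent u v"
proof -
  have "independent u (1, False) \<or> independent u (0, True)"
    using assms by (auto simp: independent_def parity_def)
  then show ?thesis using that by blast
qed

lemma q8_center:
  assumes "U \<in> carrier (dicyclic 2)" "parity U = (False, False)"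
  shows "U = (0, False) \<or> U = (2, False)"
proof -
  obtain i a where U: "U = (i, a)" by fastforce
  then have "i \<in> {0, 1, 2, 3}" using assms(1) by (auto simp: dicyclic_def)
  then show ?thesis using assms(2) U by (auto simp: parity_def)
qed

text \<open>Both the points and their values are sorted into the four cosets of the center.
  Homomorphisms through the Klein four-group handle values in one coset, automorphisms handle values
  that are independent modulo the center; together they forbid every pattern of values on five
  chosen points.\<close>

lemma affapp_ge_Dic8: "3 \<le> affapp (dicyclic 2)"
proof (rule affapp_ge_3I)
  let ?M = "dicyclic 2"
  show gr: "group ?M" by (simp add: group_dicyclic)
  show fin: "finite (carrier ?M)" by (simp add: dicyclic_def)
  interpret group ?M by fact
  fix f assume f: "f \<in> carrier ?M \<rightarrow> carrier ?M"
    and none: "\<And>x y z \<phi>. x \<in> carrier ?M \<Longrightarrow> y \<in> carrier ?M \<Longrightarrow> z \<in> carrier ?M \<Longrightarrow> \<phi> \<in> hom ?M ?M \<Longrightarrow>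
        x \<noteq> y \<Longrightarrow> x \<noteq> z \<Longrightarrow> y \<noteq> z \<Longrightarrow>
        \<phi> (inv\<^bsub>?M\<^esub> x \<otimes>\<^bsub>?M\<^esub> y) = inv\<^bsub>?M\<^esub> (f x) \<otimes>\<^bsub>?M\<^esub> f y \<Longrightarrow>
        \<phi> (inv\<^bsub>?M\<^esub> x \<otimes>\<^bsub>?M\<^esub> z) = inv\<^bsub>?M\<^esub> (f x) \<otimes>\<^bsub>?M\<^esub> f z \<Longrightarrow> False"
  have fM: "f x \<in> carrier ?M" if "x \<in> carrier ?M" for x using f that by auto
  have n: "even (2::nat)" "?M \<in> {dihedral 2, ?M}" by auto
  note quot0 = parity_quotient_trivial_iff[OF gr n] and indep = independent_quotients[OF gr n]
  let ?h = "\<lambda>x. parity (f x)"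
  let ?d = "\<lambda>x y. inv\<^bsub>?M\<^esub> x \<otimes>\<^bsub>?M\<^esub> y"
  have d_in: "?d x y \<in> carrier ?M" "?d (f x) (f y) \<in> carrier ?M"
    if "x \<in> carrier ?M" "y \<in> carrier ?M" for x y using that fM by auto
  have central: "U \<otimes>\<^bsub>?M\<^esub> U = \<one>\<^bsub>?M\<^esub> \<and> (\<forall>W\<in>carrier ?M. U \<otimes>\<^bsub>?M\<^esub> W = W \<otimes>\<^bsub>?M\<^esub> U)"
    if "U \<in> carrier ?M" "parity U = (False, False)" for U
  proof -
    have "(i + 2) mod 4 = (i - 2) mod (4::int)" for i by presburger
    then show ?thesis
      using q8_center[OF that] by (auto simp: dicyclic_def add.commute)
  qed
  have square: "U \<otimes>\<^bsub>?M\<^esub> U = (2, False)"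
    if "U \<in> carrier ?M" "parity U \<noteq> (False, False)" for U
  proof -
    have "(i + i) mod 4 = 2" if "odd i" for i :: int using that by presburger
    then show ?thesis using that by (cases U) (auto simp: dicyclic_def parity_def)
  qed
  have eq_d: "?d x y = (0, False)  \<longleftrightarrow> x = y" if "x \<in> carrier ?M" "y \<in> carrier ?M" for x y
  proof -
    have "(0, False) = \<one>\<^bsub>?M\<^esub>" by (simp add: dicyclic_def)
    then show ?thesis using that inv_equality[of "inv\<^bsub>?M\<^esub> x" y] by (metis inv_closed inv_inv l_inv)
  qed
  have same_class: "?d x y = (2, False)"
    if "x \<in> carrier ?M" "y \<in> carrier ?M" "x \<noteq> y" "parity x = parity y" for x y
    using q8_center[OF d_in(1)[OF that(1,2)]] quot0[OF that(1), of y] eq_d[OF that(1,2)] that(3,4)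
    by blast
  \<comment> \<open>The quotients of the values are central, so they commute and have square
    \<open>\<one>\<close>.\<close>
  have A: False if t: "x \<in> carrier ?M" "y \<in> carrier ?M" "z \<in> carrier ?M" "parity x \<noteq> parity y"
    "parity x \<noteq> parity z" "parity y \<noteq> parity z" "?h x = ?h y" "?h x = ?h z" for x y z
  proof -
    have pU: "parity (?d (f x) (f y)) = (False, False)" "parity (?d (f x) (f z)) = (False, False)"
      unfolding quot0[OF fM[OF t(1)]] using t by simp_all
    note U = d_in(2)[OF t(1,2)] and W = d_in(2)[OF t(1,3)]
    obtain \<phi> where \<phi>: "\<phi> \<in> hom ?M ?M" "\<phi> (?d x y) = ?d (f x) (f y)" "\<phi> (?d x z) = ?d (f x) (f z)"
      using klein_hom_exists[OF n indep[OF t(1), THEN iffD2] U W conjunct1[OF central[OF U pU(1)]]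
          conjunct1[OF central[OF W pU(2)]] bspec[OF conjunct2[OF central[OF U pU(1)]] W]] t(4-6)
      by blast
    have "x \<noteq> y" "x \<noteq> z" "y \<noteq> z" using t(4-6) by auto
    then show False using none[OF t(1-3) \<phi>(1)] \<phi>(2,3) by metis
  qed
  have B: False if t: "x \<in> carrier ?M" "y \<in> carrier ?M" "z \<in> carrier ?M" "x \<noteq> y" "parity x = parity y"
    "parity x \<noteq> parity z" "f x = f y" "?h x = ?h z" for x y z
  proof -
    have pW: "parity (?d (f x) (f z)) = (False, False)" and pu: "parity (?d x z) \<noteq> (False, False)"
      unfolding quot0[OF fM[OF t(1)]] quot0[OF t(1)] using t by simp_all
    note W = d_in(2)[OF t(1,3)]
    obtain v where v: "independent (?d x z) v" using ex_independent[OF pu] by blast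
    obtain \<phi> where \<phi>: "\<phi> \<in> hom ?M ?M" "\<phi> (?d x z) = ?d (f x) (f z)"
      "\<And>x. parity x = (False, False) \<Longrightarrow> \<phi> x = \<one>\<^bsub>?M\<^esub>"
      using klein_hom_exists[OF n v W one_closed conjunct1[OF central[OF W pW]] l_one[OF one_closed]
          bspec[OF conjunct2[OF central[OF W pW]] one_closed]] by blast
    have "parity (?d x y) = (False, False)" unfolding quot0[OF t(1)] by (rule t(5))
    then have "\<phi> (?d x y) = \<one>\<^bsub>?M\<^esub>" using \<phi>(3) by blast
    moreover have "?d (f x) (f y) = \<one>\<^bsub>?M\<^esub>" using t(7) fM[OF t(2)] by simp
    moreover have "x \<noteq> z" "y \<noteq> z" using t(5,6) by auto
    ultimately show False using none[OF t(1-3) \<phi>(1) t(4)] \<phi>(2) by metis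
  qed
  have C: False if t: "x \<in> carrier ?M" "y \<in> carrier ?M" "z \<in> carrier ?M" "parity x \<noteq> parity y"
    "parity x \<noteq> parity z" "parity y \<noteq> parity z" "?h x \<noteq> ?h y" "?h x \<noteq> ?h z" "?h y \<noteq> ?h z" for x y z
  proof -
    obtain \<phi> where \<phi>: "\<phi> \<in> hom ?M ?M" "\<phi> (?d x y) = ?d (f x) (f y)" "\<phi> (?d x z) = ?d (f x) (f z)"
      using q8_ex_hom[OF d_in(1)[OF t(1,2)] d_in(1)[OF t(1,3)] _
          d_in(2)[OF t(1,2)] d_in(2)[OF t(1,3)]] indep[OF t(1)] indep[OF fM[OF t(1)]] t
      by blast
    have "x \<noteq> y" "x \<noteq> z" "y \<noteq> z" using t(4-6) by auto
    then show False using none[OF t(1-3) \<phi>(1)] \<phi>(2,3) by metis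
  qed
  \<comment> \<open>Both \<open>inv x \<otimes> y\<close> and the quotient of the values at
    \<open>x\<close> and \<open>y\<close> are the central involution, which is the square of every
    noncentral element. An automorphism matching the quotients for \<open>z\<close> therefore
    matches these as well.\<close>
  have D: False if t: "x \<in> carrier ?M" "y \<in> carrier ?M" "z \<in> carrier ?M" "x \<noteq> y" "parity x = parity y"
    "parity x \<noteq> parity z" "f x \<noteq> f y" "?h x = ?h y" "?h x \<noteq> ?h z" for x y z
  proof -
    have pW: "parity (?d (f x) (f z)) \<noteq> (False, False)" and pu: "parity (?d x z) \<noteq> (False, False)"
      unfolding quot0[OF fM[OF t(1)]] quot0[OF t(1)] using t by simp_all
    note u = d_in(1)[OF t(1,3)] and W = d_in(2)[OF t(1,3)]
    obtain v where v: "v \<in> {(1, False), (0, True)}" "independent (?d x z) v"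
      using ex_independent[OF pu] .
    obtain V where V: "V \<in> {(1, False), (0, True)}" "independent (?d (f x) (f z)) V"
      using ex_independent[OF pW] .
    have vV: "v \<in> carrier ?M" "V \<in> carrier ?M" using v V by (auto simp: dicyclic_def)
    obtain \<phi> where \<phi>: "\<phi> \<in> hom ?M ?M" "\<phi> (?d x z) = ?d (f x) (f z)"
      using q8_ex_hom[OF u vV(1) v(2) W vV(2) V(2)] by blast
    have "\<phi> (?d x y) = \<phi> (?d x z \<otimes>\<^bsub>?M\<^esub> ?d x z)"
      using same_class[OF t(1,2,4,5)] square[OF u pu] by simp
    also have "\<dots> = ?d (f x) (f z) \<otimes>\<^bsub>?M\<^esub> ?d (f x) (f z)" using \<phi> u by (simp add: hom_mult)
    also have "\<dots> = ?d (f x) (f y)"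
      using square[OF W pW] same_class[OF fM[OF t(1)] fM[OF t(2)] t(7,8)] by simp
    finally have "\<phi> (?d x y) = ?d (f x) (f y)" .
    moreover have "x \<noteq> z" "y \<noteq> z" using t(5,6) by auto
    ultimately show False using none[OF t(1-3) \<phi>(1) t(4)] \<phi>(2) by metis
  qed
  \<comment> \<open>Representatives of all four cosets of the center, the center itself being
    represented twice.\<close>
  let ?x = "(0::int, False)" and ?y = "(2::int, False)" and ?a = "(1::int, False)"
    and ?b = "(0::int, True)" and ?c = "(1::int, True)"
  have in_M: "?x \<in> carrier ?M" "?y \<in> carrier ?M" "?a \<in> carrier ?M" "?b \<in> carrier ?M" "?c \<in> carrier ?M"
    by (auto simp: dicyclic_def)
  have par: "parity ?x = (False, False)" "parity ?y = (False, False)" "parity ?a = (True, False)"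
    "parity ?b = (False, True)" "parity ?c = (True, True)" by (auto simp: parity_def)
  have "\<not> (?h w = ?h u \<and> ?h w = ?h v)" "\<not> (?h w \<noteq> ?h u \<and> ?h w \<noteq> ?h v \<and> ?h u \<noteq> ?h v)"
    if t: "(w, u, v) \<in> {(?x, ?a, ?b), (?x, ?a, ?c), (?x, ?b, ?c), (?y, ?a, ?b), (?y, ?a, ?c), (?y, ?b, ?c),
      (?a, ?b, ?c)}" for w u v
    by (rule notI, rule A[of w u v]; use t in_M par in auto)
      (rule notI, rule C[of w u v]; use t in_M par in auto)
  note T = this[of ?x ?a ?b] this[of ?x ?a ?c] this[of ?x ?b ?c] this[of ?y ?a ?b] this[of ?y ?a ?c]
    this[of ?y ?b ?c] this[of ?a ?b ?c]
  have "\<not> (f ?x = f ?y \<and> ?h ?x = ?h w)" "\<not> (f ?x \<noteq> f ?y \<and> ?h ?x = ?h ?y \<and> ?h ?x \<noteq> ?h w)"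
    if t: "w \<in> {?a, ?b, ?c}" for w
    by (rule notI, rule B[of ?x ?y w]; use t in_M par in auto)
      (rule notI, rule D[of ?x ?y w]; use t in_M par in auto)
  note T' = this[of ?a] this[of ?b] this[of ?c]
  define hx hy ha hb hc where h: "hx = ?h ?x" "hy = ?h ?y" "ha = ?h ?a" "hb = ?h ?b" "hc = ?h ?c"
  \<comment> \<open>By \<open>A\<close> and \<open>C\<close>, each triple of points from different
    cosets has values in exactly two cosets, so four representatives split two and two. The points
    \<open>?a\<close>, \<open>?b\<close>, \<open>?c\<close> then force \<open>?x\<close> and
    \<open>?y\<close> into the same value coset, shared with exactly one of the three. Now
    \<open>B\<close> excludes equal values at \<open>?x\<close> and \<open>?y\<close>, and
    \<open>D\<close> excludes different ones.\<close>
  show False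
    using T T' unfolding h[symmetric] by (simp only: insert_iff simp_thms) (metis (full_types))
qed

text \<open>The element \<open>r\<close> is free: a noncentral value is reached by an automorphism,
  a central one through the Klein four-group.\<close>

lemma app_ge_Dic8: "1 \<le> endapp (dicyclic 2)"
proof -
  let ?M = "dicyclic 2"
  have gr: "group ?M" by (simp add: group_dicyclic)
  interpret group ?M by fact
  have "\<exists>\<phi>\<in>hom ?M ?M. \<forall>x\<in>{(1, False)}. \<phi> x = w x" if w: "w \<in> {(1, False)} \<rightarrow> carrier ?M" for w
  proof (cases "parity (w (1, False)) = (False, False)")
    case False
    then obtain V where "V \<in> {(1, False), (0, True)}" "independent (w (1, False)) V"
      using ex_independent by blast
    then show ?thesis using q8_hom[of "w (1, False)" V] w by (auto simp: dicyclic_def)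
  next
    case True
    have "w (1, False) = (0, False) \<or> w (1, False) = (2, False)"
      using True w by (intro q8_center) auto
    then have "w (1, False) \<otimes>\<^bsub>?M\<^esub> w (1, False) = \<one>\<^bsub>?M\<^esub>" by (auto simp: dicyclic_def)
    moreover have "independent (1, False) (0, True)" by (simp add: independent_def parity_def)
    ultimately obtain \<phi> where "\<phi> \<in> hom ?M ?M" "\<phi> (1, False) = w (1, False)"
      using w klein_hom_exists[of 2 ?M "(1, False)" "(0, True)" "w (1, False)" "\<one>\<^bsub>?M\<^esub>"]
      by auto
    then show ?thesis by auto
  qed
  then show ?thesis
    using free_set_le_app(1)[OF gr, of "{(1, False)}" 1] by (auto simp: dicyclic_def)
qed

subsection \<open>The alternating group of degree 4\<close>

text \<open>The images \<open>A\<close> and \<open>T\<close> of \<open>a\<close> and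
  \<open>c\<close> determine that of \<open>b\<close>, because \<open>b = c a c^(-1)\<close> and
  \<open>c^(-1) = c^2\<close>.\<close>

fun tetra_img :: "bool \<times> bool \<times> int \<Rightarrow> bool \<times> bool \<times> int \<Rightarrow> bool \<times> bool \<times> int \<Rightarrow> bool \<times> bool \<times> int" where
  "tetra_img A T (p, q, k) = tetra_mult (if p then A else (False, False, 0))
     (tetra_mult (if q then tetra_mult T (tetra_mult A (tetra_mult T T)) else (False, False, 0))
       (if k = 0 then (False, False, 0) else if k = 1 then T else tetra_mult T T))"

text \<open>An involution together with an element of order 3, which always generate Alt(4).\<close>

definition tetra_pair :: "bool \<times> bool \<times> int \<Rightarrow> bool \<times> bool \<times> int \<Rightarrow> bool" where
  "tetra_pair A T \<longleftrightarrow> snd (snd A) = 0 \<and> A \<noteq> (False, False, 0) \<and> snd (snd T) \<noteq> 0"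

fun tetra_check :: "bool \<times> bool \<times> int \<Rightarrow> bool \<times> bool \<times> int \<Rightarrow> bool" where
  "tetra_check (p, q, j) (p', q', k) =
     (if tetra_pair (p, q, j) (p', q', k) then
        iterate 12 (tetra_img (p, q, j) (p', q', k)) (True, False, 0) = (True, False, 0) \<and>
        iterate 12 (tetra_img (p, q, j) (p', q', k)) (False, False, 1) = (False, False, 1)
      else True)"

definition tetra_relations :: "bool \<times> bool \<times> int \<Rightarrow> bool \<times> bool \<times> int \<Rightarrow> bool \<times> bool \<times> int \<Rightarrow> bool" where
  "tetra_relations a b c \<longleftrightarrow> tetra_mult a a = (False, False, 0) \<and> tetra_mult b b = (False, False, 0) \<and>
     tetra_mult b a = tetra_mult a b \<and> tetra_mult c (tetra_mult c c) = (False, False, 0) \<and>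
     tetra_mult c a = tetra_mult b c \<and> tetra_mult c b = tetra_mult a (tetra_mult b c)"

fun tetra_check_relations :: "bool \<times> bool \<times> int \<Rightarrow> bool \<times> bool \<times> int \<Rightarrow> bool" where
  "tetra_check_relations (p, q, j) (p', q', k) =
     (if tetra_pair (p, q, j) (p', q', k) then tetra_relations (p, q, j)
        (tetra_mult (p', q', k) (tetra_mult (p, q, j) (tetra_mult (p', q', k) (p', q', k)))) (p', q', k)
      else True)"

declare tetra_img.simps [simp del] tetra_check.simps [simp del] tetra_check_relations.simps [simp del]
  tetra_mult.simps [simp del]

lemma tetra_checks:
  assumes "A \<in> carrier tetra" "T \<in> carrier tetra"
  shows "tetra_check A T" "tetra_check_relations A T"
proof -
  let ?els = "[(False, False, 0), (False, True, 0), (True, False, 0), (True, True, 0),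
    (False, False, 1), (False, True, 1), (True, False, 1), (True, True, 1),
    (False, False, 2), (False, True, 2), (True, False, 2), (True, True, 2)] :: (bool \<times> bool \<times> int) list"
  have "check_all_pairs tetra_check ?els ?els" by code_simp
  then have *: "\<forall>x\<in>set ?els. \<forall>y\<in>set ?els. tetra_check x y" by (simp only: check_all_pairs_iff)
  have "check_all_pairs tetra_check_relations ?els ?els" by code_simp
  then have **: "\<forall>x\<in>set ?els. \<forall>y\<in>set ?els. tetra_check_relations x y"
    by (simp only: check_all_pairs_iff)
  have "x \<in> set ?els" if "x \<in> carrier tetra" for x
  proof -
    obtain p q k where x: "x = (p, q, k)" by (metis prod_cases3)
    then have "k = 0 \<or> k = 1 \<or> k = 2" using that by (auto simp: tetra_def)
    then show ?thesis unfolding x by (cases p; cases q) auto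
  qed
  then show "tetra_check A T" "tetra_check_relations A T" using assms * ** by blast+
qed

lemma tetra_hom:
  assumes AT: "A \<in> carrier tetra" "T \<in> carrier tetra" "tetra_pair A T"
  shows "\<exists>\<alpha>\<in>hom tetra tetra. \<alpha> (True, False, 0) = A \<and> \<alpha> (False, False, 1) = T \<and>
    iterate 12 \<alpha> (True, False, 0) = (True, False, 0) \<and> iterate 12 \<alpha> (False, False, 1) = (False, False, 1)"
proof -
  interpret group tetra by (rule group_tetra)
  let ?B = "T \<otimes>\<^bsub>tetra\<^esub> (A \<otimes>\<^bsub>tetra\<^esub> (T \<otimes>\<^bsub>tetra\<^esub> T))"
  have one: "(False, False, 0) = \<one>\<^bsub>tetra\<^esub>" by (simp add: tetra_def)
  have BM: "?B \<in> carrier tetra" using AT by simp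
  have B: "tetra_mult T (tetra_mult A (tetra_mult T T)) = ?B" using AT by (simp add: tetra_mult_eq)
  have rel: "tetra_relations A ?B T"
    using tetra_checks(2)[OF AT(1,2)] AT(3) B
    by (cases A; cases T) (simp add: tetra_check_relations.simps)
  have iter: "iterate 12 (tetra_img A T) (True, False, 0) = (True, False, 0)"
    "iterate 12 (tetra_img A T) (False, False, 1) = (False, False, 1)"
    using tetra_checks(1)[OF AT(1,2)] AT(3)
    by (cases A; cases T; simp add: tetra_check.simps del: iterate.simps)+
  let ?\<alpha> = "\<lambda>(p, q, k). (if p then A else \<one>\<^bsub>tetra\<^esub>) \<otimes>\<^bsub>tetra\<^esub>
    ((if q then ?B else \<one>\<^bsub>tetra\<^esub>) \<otimes>\<^bsub>tetra\<^esub> T [^]\<^bsub>tetra\<^esub> (k::int))"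
  have hom: "?\<alpha> \<in> hom tetra tetra"
    using rel AT BM unfolding tetra_relations_def one
    by (intro hom_tetra) (simp_all only: tetra_mult_eq m_closed)
  have T2: "T [^]\<^bsub>tetra\<^esub> (2::int) = T \<otimes>\<^bsub>tetra\<^esub> T"
    using int_pow_mult[OF AT(2), of 1 1] AT(2) by simp
  have eq: "?\<alpha> x = tetra_img A T x" if x: "x \<in> carrier tetra" for x
  proof -
    obtain p q k where pqk: "x = (p, q, k)" by (metis prod_cases3)
    then have "k = 0 \<or> k = 1 \<or> k = 2" using x by (auto simp: tetra_def)
    then show ?thesis
      using AT BM T2 unfolding pqk tetra_img.simps B one by (auto simp: tetra_mult_eq)
  qed
  have iter_eq: "iterate n ?\<alpha> x = iterate n (tetra_img A T) x" if "x \<in> carrier tetra" for n x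
    using that
  proof (induction n arbitrary: x)
    case (Suc n)
    then show ?case using eq[OF Suc.prems] hom_in_carrier[OF hom Suc.prems] by (simp only: iterate.simps)
  qed simp
  have in_M: "(True, False, 0) \<in> carrier tetra" "(False, False, 1) \<in> carrier tetra"
    by (auto simp: tetra_def)
  have "?\<alpha> (True, False, 0) = A" "?\<alpha> (False, False, 1) = T" using AT by simp_all
  then show ?thesis
    using hom iter iter_eq[OF in_M(1), of 12] iter_eq[OF in_M(2), of 12]
    by (intro bexI[of _ ?\<alpha>]) (simp_all only: simp_thms)
qed

lemma tetra_ex_hom:
  assumes "u \<in> carrier tetra" "v \<in> carrier tetra" "tetra_pair u v"
    and "U \<in> carrier tetra" "W \<in> carrier tetra" "tetra_pair U W"
  shows "\<exists>\<phi>\<in>hom tetra tetra. \<phi> u = U \<and> \<phi> v = W"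
proof -
  obtain \<alpha> where \<alpha>: "\<alpha> \<in> hom tetra tetra" "\<alpha> (True, False, 0) = u" "\<alpha> (False, False, 1) = v"
    "iterate (Suc 11) \<alpha> (True, False, 0) = (True, False, 0)"
    "iterate (Suc 11) \<alpha> (False, False, 1) = (False, False, 1)"
    using tetra_hom[OF assms(1-3)] by (auto simp del: iterate.simps)
  obtain \<beta> where \<beta>: "\<beta> \<in> hom tetra tetra" "\<beta> (True, False, 0) = U" "\<beta> (False, False, 1) = W"
    using tetra_hom[OF assms(4-6)] by blast
  show ?thesis using ex_hom_by_iterate[OF \<alpha>(1,4,5) \<beta>(1)] \<alpha> \<beta> by auto
qed

lemma tetra_cube:
  assumes "T \<in> carrier tetra"
  shows "T [^]\<^bsub>tetra\<^esub> (3::nat) = (if snd (snd T) = 0 then T else \<one>\<^bsub>tetra\<^esub>)"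
proof -
  interpret group tetra by (rule group_tetra)
  obtain p q k where T: "T = (p, q, k)" by (metis prod_cases3)
  then have "k = 0 \<or> k = 1 \<or> k = 2" using assms by (auto simp: tetra_def)
  then have "T \<otimes>\<^bsub>tetra\<^esub> (T \<otimes>\<^bsub>tetra\<^esub> T) = (if snd (snd T) = 0 then T else \<one>\<^bsub>tetra\<^esub>)"
    unfolding T by (elim disjE; cases p; cases q) (simp_all add: tetra_def tetra_rot_def)
  then show ?thesis using pow_three[OF assms] by simp
qed

text \<open>These endomorphisms factor through the quotient of order 3 by the four-group. The
  element \<open>v\<close> is congruent to \<open>c\<close> or to \<open>c^2\<close>; in the second
  case \<open>c\<close> has to go to \<open>W^2\<close>, whose square is \<open>W\<close>.\<close>

lemma tetra_ex_hom_trivial: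
  assumes "v \<in> carrier tetra" "snd (snd v) \<noteq> 0" "W \<in> carrier tetra" "snd (snd W) \<noteq> 0"
  shows "\<exists>\<phi>\<in>hom tetra tetra. \<phi> v = W \<and> (\<forall>u. snd (snd u) = 0 \<longrightarrow> \<phi> u = \<one>\<^bsub>tetra\<^esub>)"
proof -
  interpret group tetra by (rule group_tetra)
  obtain p q k where v: "v = (p, q, k)" by (metis prod_cases3)
  then have k: "k = 1 \<or> k = 2" using assms by (auto simp: tetra_def)
  have W3: "W \<otimes>\<^bsub>tetra\<^esub> (W \<otimes>\<^bsub>tetra\<^esub> W) = \<one>\<^bsub>tetra\<^esub>"
    using tetra_cube[OF assms(3)] pow_three[OF assms(3)] assms(4) by simp
  define T where "T = (if k = 1 then W else W \<otimes>\<^bsub>tetra\<^esub> W)"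
  have T: "T \<in> carrier tetra" using assms by (simp add: T_def)
  have W4: "W \<otimes>\<^bsub>tetra\<^esub> W \<otimes>\<^bsub>tetra\<^esub> (W \<otimes>\<^bsub>tetra\<^esub> W) = W"
    using W3 assms(3) by (metis m_assoc m_closed r_one)
  have T3: "T \<otimes>\<^bsub>tetra\<^esub> (T \<otimes>\<^bsub>tetra\<^esub> T) = \<one>\<^bsub>tetra\<^esub>"
    using W3 W4 assms(3) by (auto simp: T_def m_assoc)
  have T2: "T [^]\<^bsub>tetra\<^esub> (2::int) = T \<otimes>\<^bsub>tetra\<^esub> T"
    using int_pow_mult[OF T, of 1 1] T by simp
  have "(\<lambda>(p, q, k::int). (if p then \<one>\<^bsub>tetra\<^esub> else \<one>\<^bsub>tetra\<^esub>) \<otimes>\<^bsub>tetra\<^esub>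
    ((if q then \<one>\<^bsub>tetra\<^esub> else \<one>\<^bsub>tetra\<^esub>) \<otimes>\<^bsub>tetra\<^esub> T [^]\<^bsub>tetra\<^esub> k)) \<in> hom tetra tetra"
    using T T3 by (intro hom_tetra) auto
  then show ?thesis
    using k v T T2 W4 assms(3) by (intro bexI) (auto simp: T_def)
qed

lemma not_inj_onE:
  assumes "\<not> inj_on f A"
  obtains x y where "x \<in> A" "y \<in> A" "x \<noteq> y" "f x = f y"
  using assms unfolding inj_on_def by blast

text \<open>The coset of a point modulo the four-group is read off from its last component. Without
  a triple of agreement all values fall into a single coset; twelve points then share four values,
  so one value is taken three times and a constant map agrees there.\<close>

lemma affapp_ge_tetra: "3 \<le> affapp tetra"
proof (rule affapp_ge_3I[OF group_tetra finite_tetra])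
  interpret group tetra by (rule group_tetra)
  fix f assume f: "f \<in> carrier tetra \<rightarrow> carrier tetra"
    and none: "\<And>x y z \<phi>. x \<in> carrier tetra \<Longrightarrow> y \<in> carrier tetra \<Longrightarrow> z \<in> carrier tetra \<Longrightarrow>
        \<phi> \<in> hom tetra tetra \<Longrightarrow> x \<noteq> y \<Longrightarrow> x \<noteq> z \<Longrightarrow> y \<noteq> z \<Longrightarrow>
        \<phi> (inv\<^bsub>tetra\<^esub> x \<otimes>\<^bsub>tetra\<^esub> y) = inv\<^bsub>tetra\<^esub> (f x) \<otimes>\<^bsub>tetra\<^esub> f y \<Longrightarrow>
        \<phi> (inv\<^bsub>tetra\<^esub> x \<otimes>\<^bsub>tetra\<^esub> z) = inv\<^bsub>tetra\<^esub> (f x) \<otimes>\<^bsub>tetra\<^esub> f z \<Longrightarrow> False"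
  let ?d = "\<lambda>x y. inv\<^bsub>tetra\<^esub> x \<otimes>\<^bsub>tetra\<^esub> y"
  let ?k = "\<lambda>x :: bool \<times> bool \<times> int. snd (snd x)"
  have fM: "f x \<in> carrier tetra" if "x \<in> carrier tetra" for x using f that by auto
  have k_range: "?k x \<in> {0, 1, 2}" if "x \<in> carrier tetra" for x
    using that by (auto simp: tetra_def)
  have k_mult: "?k (x \<otimes>\<^bsub>tetra\<^esub> y) = (?k x + ?k y) mod 3" for x y
    by (cases x; cases y) (simp add: tetra_def)
  have k_one: "?k \<one>\<^bsub>tetra\<^esub> = 0" by (simp add: tetra_def)
  have k_quot: "?k (?d x y) = 0 \<longleftrightarrow> ?k x = ?k y" if "x \<in> carrier tetra" "y \<in> carrier tetra" for x y
  proof -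
    have "(?k (inv\<^bsub>tetra\<^esub> x) + ?k x) mod 3 = 0"
      using k_mult[of "inv\<^bsub>tetra\<^esub> x" x] that(1) k_one by simp
    then show ?thesis
      using k_mult[of "inv\<^bsub>tetra\<^esub> x" y] k_range[of "inv\<^bsub>tetra\<^esub> x"] k_range[OF that(1)] k_range[OF that(2)] that
      by auto
  qed
  have d_one: "?d x y = \<one>\<^bsub>tetra\<^esub> \<longleftrightarrow> x = y" if "x \<in> carrier tetra" "y \<in> carrier tetra" for x y
    using that by (metis inv_closed inv_equality inv_inv l_inv)
  have one: "(False, False, 0) = \<one>\<^bsub>tetra\<^esub>" by (simp add: tetra_def)
  \<comment> \<open>Otherwise the quotients for \<open>x\<close> and \<open>z\<close> lie outside
    the four-group on both sides. The quotient of the values at \<open>x\<close> and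
    \<open>y\<close> is either trivial, and an endomorphism through the quotient of order 3 applies,
    or an involution, and an automorphism applies.\<close>
  have rule: "?k (f z) = ?k (f x)"
    if t: "x \<in> carrier tetra" "y \<in> carrier tetra" "z \<in> carrier tetra" "x \<noteq> y" "?k x = ?k y"
      "?k z \<noteq> ?k x" "?k (f x) = ?k (f y)" for x y z
  proof (rule ccontr)
    assume nz: "?k (f z) \<noteq> ?k (f x)"
    note fx = fM[OF t(1)] and fy = fM[OF t(2)] and fz = fM[OF t(3)]
    have M: "?d x y \<in> carrier tetra" "?d x z \<in> carrier tetra" "?d (f x) (f y) \<in> carrier tetra"
      "?d (f x) (f z) \<in> carrier tetra" using t fx fy fz by simp_all
    have k: "?k (?d x y) = 0" "?k (?d x z) \<noteq> 0" "?k (?d (f x) (f y)) = 0" "?k (?d (f x) (f z)) \<noteq> 0"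
      using k_quot[OF t(1,2)] k_quot[OF t(1,3)] k_quot[OF fx fy] k_quot[OF fx fz] t nz by simp_all
    have ne: "x \<noteq> z" "y \<noteq> z" using t by auto
    have "\<exists>\<phi>\<in>hom tetra tetra. \<phi> (?d x y) = ?d (f x) (f y) \<and> \<phi> (?d x z) = ?d (f x) (f z)"
    proof (cases "f x = f y")
      case True
      then have "?d (f x) (f y) = \<one>\<^bsub>tetra\<^esub>" using fy by simp
      then show ?thesis using tetra_ex_hom_trivial[OF M(2) k(2) M(4) k(4)] k(1) by metis
    next
      case False
      have "tetra_pair (?d x y) (?d x z)" "tetra_pair (?d (f x) (f y)) (?d (f x) (f z))"
        unfolding tetra_pair_def one using k d_one[OF t(1,2)] d_one[OF fx fy] False t(4) by simp_all
      then show ?thesis using tetra_ex_hom M by blast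
    qed
    then show False using none[OF t(1-3) _ t(4) ne] by metis
  qed
  \<comment> \<open>A coset has four elements, and their values are distributed over three
    cosets.\<close>
  have pair: "\<exists>x\<in>carrier tetra. \<exists>y\<in>carrier tetra. x \<noteq> y \<and> ?k x = c \<and> ?k y = c \<and> ?k (f x) = ?k (f y)"
    if c: "c \<in> {0, 1, 2}" for c
  proof -
    let ?C = "{(p, q, k). k = c} :: (bool \<times> bool \<times> int) set"
    have C: "?C = (UNIV \<times> UNIV \<times> {c})" by auto
    have CM: "?C \<subseteq> carrier tetra" using c by (auto simp: tetra_def)
    have "\<not> inj_on (\<lambda>x. ?k (f x)) ?C"
    proof
      assume "inj_on (\<lambda>x. ?k (f x)) ?C"
      then have "card ?C \<le> card {0, 1, 2 :: int}"
        using CM fM k_range by (intro card_inj_on_le) blast+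
      then show False unfolding C by (simp add: card_cartesian_product)
    qed
    then obtain x y where "x \<in> ?C" "y \<in> ?C" "x \<noteq> y" "?k (f x) = ?k (f y)"
      by (rule not_inj_onE)
    then show ?thesis using CM by (intro bexI[of _ x] bexI[of _ y]) auto
  qed
  obtain x0 y0 where p0: "x0 \<in> carrier tetra" "y0 \<in> carrier tetra" "x0 \<noteq> y0" "?k x0 = 0" "?k y0 = 0"
    "?k (f x0) = ?k (f y0)" using pair[of 0] by blast
  obtain x1 y1 where p1: "x1 \<in> carrier tetra" "y1 \<in> carrier tetra" "x1 \<noteq> y1" "?k x1 = 1" "?k y1 = 1"
    "?k (f x1) = ?k (f y1)" using pair[of 1] by blast
  \<comment> \<open>The pair inside the four-group determines the value coset of all points outside
    it, in particular of \<open>x1\<close>; the pair \<open>x1\<close>, \<open>y1\<close> then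
    determines that of the points inside.\<close>
  have const: "?k (f z) = ?k (f x0)" if z: "z \<in> carrier tetra" for z
  proof (cases "?k z = 0")
    case False
    then show ?thesis using rule[OF p0(1,2) z] p0 by simp
  next
    case True
    then show ?thesis
      using rule[OF p1(1,2) z] rule[OF p0(1,2) p1(1)] p0 p1 by simp
  qed
  let ?B = "UNIV \<times> UNIV \<times> {?k (f x0)} :: (bool \<times> bool \<times> int) set"
  have "\<exists>v\<in>?B. 2 < card {x \<in> carrier tetra. f x = v}"
  proof (rule ccontr)
    assume "\<not> ?thesis"
    then have le: "card {x \<in> carrier tetra. f x = v} \<le> 2" if "v \<in> ?B" for v
      using that by (meson not_less)
    have "carrier tetra \<subseteq> (\<Union>v\<in>?B. {x \<in> carrier tetra. f x = v})"
    proof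
      fix x assume x: "x \<in> carrier tetra"
      have "f x \<in> ?B" using const[OF x] by (cases "f x") auto
      then show "x \<in> (\<Union>v\<in>?B. {x \<in> carrier tetra. f x = v})" using x by blast
    qed
    then have "card (carrier tetra) \<le> card (\<Union>v\<in>?B. {x \<in> carrier tetra. f x = v})"
      using finite_tetra by (intro card_mono) auto
    also have "\<dots> \<le> (\<Sum>v\<in>?B. card {x \<in> carrier tetra. f x = v})" by (rule card_UN_le) simp
    also have "\<dots> \<le> card ?B * 2" using le by (rule sum_bounded_above[THEN order_trans]) auto
    also have "card ?B = 4" by (simp add: card_cartesian_product)
    finally show False using order_tetra by (simp add: order_def)
  qed
  then obtain v where "2 < card {x \<in> carrier tetra. f x = v}" by blast
  then have "3 \<le> card {x \<in> carrier tetra. f x = v}" by simp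
  then obtain S where S: "S \<subseteq> {x \<in> carrier tetra. f x = v}" "card S = 3"
    by (rule obtain_subset_with_card_n)
  from S(2) obtain x y z where S3: "S = {x, y, z}" and ne: "x \<noteq> y" "x \<noteq> z" "y \<noteq> z"
    unfolding card_3_iff by blast
  from S(1) have xyz: "x \<in> carrier tetra" "y \<in> carrier tetra" "z \<in> carrier tetra"
    "f x = v" "f y = v" "f z = v" unfolding S3 by simp_all
  then have "v \<in> carrier tetra" using fM by metis
  then have "inv\<^bsub>tetra\<^esub> v \<otimes>\<^bsub>tetra\<^esub> v = \<one>\<^bsub>tetra\<^esub>" by simp
  then have "\<one>\<^bsub>tetra\<^esub> = inv\<^bsub>tetra\<^esub> (f x) \<otimes>\<^bsub>tetra\<^esub> f y" "\<one>\<^bsub>tetra\<^esub> = inv\<^bsub>tetra\<^esub> (f x) \<otimes>\<^bsub>tetra\<^esub> f z"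
    unfolding xyz(4-6) by (rule sym)+
  then show False by (rule none[OF xyz(1-3) trivial_hom[OF group_tetra] ne])
qed

text \<open>The classification of order 12 needs only a subgroup of order 3 that is not normal.
  Powers of the 3-cycle \<open>c\<close> fix 4, whereas its conjugate by \<open>y\<close>, the
  product of the transpositions of 1, 2 and of 3, 4, moves 4 to 2.\<close>

lemma alt_group_4_iso_tetra: "alt_group 4 \<cong> tetra"
proof -
  let ?A = "alt_group 4"
  interpret group ?A by (rule alt_group_is_group)
  have order: "order ?A = 12"
    using alt_group_card_carrier[of 4] by (simp add: order_def fact_numeral)
  have fin: "finite (carrier ?A)" using order order_gt_0_iff_finite by (metis zero_less_numeral)
  define c where "c = transpose 1 2 \<circ> transpose 2 (3::nat)"
  define y where "y = transpose 1 2 \<circ> transpose 3 (4::nat)"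
  have perm: "transpose a b permutes {1..4}" if "a \<in> {1..4}" "b \<in> {1..4}" for a b :: nat
    using that by (rule permutes_swap_id)
  have even: "evenperm (transpose a b \<circ> transpose a' b')" if "a \<noteq> b" "a' \<noteq> b'" for a b a' b' :: nat
    using that by (simp add: evenperm_comp evenperm_swap permutation_swap_id)
  have cA: "c \<in> carrier ?A" and yA: "y \<in> carrier ?A"
    unfolding alt_group_carrier c_def y_def
    by (intro conjI permutes_compose perm even; simp)+
  have "(c \<circ> (c \<circ> c)) x = id x" for x
    by (cases "x = 1"; cases "x = 2"; cases "x = 3") (auto simp: c_def transpose_def)
  then have c3: "c [^]\<^bsub>?A\<^esub> (3::nat) = \<one>\<^bsub>?A\<^esub>"
    using pow_three[OF cA] by (auto simp: alt_group_mult alt_group_one)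
  have "c 1 \<noteq> id 1" by (simp add: c_def transpose_def)
  then have "c \<noteq> \<one>\<^bsub>?A\<^esub>" by (auto simp: alt_group_one)
  then have ordc: "ord c = 3" using ord_eq_prime[OF cA _ c3] by simp
  have fix4: "(c [^]\<^bsub>?A\<^esub> (n::nat)) 4 = 4" for n
    by (induction n) (auto simp: alt_group_mult alt_group_one c_def transpose_def)
  have "(y \<circ> y) x = id x" for x
    by (cases "x = 1"; cases "x = 2"; cases "x = 3"; cases "x = 4") (auto simp: y_def transpose_def)
  then have "y \<otimes>\<^bsub>?A\<^esub> y = \<one>\<^bsub>?A\<^esub>" by (auto simp: alt_group_mult alt_group_one)
  then have invy: "inv\<^bsub>?A\<^esub> y = y" using yA by (simp add: inv_equality)
  have "(y \<otimes>\<^bsub>?A\<^esub> c \<otimes>\<^bsub>?A\<^esub> y) 4 = 2"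
    by (simp add: alt_group_mult c_def y_def transpose_def)
  then have "y \<otimes>\<^bsub>?A\<^esub> c \<otimes>\<^bsub>?A\<^esub> inv\<^bsub>?A\<^esub> y \<notin> range (\<lambda>i::int. c [^]\<^bsub>?A\<^esub> i)"
  proof (intro notI)
    assume "y \<otimes>\<^bsub>?A\<^esub> c \<otimes>\<^bsub>?A\<^esub> inv\<^bsub>?A\<^esub> y \<in> range (\<lambda>i::int. c [^]\<^bsub>?A\<^esub> i)"
    then obtain k where "y \<otimes>\<^bsub>?A\<^esub> c \<otimes>\<^bsub>?A\<^esub> y = c [^]\<^bsub>?A\<^esub> (k::nat)"
      unfolding invy by (rule int_pow_in_range_nat[OF fin cA])
    then show False using fix4[of k] \<open>(y \<otimes>\<^bsub>?A\<^esub> c \<otimes>\<^bsub>?A\<^esub> y) 4 = 2\<close> by (simp del: mult_DirProd)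
  qed
  moreover have "order ?A = 2 ^ 2 * 3" using order by simp
  then obtain K where "subgroup K ?A" "card K = 4"
    using sylow_thm[OF two_is_prime_nat group_axioms _ fin] by (metis power2_eq_square mult_2 numeral_Bit0)
  ultimately show ?thesis using order_12_not_normal[OF fin order cA ordc _ _ yA] by blast
qed

subsection \<open>The dihedral group of order 12\<close>

text \<open>Modulo its center the group is \<open>Sym(3)\<close>, whose elements are written as \<open>(i, s)\<close> with \<open>i\<close>
  modulo 3; \<open>near a\<close> consists of the other elements in the coset of \<open>a\<close> modulo rotations. Outside of
  it, the quotient of two values is an involution or central, and then an endomorphism factoring
  through the Klein four-group takes the prescribed values.\<close>

definition near :: "int \<times> bool \<Rightarrow> (int \<times> bool) set" where
  "near a = {b. snd b = snd a \<and> fst b \<noteq> fst a \<and> fst b \<in> {0, 1, 2}}"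

text \<open>If \<open>a\<close> and \<open>b\<close> are two of the three elements of one coset, the
  third is all that their \<open>near\<close> sets have in common.\<close>

lemma near_disjoint:
  assumes "x \<in> near a" "x \<in> near b" "y \<in> near a" "y \<in> near b" "b \<in> near a" "fst a \<in> {0, 1, 2}"
  shows "x = y"
  using assms unfolding near_def prod_eq_iff by auto

text \<open>For each parity class, \<open>P\<close> and \<open>Q\<close> give the values modulo the
  center at two chosen points. Both kinds of coincidence force so much into the two-element sets
  \<open>near a\<close> that they contradict each other; without them eight distinct values would
  lie among six elements.\<close>

lemma D12_pigeonhole:
  fixes P Q :: "bool \<times> bool \<Rightarrow> int \<times> bool"
  assumes range: "\<And>v. fst (P v) \<in> {0, 1, 2}" "\<And>v. fst (Q v) \<in> {0, 1, 2}"
    and share: "\<And>v w u a. v \<noteq> w \<Longrightarrow> u \<noteq> v \<Longrightarrow> u \<noteq> w \<Longrightarrow> a \<in> {P v, Q v} \<Longrightarrow> a \<in> {P w, Q w} \<Longrightarrow>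
      P u \<in> near a \<and> Q u \<in> near a"
    and double: "\<And>v u. u \<noteq> v \<Longrightarrow> P v = Q v \<Longrightarrow> P u \<in> near (P v) \<and> Q u \<in> near (P v)"
  shows False
proof -
  have three: "\<exists>j k l. j \<noteq> i \<and> k \<noteq> i \<and> l \<noteq> i \<and> j \<noteq> k \<and> j \<noteq> l \<and> k \<noteq> l" for i :: "bool \<times> bool"
  proof -
    obtain a b where i: "i = (a, b)" by fastforce
    show ?thesis
      unfolding i
      by (rule exI[of _ "(\<not> a, b)"], rule exI[of _ "(a, \<not> b)"], rule exI[of _ "(\<not> a, \<not> b)"]) simp
  qed
  have two: "\<exists>k l. k \<noteq> i \<and> k \<noteq> j \<and> l \<noteq> i \<and> l \<noteq> j \<and> k \<noteq> l" if "i \<noteq> j" for i j :: "bool \<times> bool"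
    using three[of i] that by metis
  have near_two: "x = y \<or> x = z \<or> y = z" if "x \<in> near a" "y \<in> near a" "z \<in> near a" "fst a \<in> {0, 1, 2}"
    for x y z a using that unfolding near_def prod_eq_iff by auto
  have no_double: "P i \<noteq> Q i" for i
  proof
    assume eq: "P i = Q i"
    \<comment> \<open>By \<open>share\<close> and \<open>double\<close> the class \<open>l\<close>
      is confined to the third residue and has a double value; so, by the same reasoning, has
      \<open>j\<close>. But then \<open>P k\<close> is near \<open>P j\<close>, contrary to their
      equality.\<close>
    have contra: False if jkl: "j \<noteq> i" "k \<noteq> i" "l \<noteq> i" "j \<noteq> k" "j \<noteq> l" "k \<noteq> l" and jk: "P j = P k" for j k l
    proof -
      have n: "P u \<in> near (P i)" "Q u \<in> near (P i)" if "u \<noteq> i" for u using double[OF that eq] by auto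
      have l: "P l \<in> near (P j)" "Q l \<in> near (P j)"
        using share[of j k l "P j"] jkl jk by auto
      have "P l = Q l"
        by (rule near_disjoint[of _ "P i" "P j"]) (use n jkl l range in auto)
      then have j: "P j \<in> near (P l)" "Q j \<in> near (P l)" using double[of j l] jkl by auto
      have "P j = Q j"
        by (rule near_disjoint[of _ "P i" "P l"]) (use n jkl j range in auto)
      then have "P k \<in> near (P j)" using double[of k j] jkl by auto
      then show False using jk by (simp add: near_def)
    qed
    obtain j k l where "j \<noteq> i" "k \<noteq> i" "l \<noteq> i" "j \<noteq> k" "j \<noteq> l" "k \<noteq> l" using three by blast
    moreover have "P j = P k \<or> P j = P l \<or> P k = P l"
      using near_two[of "P j" "P i" "P k" "P l"] double[of _ i] eq calculation range by auto
    ultimately show False using contra[of j k l] contra[of j l k] contra[of k l j] by metis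
  qed
  \<comment> \<open>The other two classes \<open>k\<close> and \<open>l\<close> both fill
    \<open>near a\<close> completely, hence share both values. This confines class \<open>i\<close>
    to a single element and gives it a double value.\<close>
  have no_share: "{P i, Q i} \<inter> {P j, Q j} = {}" if ij: "i \<noteq> j" for i j
  proof (rule ccontr)
    assume "{P i, Q i} \<inter> {P j, Q j} \<noteq> {}"
    then obtain a where a: "a \<in> {P i, Q i}" "a \<in> {P j, Q j}" by blast
    obtain k l where kl: "k \<noteq> i" "k \<noteq> j" "l \<noteq> i" "l \<noteq> j" "k \<noteq> l" using two[OF ij] by blast
    have a_range: "fst a \<in> {0, 1, 2}"
      using a(1) range(1)[of i] range(2)[of i] unfolding insert_iff by (metis empty_iff)
    have n: "P k \<in> near a" "Q k \<in> near a" "P l \<in> near a" "Q l \<in> near a"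
      using share[OF ij kl(1,2) a] share[OF ij kl(3,4) a] by auto
    have "P k \<in> {P l, Q l}" "Q k \<in> {P l, Q l}"
      using near_two[OF n(3,4,1) a_range] near_two[OF n(3,4,2) a_range] no_double[of l] by auto
    then have "P i \<in> near (P k)" "Q i \<in> near (P k)" "P i \<in> near (Q k)" "Q i \<in> near (Q k)"
      using share[OF kl(5), of i "P k"] share[OF kl(5), of i "Q k"] kl by auto
    moreover have "Q k \<in> near (P k)"
      using n no_double[of k] range unfolding near_def prod_eq_iff by auto
    ultimately have "P i = Q i"
      using near_disjoint[of "P i" "P k" "Q k" "Q i"] range by blast
    then show False using no_double by blast
  qed
  let ?Z = "\<lambda>(v, b). if b then P v else Q v"
  have "inj_on ?Z (UNIV :: ((bool \<times> bool) \<times> bool) set)"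
  proof (rule inj_onI)
    fix p q :: "(bool \<times> bool) \<times> bool" assume eq: "?Z p = ?Z q"
    obtain v b w c where pq: "p = (v, b)" "q = (w, c)" by (metis surj_pair)
    have "v = w"
    proof (rule ccontr)
      assume "v \<noteq> w"
      then show False using no_share[of v w] eq unfolding pq by (auto split: if_splits)
    qed
    then show "p = q" using no_double[of v] no_double[of v, symmetric] eq unfolding pq by (cases b; cases c) auto
  qed
  moreover have "?Z p \<in> {0, 1, 2} \<times> UNIV" for p
  proof -
    have "fst (?Z p) \<in> {0, 1, 2}"
      using range(1)[of "fst p"] range(2)[of "fst p"] by (simp only: case_prod_beta simp_thms split: if_split)
    then show ?thesis by (simp only: mem_Times_iff UNIV_I simp_thms)
  qed
  then have "range ?Z \<subseteq> {0, 1, 2} \<times> UNIV" by blast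
  ultimately have "card (UNIV :: ((bool \<times> bool) \<times> bool) set) \<le> card ({0, 1, 2 :: int} \<times> (UNIV :: bool set))"
    by (rule card_inj_on_le) auto
  then show False by (simp add: card_cartesian_product UNIV_Times_UNIV[symmetric] del: UNIV_Times_UNIV)
qed

text \<open>The map \<open>?g\<close> is \<open>f\<close> modulo the center, which consists of 1 and
  \<open>r^3\<close>. Only homomorphisms through the Klein four-group are used; what they cannot
  reach is recorded by \<open>near\<close> and refuted by counting.\<close>

lemma affapp_ge_D12: "3 \<le> affapp (dihedral 6)"
proof (rule affapp_ge_3I)
  let ?M = "dihedral 6"
  show gr: "group ?M" by (simp add: group_dihedral)
  show fin: "finite (carrier ?M)" by (simp add: dihedral_def)
  interpret group ?M by fact
  fix f assume f: "f \<in> carrier ?M \<rightarrow> carrier ?M"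
    and none: "\<And>x y z \<phi>. x \<in> carrier ?M \<Longrightarrow> y \<in> carrier ?M \<Longrightarrow> z \<in> carrier ?M \<Longrightarrow> \<phi> \<in> hom ?M ?M \<Longrightarrow>
        x \<noteq> y \<Longrightarrow> x \<noteq> z \<Longrightarrow> y \<noteq> z \<Longrightarrow>
        \<phi> (inv\<^bsub>?M\<^esub> x \<otimes>\<^bsub>?M\<^esub> y) = inv\<^bsub>?M\<^esub> (f x) \<otimes>\<^bsub>?M\<^esub> f y \<Longrightarrow>
        \<phi> (inv\<^bsub>?M\<^esub> x \<otimes>\<^bsub>?M\<^esub> z) = inv\<^bsub>?M\<^esub> (f x) \<otimes>\<^bsub>?M\<^esub> f z \<Longrightarrow> False"
  have fM: "f x \<in> carrier ?M" if "x \<in> carrier ?M" for x using f that by auto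
  have n: "even (6::nat)" "?M \<in> {?M, dicyclic 6}" by auto
  note quot0 = parity_quotient_trivial_iff[OF gr n] and indep = independent_quotients[OF gr n]
  let ?d = "\<lambda>x y. inv\<^bsub>?M\<^esub> x \<otimes>\<^bsub>?M\<^esub> y"
  let ?g = "\<lambda>x. (fst (f x) mod 3, snd (f x))"
  have inv: "inv\<^bsub>?M\<^esub> (i, a) = (if a then i else (- i) mod 6, a)" if "(i, a) \<in> carrier ?M" for i a
    using that by (intro inv_equality) (auto simp: dihedral_def mod_simps)
  have d_in: "?d (f x) (f y) \<in> carrier ?M" if "x \<in> carrier ?M" "y \<in> carrier ?M" for x y
    using that fM by simp
  have quot_f: "?d (i, a) (j, b) = (if a then (i - j) mod 6 else (j - i) mod 6, a \<noteq> b)"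
    if "(i, a) \<in> carrier ?M" "(j, b) \<in> carrier ?M" for i a j b
    unfolding inv[OF that(1)] by (auto simp: dihedral_def mod_simps)
  have central: "U \<otimes>\<^bsub>?M\<^esub> U = \<one>\<^bsub>?M\<^esub> \<and> (\<forall>W\<in>carrier ?M. U \<otimes>\<^bsub>?M\<^esub> W = W \<otimes>\<^bsub>?M\<^esub> U)"
    if "U = (0, False) \<or> U = (3, False)" for U
  proof -
    have "(3 + j) mod 6 = (j - 3) mod (6::int)" for j
      using mod_add_self2[of "j - 3" 6] by (simp add: add.commute)
    then show ?thesis using that by (auto simp: dihedral_def add.commute)
  qed
  have mod6: "u mod 6 = 0 \<or> u mod 6 = 3" if "3 dvd u" for u :: int
    using that by presburger
  have dZ: "?d (f x) (f y) = (0, False) \<or> ?d (f x) (f y) = (3, False)"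
    if t: "x \<in> carrier ?M" "y \<in> carrier ?M" "?g x = ?g y" for x y
  proof -
    obtain i a j b where ij: "f x = (i, a)" "f y = (j, b)" by fastforce
    have "i mod 3 = j mod 3" and ab: "a = b" using t(3) ij by auto
    then have "(i - j) mod 6 = 0 \<or> (i - j) mod 6 = 3" "(j - i) mod 6 = 0 \<or> (j - i) mod 6 = 3"
      by (intro mod6; simp add: mod_eq_dvd_iff dvd_diff_commute)+
    then show ?thesis using quot_f[of i a j b] fM[OF t(1)] fM[OF t(2)] ab unfolding ij by auto
  qed
  have involution: "?d (f x) (f z) \<otimes>\<^bsub>?M\<^esub> ?d (f x) (f z) = \<one>\<^bsub>?M\<^esub>"
    if t: "x \<in> carrier ?M" "z \<in> carrier ?M" "?g z \<notin> near (?g x)" for x z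
  proof -
    obtain i a j b where ij: "f x = (i, a)" "f z = (j, b)" by fastforce
    have "a \<noteq> b \<or> i mod 3 = j mod 3" using t(3) unfolding ij near_def by auto
    moreover have "(i - j) mod 6 = 0 \<or> (i - j) mod 6 = 3" "(j - i) mod 6 = 0 \<or> (j - i) mod 6 = 3"
      if "i mod 3 = j mod 3" using that by (intro mod6; simp add: mod_eq_dvd_iff dvd_diff_commute)+
    ultimately have disj: "a \<noteq> b \<or> (i - j) mod 6 \<in> {0, 3} \<and> (j - i) mod 6 \<in> {0, 3}" by blast
    have sq: "(m, True) \<otimes>\<^bsub>?M\<^esub> (m, True) = \<one>\<^bsub>?M\<^esub>" "(0, False) \<otimes>\<^bsub>?M\<^esub> (0, False) = \<one>\<^bsub>?M\<^esub>"
      "(3, False) \<otimes>\<^bsub>?M\<^esub> (3, False) = \<one>\<^bsub>?M\<^esub>" for m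
      by (simp_all add: dihedral_def)
    have q: "?d (i, a) (j, b) = (if a then (i - j) mod 6 else (j - i) mod 6, a \<noteq> b)"
      using fM[OF t(1)] fM[OF t(2)] unfolding ij by (rule quot_f)
    show ?thesis
    proof (cases "a = b")
      case True
      then have "?d (i, a) (j, b) = (0, False) \<or> ?d (i, a) (j, b) = (3, False)" unfolding q using disj by auto
      then show ?thesis unfolding ij using sq(2,3) by metis
    next
      case False
      then have "snd (?d (i, a) (j, b))" unfolding q by simp
      then show ?thesis unfolding ij using sq(1)[of "fst (?d (i, a) (j, b))"] by (metis prod.collapse)
    qed
  qed
  \<comment> \<open>The quotient of the values at \<open>x\<close> and \<open>y\<close> is central
    with square \<open>\<one>\<close>. So it commutes with the quotient for \<open>z\<close>, which
    has square \<open>\<one>\<close> unless the value at \<open>z\<close> is near.\<close>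
  have share: "?g z \<in> near (?g x)"
    if t: "x \<in> carrier ?M" "y \<in> carrier ?M" "z \<in> carrier ?M" "parity x \<noteq> parity y"
      "parity z \<noteq> parity x" "parity z \<noteq> parity y" "?g x = ?g y" for x y z
  proof (rule ccontr)
    assume far: "?g z \<notin> near (?g x)"
    note U = central[OF dZ[OF t(1,2,7)]] and W = involution[OF t(1,3) far]
    have "independent (?d x y) (?d x z)" unfolding indep[OF t(1)] using t(4-6) by metis
    then obtain \<phi> where \<phi>: "\<phi> \<in> hom ?M ?M" "\<phi> (?d x y) = ?d (f x) (f y)" "\<phi> (?d x z) = ?d (f x) (f z)"
      using klein_hom_exists[OF n _ d_in[OF t(1,2)] d_in[OF t(1,3)] conjunct1[OF U] W
          bspec[OF conjunct2[OF U] d_in[OF t(1,3)]]] by blast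
    have "x \<noteq> y" "x \<noteq> z" "y \<noteq> z" using t(4-6) by auto
    then show False using none[OF t(1-3) \<phi>(1)] \<phi>(2,3) by metis
  qed
  have double: "?g z \<in> near (?g x)"
    if t: "x \<in> carrier ?M" "y \<in> carrier ?M" "z \<in> carrier ?M" "x \<noteq> y" "parity x = parity y"
      "parity z \<noteq> parity x" "f x = f y" for x y z
  proof (rule ccontr)
    assume far: "?g z \<notin> near (?g x)"
    note W = involution[OF t(1,3) far]
    have "parity (?d x z) \<noteq> (False, False)" unfolding quot0[OF t(1)] using t(6) by metis
    then obtain v where v: "independent (?d x z) v" using ex_independent by blast
    have "?d (f x) (f z) \<otimes>\<^bsub>?M\<^esub> \<one>\<^bsub>?M\<^esub> = \<one>\<^bsub>?M\<^esub> \<otimes>\<^bsub>?M\<^esub> ?d (f x) (f z)"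
      using d_in[OF t(1,3)] by simp
    then obtain \<phi> where \<phi>: "\<phi> \<in> hom ?M ?M" "\<phi> (?d x z) = ?d (f x) (f z)"
      "\<And>x. parity x = (False, False) \<Longrightarrow> \<phi> x = \<one>\<^bsub>?M\<^esub>"
      using klein_hom_exists[OF n v d_in[OF t(1,3)] one_closed W l_one[OF one_closed]] by blast
    have "parity (?d x y) = (False, False)" unfolding quot0[OF t(1)] by (rule t(5))
    then have "\<phi> (?d x y) = \<one>\<^bsub>?M\<^esub>" using \<phi>(3) by blast
    moreover have "?d (f x) (f y) = \<one>\<^bsub>?M\<^esub>" using t(7) fM[OF t(2)] by simp
    moreover have "x \<noteq> z" "y \<noteq> z" using t(5,6) by auto
    ultimately show False using none[OF t(1-3) \<phi>(1) t(4)] \<phi>(2) by metis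
  qed
  \<comment> \<open>A parity class has three elements and a coset of the center two, so three
    distinct values cannot all agree modulo the center. The chosen two points thus have equal values
    as soon as these agree modulo the center, as \<open>double\<close> requires.\<close>
  have "\<exists>x y. x \<in> carrier ?M \<and> y \<in> carrier ?M \<and> x \<noteq> y \<and> parity x = v \<and> parity y = v \<and>
      (f x = f y \<or> ?g x \<noteq> ?g y)" for v
  proof (rule ccontr)
    assume none: "\<not> ?thesis"
    let ?i = "if fst v then 1 else 0 :: int"
    let ?x = "(?i, snd v)" and ?y = "(?i + 2, snd v)" and ?z = "(?i + 4, snd v)"
    have in_M: "?x \<in> carrier ?M" "?y \<in> carrier ?M" "?z \<in> carrier ?M"
      by (auto simp: dihedral_def)
    have par: "parity ?x = v" "parity ?y = v" "parity ?z = v"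
      by (auto simp: parity_def prod_eq_iff)
    have ne: "f p \<noteq> f q \<and> ?g p = ?g q" if "p \<in> {?x, ?y, ?z}" "q \<in> {?x, ?y, ?z}" "p \<noteq> q" for p q
      using none in_M par that by (metis empty_iff insert_iff)
    have "f ?x \<noteq> f ?y \<and> ?g ?x = ?g ?y" "f ?x \<noteq> f ?z \<and> ?g ?x = ?g ?z" "f ?y \<noteq> f ?z \<and> ?g ?y = ?g ?z"
      by (rule ne; simp)+
    moreover have "fst (f p) \<in> {0..<6}" if "p \<in> carrier ?M" for p
      using fM[OF that] by (auto simp: dihedral_def)
    from this[OF in_M(1)] this[OF in_M(2)] this[OF in_M(3)]
    have "0 \<le> fst (f ?x)" "fst (f ?x) < 6" "0 \<le> fst (f ?y)" "fst (f ?y) < 6" "0 \<le> fst (f ?z)" "fst (f ?z) < 6"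
      by auto
    moreover have "i = j \<or> i = k \<or> j = k"
      if "i mod 3 = j mod 3" "i mod 3 = k mod 3" "0 \<le> i" "i < 6" "0 \<le> j" "j < 6" "0 \<le> k" "k < 6" for i j k :: int
    proof -
      have small: "u = u mod 3 \<or> u = u mod 3 + 3" if "0 \<le> u" "u < 6" for u :: int
        using that by presburger
      show ?thesis using small[OF that(3,4)] small[OF that(5,6)] small[OF that(7,8)] that(1,2) by auto
    qed
    ultimately show False by (metis fst_conv snd_conv prod_eq_iff)
  qed
  then obtain x y where xy: "\<And>v. x v \<in> carrier ?M" "\<And>v. y v \<in> carrier ?M" "\<And>v. x v \<noteq> y v"
    "\<And>v. parity (x v) = v" "\<And>v. parity (y v) = v" "\<And>v. f (x v) = f (y v) \<or> ?g (x v) \<noteq> ?g (y v)"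
    by metis
  show False
  proof (rule D12_pigeonhole[of "\<lambda>v. ?g (x v)" "\<lambda>v. ?g (y v)"])
    fix v w u a assume vwu: "v \<noteq> w" "u \<noteq> v" "u \<noteq> w" and a: "a \<in> {?g (x v), ?g (y v)}" "a \<in> {?g (x w), ?g (y w)}"
    have "?g (x v) = a \<or> ?g (y v) = a" "?g (x w) = a \<or> ?g (y w) = a"
      using a unfolding insert_iff by (metis empty_iff)+
    then obtain p q where pq: "p = x v \<or> p = y v" "q = x w \<or> q = y w" "?g p = a" "?g q = a"
      by (elim disjE) blast+
    have p: "p \<in> carrier ?M" "parity p = v" using pq(1) xy(1,2,4,5) by (elim disjE; simp only:)+
    have q: "q \<in> carrier ?M" "parity q = w" using pq(2) xy(1,2,4,5) by (elim disjE; simp only:)+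
    have gpq: "?g p = ?g q" unfolding pq(3,4) ..
    have "?g z \<in> near (?g p)" if "z \<in> carrier ?M" "parity z = u" for z
      by (rule share[OF p(1) q(1) that(1) _ _ _ gpq]; simp only: p(2) q(2) that(2) vwu not_False_eq_True)
    then show "?g (x u) \<in> near a \<and> ?g (y u) \<in> near a"
      unfolding pq(3) using xy(1,2,4,5)[of u] by (intro conjI) blast+
  next
    fix v u :: "bool \<times> bool" assume uv: "u \<noteq> v" and eq: "?g (x v) = ?g (y v)"
    have fxy: "f (x v) = f (y v)" using xy(6)[of v] eq by blast
    have "?g z \<in> near (?g (x v))" if "z \<in> carrier ?M" "parity z = u" for z
      by (rule double[OF xy(1,2) that(1) xy(3) _ _ fxy]; simp only: xy(4,5) that(2) uv not_False_eq_True)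
    then show "?g (x u) \<in> near (?g (x v)) \<and> ?g (y u) \<in> near (?g (x v))"
      using xy(1,2,4,5)[of u] by (intro conjI) blast+
  next
    have "i mod 3 \<in> {0, 1, 2}" for i :: int by (simp; presburger)
    then show "fst (?g (x v)) \<in> {0, 1, 2}" "fst (?g (y v)) \<in> {0, 1, 2}" for v by (simp_all only: fst_conv)
  qed
qed

subsection \<open>The group \<open>Z6 \<times> Z2\<close>\<close>

lemma (in monoid) pow_six:
  "x \<in> carrier G \<Longrightarrow> x [^] (6::nat) = x \<otimes> (x \<otimes> (x \<otimes> (x \<otimes> (x \<otimes> x))))"
  by (simp add: numeral_eq_Suc m_assoc)

text \<open>Among the four elements of order at most 2, two have values with the same 3-part. Their
  quotient \<open>d\<close> is an involution and the quotient \<open>t\<close> of the values has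
  square \<open>\<one>\<close>. The group is the direct product of the cyclic groups of
  \<open>d\<close> and of some \<open>w\<close> of order 6, so the value at the third point
  \<open>x \<otimes> w\<close> is arbitrary.\<close>

lemma affapp_ge_Z6_Z2: "3 \<le> affapp (integer_mod_group 6 \<times>\<times> integer_mod_group 2)"
proof (rule affapp_ge_3I)
  let ?M = "integer_mod_group 6 \<times>\<times> integer_mod_group 2"
  show fin: "finite (carrier ?M)" by (simp add: carrier_integer_mod_group)
  interpret comm_group ?M by (simp add: comm_group_DirProd)
  show gr: "group ?M" by (rule group_axioms)
  fix f assume f: "f \<in> carrier ?M \<rightarrow> carrier ?M"
    and none: "\<And>x y z \<phi>. x \<in> carrier ?M \<Longrightarrow> y \<in> carrier ?M \<Longrightarrow> z \<in> carrier ?M \<Longrightarrow> \<phi> \<in> hom ?M ?M \<Longrightarrow>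
        x \<noteq> y \<Longrightarrow> x \<noteq> z \<Longrightarrow> y \<noteq> z \<Longrightarrow>
        \<phi> (inv\<^bsub>?M\<^esub> x \<otimes>\<^bsub>?M\<^esub> y) = inv\<^bsub>?M\<^esub> (f x) \<otimes>\<^bsub>?M\<^esub> f y \<Longrightarrow>
        \<phi> (inv\<^bsub>?M\<^esub> x \<otimes>\<^bsub>?M\<^esub> z) = inv\<^bsub>?M\<^esub> (f x) \<otimes>\<^bsub>?M\<^esub> f z \<Longrightarrow> False"
  have fM: "f x \<in> carrier ?M" if "x \<in> carrier ?M" for x using f that by auto
  let ?d = "\<lambda>x y. inv\<^bsub>?M\<^esub> x \<otimes>\<^bsub>?M\<^esub> y"
  let ?V = "{(0, 0), (3, 0), (0, 1), (3, 1)} :: (int \<times> int) set"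
  have VM: "x \<in> carrier ?M" if "x \<in> ?V" for x using that by (auto simp: carrier_integer_mod_group)
  let ?g = "\<lambda>x. fst (f x) mod 3"
  have "\<not> inj_on ?g ?V"
  proof
    assume "inj_on ?g ?V"
    then have "card ?V \<le> card {0, 1, 2 :: int}"
      by (rule card_inj_on_le) auto
    then show False by simp
  qed
  then obtain x y where xy: "x \<in> ?V" "y \<in> ?V" "x \<noteq> y" "?g x = ?g y" by (auto simp only: inj_on_def)
  note xM = VM[OF xy(1)] and yM = VM[OF xy(2)]
  define d where "d = ?d x y"
  define t where "t = ?d (f x) (f y)"
  have dM: "d \<in> carrier ?M" and tM: "t \<in> carrier ?M" unfolding d_def t_def using xM yM fM by (simp_all only: m_closed inv_closed)
  have pow6: "w [^]\<^bsub>?M\<^esub> (6::nat) = \<one>\<^bsub>?M\<^esub>" for w by (cases w) (simp add: pow_DirProd)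
  have d: "d \<in> {(3, 0), (0, 1), (3, 1)}"
    using xy(1-3) unfolding d_def
    by (auto simp: inv_DirProd carrier_integer_mod_group)
  have t2: "t \<otimes>\<^bsub>?M\<^esub> t = \<one>\<^bsub>?M\<^esub>"
  proof -
    obtain a b a' b' where ab: "f x = (a, b)" "f y = (a', b')" by fastforce
    have t: "t = ((- a mod 6 + a') mod 6, (- b mod 2 + b') mod 2)"
      using fM[OF xM] fM[OF yM] unfolding t_def ab by (simp add: inv_DirProd)
    have "3 dvd a' - a" using xy(4) ab by (simp add: mod_eq_dvd_iff[symmetric])
    then obtain k where k: "a' = a + 3 * k" by (metis add_diff_cancel_left' diff_add_cancel dvdE add.commute)
    have "(- a mod 6 + a') mod 6 = 3 * k mod 6" using mod_add_left_eq[of "- a" 6 a'] k by simp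
    moreover have "(3 * k mod 6 + 3 * k mod 6) mod 6 = 0" by presburger
    ultimately have "((- a mod 6 + a') mod 6 + (- a mod 6 + a') mod 6) mod 6 = 0" by simp
    moreover have "((- b mod 2 + b') mod 2 + (- b mod 2 + b') mod 2) mod 2 = 0"
      by (simp add: mult_2[symmetric])
    ultimately show ?thesis
      unfolding t
      by (simp only: mult_DirProd mult_integer_mod_group one_DirProd one_integer_mod_group of_nat_numeral)
  qed
  have ex: "\<exists>\<phi>\<in>hom ?M ?M. \<phi> (1, 0) = p \<and> \<phi> (0, 1) = q"
    if "p \<in> carrier ?M" "q \<in> carrier ?M" "q \<otimes>\<^bsub>?M\<^esub> q = \<one>\<^bsub>?M\<^esub>" for p q
  proof -
    have "q [^]\<^bsub>?M\<^esub> (2::nat) = \<one>\<^bsub>?M\<^esub>" using pow_two[OF that(2)] that(3) by (rule trans)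
    then have "(\<lambda>(a::int, b::int). p [^]\<^bsub>?M\<^esub> a \<otimes>\<^bsub>?M\<^esub> q [^]\<^bsub>?M\<^esub> b) \<in> hom ?M ?M"
      using that pow6 by (intro hom_DirProd hom_integer_mod_group m_comm int_pow_closed) auto
    moreover have "p [^]\<^bsub>?M\<^esub> (1::int) \<otimes>\<^bsub>?M\<^esub> q [^]\<^bsub>?M\<^esub> (0::int) = p" "p [^]\<^bsub>?M\<^esub> (0::int) \<otimes>\<^bsub>?M\<^esub> q [^]\<^bsub>?M\<^esub> (1::int) = q"
      using that by (simp_all only: int_pow_1 int_pow_0 r_one l_one)
    ultimately show ?thesis by (intro bexI) (simp_all only: prod.case simp_thms)
  qed
  have key: False if w: "w \<in> carrier ?M" "w \<notin> {(0, 0), d}"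
    and hom: "\<And>z. z \<in> carrier ?M \<Longrightarrow> \<exists>\<phi>\<in>hom ?M ?M. \<phi> d = t \<and> \<phi> w = z" for w
  proof -
    let ?z = "x \<otimes>\<^bsub>?M\<^esub> w"
    have zM: "?z \<in> carrier ?M" using xM w by (simp only: m_closed)
    have eq: "?d x ?z = w" using xM w(1) by (simp only: m_assoc[symmetric] inv_closed l_inv l_one)
    have "?d (f x) (f ?z) \<in> carrier ?M" using fM[OF xM] fM[OF zM] by (simp only: m_closed inv_closed)
    then obtain \<phi> where \<phi>: "\<phi> \<in> hom ?M ?M" "\<phi> d = t" "\<phi> w = ?d (f x) (f ?z)" using hom by blast
    have "x \<noteq> ?z"
    proof
      assume "x = ?z"
      then have "w = ?d x x" using eq by metis
      then show False using w(2) xM by (simp only: l_inv one_DirProd one_integer_mod_group insert_iff simp_thms)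
    qed
    moreover have "y \<noteq> ?z"
    proof
      assume "y = ?z"
      then have "d = w" using eq unfolding d_def by (simp only:)
      then show False using w(2) by blast
    qed
    ultimately show False
      using none[OF xM yM zM \<phi>(1) xy(3)] \<phi>(2,3) eq unfolding d_def t_def by metis
  qed
  have in_M: "(1, 0) \<in> carrier ?M" "(2, 1) \<in> carrier ?M" "(0, 1) \<in> carrier ?M" "(3, 0) \<in> carrier ?M" "(2, 0) \<in> carrier ?M"
    by (auto simp: carrier_integer_mod_group)
  have three: "(3, 0) = (1, 0) \<otimes>\<^bsub>?M\<^esub> ((1, 0) \<otimes>\<^bsub>?M\<^esub> (1, 0))" by simp
  have h3: "\<phi> (3, 0) = \<phi> (1, 0) \<otimes>\<^bsub>?M\<^esub> (\<phi> (1, 0) \<otimes>\<^bsub>?M\<^esub> \<phi> (1, 0))" if "\<phi> \<in> hom ?M ?M" for \<phi>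
    unfolding three using that in_M hom_mult[OF that] by (metis m_closed)
  have h31: "\<phi> (3, 1) = \<phi> (3, 0) \<otimes>\<^bsub>?M\<^esub> \<phi> (0, 1)" if "\<phi> \<in> hom ?M ?M" for \<phi>
    using hom_mult[OF that in_M(4,3)] by simp
  have h21: "\<phi> (2, 1) = (\<phi> (1, 0) \<otimes>\<^bsub>?M\<^esub> \<phi> (1, 0)) \<otimes>\<^bsub>?M\<^esub> \<phi> (0, 1)" if "\<phi> \<in> hom ?M ?M" for \<phi>
    using hom_mult[OF that in_M(5,3)] hom_mult[OF that in_M(1,1)] by simp
  have z6: "z \<otimes>\<^bsub>?M\<^esub> (z \<otimes>\<^bsub>?M\<^esub> (z \<otimes>\<^bsub>?M\<^esub> (z \<otimes>\<^bsub>?M\<^esub> (z \<otimes>\<^bsub>?M\<^esub> z)))) = \<one>\<^bsub>?M\<^esub>" if "z \<in> carrier ?M" for z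
    using pow_six[OF that] pow6[of z] by (simp only:)
  consider "d = (3, 0)" | "d = (0, 1)" | "d = (3, 1)" using d by blast
  then show False
  proof cases
    case 1
    show False
    proof (rule key[of "(2, 1)"])
      fix z assume z: "z \<in> carrier ?M"
      \<comment> \<open>With \<open>w = (2, 1)\<close> and \<open>d = (3, 0)\<close>, the generators
        are, in additive notation, \<open>(1, 0) = d + 2 w\<close> and \<open>(0, 1) = 3 w\<close>;
        their images are the same expressions in \<open>t\<close> and \<open>z\<close>.\<close>
      let ?p = "t \<otimes>\<^bsub>?M\<^esub> (z \<otimes>\<^bsub>?M\<^esub> z)" and ?q = "z \<otimes>\<^bsub>?M\<^esub> (z \<otimes>\<^bsub>?M\<^esub> z)"
      have M: "?p \<in> carrier ?M" "?q \<in> carrier ?M" using z tM by (simp_all only: m_closed)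
      have q2: "?q \<otimes>\<^bsub>?M\<^esub> ?q = \<one>\<^bsub>?M\<^esub>" using z z6[OF z] by (simp only: m_assoc m_closed)
      then obtain \<phi> where \<phi>: "\<phi> \<in> hom ?M ?M" "\<phi> (1, 0) = ?p" "\<phi> (0, 1) = ?q" using ex[OF M] by blast
      have tt: "t \<otimes>\<^bsub>?M\<^esub> (t \<otimes>\<^bsub>?M\<^esub> u) = u" if "u \<in> carrier ?M" for u
        using that tM t2 by (simp only: m_assoc[symmetric] l_one)
      have pp: "?p \<otimes>\<^bsub>?M\<^esub> ?p = z \<otimes>\<^bsub>?M\<^esub> (z \<otimes>\<^bsub>?M\<^esub> (z \<otimes>\<^bsub>?M\<^esub> z))"
        using z tM by (simp only: m_ac m_closed tt)
      have "\<phi> (3, 0) = t"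
        unfolding h3[OF \<phi>(1)] \<phi>(2) pp using z tM z6[OF z] by (simp only: m_assoc m_closed r_one)
      moreover have "\<phi> (2, 1) = z"
        unfolding h21[OF \<phi>(1)] \<phi>(2,3) pp using z z6[OF z] by (simp only: m_assoc m_closed r_one)
      ultimately show "\<exists>\<phi>\<in>hom ?M ?M. \<phi> d = t \<and> \<phi> (2, 1) = z" using \<phi>(1) 1 by blast
    qed (use in_M 1 in auto)
  next
    case 2
    show False
    proof (rule key[of "(1, 0)"])
      fix z assume z: "z \<in> carrier ?M"
      show "\<exists>\<phi>\<in>hom ?M ?M. \<phi> d = t \<and> \<phi> (1, 0) = z" using ex[OF z tM t2] 2 by blast
    qed (use in_M 2 in auto)
  next
    case 3
    show False
    proof (rule key[of "(1, 0)"])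
      fix z assume z: "z \<in> carrier ?M"
      \<comment> \<open>With \<open>w = (1, 0)\<close> and \<open>d = (3, 1)\<close>, the second
        generator is \<open>(0, 1) = 3 w + d\<close> in additive notation, so its image is
        \<open>?q \<otimes> t\<close>, taken in \<open>?M\<close>.\<close>
      let ?q = "z \<otimes>\<^bsub>?M\<^esub> (z \<otimes>\<^bsub>?M\<^esub> z)"
      have qM: "?q \<in> carrier ?M" using z by (simp only: m_closed)
      have q2: "?q \<otimes>\<^bsub>?M\<^esub> ?q = \<one>\<^bsub>?M\<^esub>" using z z6[OF z] by (simp only: m_assoc m_closed)
      have qq: "?q \<otimes>\<^bsub>?M\<^esub> (?q \<otimes>\<^bsub>?M\<^esub> t) = t" using qM tM q2 by (metis m_assoc l_one)
      have sM: "?q \<otimes>\<^bsub>?M\<^esub> t \<in> carrier ?M" using qM tM by (simp only: m_closed)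
      have "(?q \<otimes>\<^bsub>?M\<^esub> t) \<otimes>\<^bsub>?M\<^esub> (?q \<otimes>\<^bsub>?M\<^esub> t) = \<one>\<^bsub>?M\<^esub>"
        using qq qM tM t2 m_comm[OF qM tM] by (metis m_assoc sM)
      then obtain \<phi> where \<phi>: "\<phi> \<in> hom ?M ?M" "\<phi> (1, 0) = z" "\<phi> (0, 1) = ?q \<otimes>\<^bsub>?M\<^esub> t"
        using ex[OF z sM] by blast
      have "\<phi> (3, 1) = t" unfolding h31[OF \<phi>(1)] h3[OF \<phi>(1)] \<phi>(2,3) by (rule qq)
      then show "\<exists>\<phi>\<in>hom ?M ?M. \<phi> d = t \<and> \<phi> (1, 0) = z" using \<phi> 3 by blast
    qed (use in_M 3 in auto)
  qed
qed

section \<open>The table of values\<close>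

lemma app_values:
  assumes "group G" "finite (carrier G)" "group M"
    and "endapp M \<le> a \<and> affapp M \<le> Suc b" "a \<le> endapp M" "Suc b \<le> affapp M"
  shows "G \<cong> M \<longrightarrow> (endapp G, affapp G) = (a, Suc b)"
  using app_iso[OF assms(1-3)] assms(4-6) by auto

lemma app_singleton_group:
  "endapp (singleton_group ()) = 1" "affapp (singleton_group ()) = 1"
proof -
  let ?M = "singleton_group ()"
  have gr: "group ?M" by simp
  have carrier: "carrier ?M = {()}" by (simp add: singleton_group_def)
  have agr: "agreement ?M h f = 1" for h f by (simp add: agreement_def carrier)
  have "endapp ?M \<le> 1"
    using endapp_le[OF gr, of id 1] by (simp add: carrier agr)
  moreover have "1 \<le> endapp ?M"
    using endapp_geI[OF gr, of 1] hom_self_nonempty[of ?M] by (auto simp: carrier agr)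
  ultimately show "endapp ?M = 1" by simp
  have "affapp ?M \<le> 1"
    using affapp_le[OF gr, of id 1] by (simp add: carrier agr)
  moreover have "1 \<le> affapp ?M"
    \<comment> \<open>The empty set is free, so the translation alone gives one point of
      agreement.\<close>
    using free_set_le_app(2)[OF gr, of "{}" 0] hom_self_nonempty[of ?M] by (auto simp: carrier)
  ultimately show "affapp ?M = 1" by simp
qed

lemma (in group) order_1:
  assumes "order G = 1"
  shows "G \<cong> singleton_group ()"
proof -
  obtain x where "carrier G = {x}" using assms card_1_singletonE unfolding order_def by blast
  then have carrier: "carrier G = {\<one>}" using one_closed by auto
  have "(\<lambda>_. ()) \<in> iso G (singleton_group ())"
    by (auto simp: iso_def hom_def bij_betw_def carrier singleton_group_def)
  then show ?thesis by (rule is_isoI)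
qed

lemma (in group) classification_order_le_15:
  assumes fin: "finite (carrier G)" and "order G \<le> 15"
  shows "G \<cong> singleton_group () \<or> G \<cong> integer_mod_group 2 \<or> G \<cong> integer_mod_group 3
    \<or> G \<cong> integer_mod_group 4 \<or> G \<cong> integer_mod_group 2 \<times>\<times> integer_mod_group 2
    \<or> G \<cong> integer_mod_group 5 \<or> G \<cong> dihedral 3 \<or> G \<cong> integer_mod_group 6
    \<or> G \<cong> integer_mod_group 7 \<or> G \<cong> integer_mod_group 8
    \<or> G \<cong> integer_mod_group 4 \<times>\<times> integer_mod_group 2 \<or> G \<cong> dihedral 4 \<or> G \<cong> dicyclic 2
    \<or> G \<cong> integer_mod_group 2 \<times>\<times> integer_mod_group 2 \<times>\<times> integer_mod_group 2
    \<or> G \<cong> integer_mod_group 9 \<or> G \<cong> integer_mod_group 3 \<times>\<times> integer_mod_group 3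
    \<or> G \<cong> dihedral 5 \<or> G \<cong> integer_mod_group 10 \<or> G \<cong> integer_mod_group 11
    \<or> G \<cong> dicyclic 3 \<or> G \<cong> integer_mod_group 12 \<or> G \<cong> alt_group 4 \<or> G \<cong> dihedral 6
    \<or> G \<cong> integer_mod_group 6 \<times>\<times> integer_mod_group 2 \<or> G \<cong> integer_mod_group 13
    \<or> G \<cong> dihedral 7 \<or> G \<cong> integer_mod_group 14 \<or> G \<cong> integer_mod_group 15"
proof -
  have alt: "G \<cong> alt_group 4" if "G \<cong> tetra"
    using iso_trans[OF that group.iso_sym[OF alt_group_is_group alt_group_4_iso_tetra]] .
  have "order G > 0" using fin order_gt_0_iff_finite by blast
  then have "order G \<in> {1, 8, 12, 15} \<or> order G \<in> {2, 3, 5, 7, 11, 13} \<or> order G \<in> {4, 9} \<or>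
      order G \<in> {6, 10, 14}"
    using assms(2) unfolding insert_iff empty_iff by arith
  then consider "order G = 1" | "order G = 8" | "order G = 12" | "order G = 15"
    | "order G \<in> {2, 3, 5, 7, 11, 13}" | p where "p \<in> {2, 3}" "order G = p * p"
    | p where "p \<in> {3, 5, 7}" "order G = 2 * p"
    by fastforce
  then show ?thesis
  proof cases
    case 1 then show ?thesis using order_1 by blast
  next
    case 2 then show ?thesis using order_8[OF fin] by blast
  next
    case 3 then show ?thesis using order_12[OF fin] alt by blast
  next
    case 4 then show ?thesis using order_15[OF fin] by blast
  next
    case 5
    moreover from 5 have "Factorial_Ring.prime (order G)" by auto
    then have "G \<cong> integer_mod_group (order G)" by (rule order_prime[OF fin])
    ultimately show ?thesis by (elim insertE emptyE) simp_all
  next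
    case 6
    then show ?thesis using order_prime_square[OF fin] by auto
  next
    case 7
    then have "Factorial_Ring.prime p" "odd p" by auto
    then have "G \<cong> integer_mod_group (2 * p) \<or> G \<cong> dihedral p" by (rule order_2p[OF fin 7(2)])
    then show ?thesis using 7(1) by auto
  qed
qed

theorem proposition5p1:
  fixes G :: "('a, 'b) monoid_scheme"
  assumes "group G" and "finite (carrier G)" and "order G \<le> 15"
  shows "(G \<cong> singleton_group ()
    \<or> G \<cong> integer_mod_group 2
    \<or> G \<cong> integer_mod_group 3
    \<or> G \<cong> integer_mod_group 4
    \<or> G \<cong> integer_mod_group 2 \<times>\<times> integer_mod_group 2
    \<or> G \<cong> integer_mod_group 5
    \<or> G \<cong> dihedral 3
    \<or> G \<cong> integer_mod_group 6
    \<or> G \<cong> integer_mod_group 7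
    \<or> G \<cong> integer_mod_group 8
    \<or> G \<cong> integer_mod_group 4 \<times>\<times> integer_mod_group 2
    \<or> G \<cong> dihedral 4
    \<or> G \<cong> dicyclic 2
    \<or> G \<cong> integer_mod_group 2 \<times>\<times> integer_mod_group 2 \<times>\<times> integer_mod_group 2
    \<or> G \<cong> integer_mod_group 9
    \<or> G \<cong> integer_mod_group 3 \<times>\<times> integer_mod_group 3
    \<or> G \<cong> dihedral 5
    \<or> G \<cong> integer_mod_group 10
    \<or> G \<cong> integer_mod_group 11
    \<or> G \<cong> dicyclic 3
    \<or> G \<cong> integer_mod_group 12
    \<or> G \<cong> alt_group 4
    \<or> G \<cong> dihedral 6
    \<or> G \<cong> integer_mod_group 6 \<times>\<times> integer_mod_group 2
    \<or> G \<cong> integer_mod_group 13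
    \<or> G \<cong> dihedral 7
    \<or> G \<cong> integer_mod_group 14
    \<or> G \<cong> integer_mod_group 15)
    \<and> (G \<cong> singleton_group () \<longrightarrow> (endapp G, affapp G) = (1, 1))
    \<and> (G \<cong> integer_mod_group 2 \<longrightarrow> (endapp G, affapp G) = (1, 2))
    \<and> (G \<cong> integer_mod_group 3 \<longrightarrow> (endapp G, affapp G) = (1, 2))
    \<and> (G \<cong> integer_mod_group 4 \<longrightarrow> (endapp G, affapp G) = (1, 2))
    \<and> (G \<cong> integer_mod_group 2 \<times>\<times> integer_mod_group 2 \<longrightarrow> (endapp G, affapp G) = (2, 3))
    \<and> (G \<cong> integer_mod_group 5 \<longrightarrow> (endapp G, affapp G) = (1, 2))
    \<and> (G \<cong> dihedral 3 \<longrightarrow> (endapp G, affapp G) = (0, 2))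
    \<and> (G \<cong> integer_mod_group 6 \<longrightarrow> (endapp G, affapp G) = (1, 2))
    \<and> (G \<cong> integer_mod_group 7 \<longrightarrow> (endapp G, affapp G) = (1, 2))
    \<and> (G \<cong> integer_mod_group 8 \<longrightarrow> (endapp G, affapp G) = (1, 2))
    \<and> (G \<cong> integer_mod_group 4 \<times>\<times> integer_mod_group 2 \<longrightarrow> (endapp G, affapp G) = (1, 2))
    \<and> (G \<cong> dihedral 4 \<longrightarrow> (endapp G, affapp G) = (1, 2))
    \<and> (G \<cong> dicyclic 2 \<longrightarrow> (endapp G, affapp G) = (1, 3))
    \<and> (G \<cong> integer_mod_group 2 \<times>\<times> integer_mod_group 2 \<times>\<times> integer_mod_group 2 \<longrightarrow> (endapp G, affapp G) = (3, 4))
    \<and> (G \<cong> integer_mod_group 9 \<longrightarrow> (endapp G, affapp G) = (1, 2))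
    \<and> (G \<cong> integer_mod_group 3 \<times>\<times> integer_mod_group 3 \<longrightarrow> (endapp G, affapp G) = (2, 3))
    \<and> (G \<cong> dihedral 5 \<longrightarrow> (endapp G, affapp G) = (0, 2))
    \<and> (G \<cong> integer_mod_group 10 \<longrightarrow> (endapp G, affapp G) = (1, 2))
    \<and> (G \<cong> integer_mod_group 11 \<longrightarrow> (endapp G, affapp G) = (1, 2))
    \<and> (G \<cong> dicyclic 3 \<longrightarrow> (endapp G, affapp G) = (0, 2))
    \<and> (G \<cong> integer_mod_group 12 \<longrightarrow> (endapp G, affapp G) = (1, 2))
    \<and> (G \<cong> alt_group 4 \<longrightarrow> (endapp G, affapp G) = (0, 3))
    \<and> (G \<cong> dihedral 6 \<longrightarrow> (endapp G, affapp G) = (1, 3))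
    \<and> (G \<cong> integer_mod_group 6 \<times>\<times> integer_mod_group 2 \<longrightarrow> (endapp G, affapp G) = (1, 3))
    \<and> (G \<cong> integer_mod_group 13 \<longrightarrow> (endapp G, affapp G) = (1, 2))
    \<and> (G \<cong> dihedral 7 \<longrightarrow> (endapp G, affapp G) = (0, 2))
    \<and> (G \<cong> integer_mod_group 14 \<longrightarrow> (endapp G, affapp G) = (1, 2))
    \<and> (G \<cong> integer_mod_group 15 \<longrightarrow> (endapp G, affapp G) = (1, 2))"
proof -
  interpret group G by fact
  note app = app_values[OF assms(1,2)]
  have "G \<cong> singleton_group () \<longrightarrow> (endapp G, affapp G) = (1, 1)"
    using app_iso[OF assms(1,2) singleton_group[of "()"]] app_singleton_group by auto
  moreover have "G \<cong> integer_mod_group 2 \<longrightarrow> (endapp G, affapp G) = (1, 2)"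
    using app[OF _ app_le_Z2] app_ge_integer_mod_group[of 2]
    by (simp add: group_integer_mod_group)
  moreover have "G \<cong> integer_mod_group 3 \<longrightarrow> (endapp G, affapp G) = (1, 2)"
    using app[OF _ app_le_Z3] app_ge_integer_mod_group[of 3]
    by (simp add: group_integer_mod_group)
  moreover have "G \<cong> integer_mod_group 4 \<longrightarrow> (endapp G, affapp G) = (1, 2)"
    using app[OF _ app_le_Z4] app_ge_integer_mod_group[of 4]
    by (simp add: group_integer_mod_group)
  moreover have "G \<cong> integer_mod_group 2 \<times>\<times> integer_mod_group 2 \<longrightarrow> (endapp G, affapp G) = (2, 3)"
    using app[OF _ app_le_Z2_Z2] app_ge_prime_square[of 2]
    by (simp add: DirProd_group)
  moreover have "G \<cong> integer_mod_group 5 \<longrightarrow> (endapp G, affapp G) = (1, 2)"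
    using app[OF _ app_le_Z5] app_ge_integer_mod_group[of 5]
    by (simp add: group_integer_mod_group)
  moreover have "G \<cong> dihedral 3 \<longrightarrow> (endapp G, affapp G) = (0, 2)"
    using app[OF _ app_le_D6] affapp_ge_dihedral[of 3]
    by (simp add: group_dihedral)
  moreover have "G \<cong> integer_mod_group 6 \<longrightarrow> (endapp G, affapp G) = (1, 2)"
    using app[OF _ app_le_Z6] app_ge_integer_mod_group[of 6]
    by (simp add: group_integer_mod_group)
  moreover have "G \<cong> integer_mod_group 7 \<longrightarrow> (endapp G, affapp G) = (1, 2)"
    using app[OF _ app_le_Z7] app_ge_integer_mod_group[of 7]
    by (simp add: group_integer_mod_group)
  moreover have "G \<cong> integer_mod_group 8 \<longrightarrow> (endapp G, affapp G) = (1, 2)"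
    using app[OF _ app_le_Z8] app_ge_integer_mod_group[of 8]
    by (simp add: group_integer_mod_group)
  moreover have "G \<cong> integer_mod_group 4 \<times>\<times> integer_mod_group 2 \<longrightarrow> (endapp G, affapp G) = (1, 2)"
    using app[OF _ app_le_Z4_Z2] app_ge_DirProd_dvd[of 4 2]
    by (simp add: DirProd_group)
  moreover have "G \<cong> dihedral 4 \<longrightarrow> (endapp G, affapp G) = (1, 2)"
    using app[OF _ app_le_D8] app_ge_dihedral_even[of 4]
    by (simp add: group_dihedral)
  moreover have "G \<cong> dicyclic 2 \<longrightarrow> (endapp G, affapp G) = (1, 3)"
    using app[OF _ app_le_Dic8] app_ge_Dic8 affapp_ge_Dic8
    by (simp add: group_dicyclic)
  moreover have "G \<cong> integer_mod_group 2 \<times>\<times> integer_mod_group 2 \<times>\<times> integer_mod_group 2 \<longrightarrow> (endapp G, affapp G) = (3, 4)"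
    using app[OF _ app_le_Z2_Z2_Z2] app_ge_Z2_Z2_Z2
    by (simp add: DirProd_group)
  moreover have "G \<cong> integer_mod_group 9 \<longrightarrow> (endapp G, affapp G) = (1, 2)"
    using app[OF _ app_le_Z9] app_ge_integer_mod_group[of 9]
    by (simp add: group_integer_mod_group)
  moreover have "G \<cong> integer_mod_group 3 \<times>\<times> integer_mod_group 3 \<longrightarrow> (endapp G, affapp G) = (2, 3)"
    using app[OF _ app_le_Z3_Z3] app_ge_prime_square[of 3]
    by (simp add: DirProd_group)
  moreover have "G \<cong> dihedral 5 \<longrightarrow> (endapp G, affapp G) = (0, 2)"
    using app[OF _ app_le_D10] affapp_ge_dihedral[of 5]
    by (simp add: group_dihedral)
  moreover have "G \<cong> integer_mod_group 10 \<longrightarrow> (endapp G, affapp G) = (1, 2)"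
    using app[OF _ app_le_Z10] app_ge_integer_mod_group[of 10]
    by (simp add: group_integer_mod_group)
  moreover have "G \<cong> integer_mod_group 11 \<longrightarrow> (endapp G, affapp G) = (1, 2)"
    using app[OF _ app_le_Z11] app_ge_integer_mod_group[of 11]
    by (simp add: group_integer_mod_group)
  moreover have "G \<cong> dicyclic 3 \<longrightarrow> (endapp G, affapp G) = (0, 2)"
    using app[OF _ app_le_Dic12] affapp_ge_dicyclic_3
    by (simp add: group_dicyclic)
  moreover have "G \<cong> integer_mod_group 12 \<longrightarrow> (endapp G, affapp G) = (1, 2)"
    using app[OF _ app_le_Z12] app_ge_integer_mod_group[of 12]
    by (simp add: group_integer_mod_group)
  moreover have "G \<cong> alt_group 4 \<longrightarrow> (endapp G, affapp G) = (0, 3)"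
    using app[OF group_tetra app_le_tetra] affapp_ge_tetra iso_trans[OF _ alt_group_4_iso_tetra]
    by auto
  moreover have "G \<cong> dihedral 6 \<longrightarrow> (endapp G, affapp G) = (1, 3)"
    using app[OF _ app_le_D12] app_ge_dihedral_even[of 6] affapp_ge_D12
    by (simp add: group_dihedral)
  moreover have "G \<cong> integer_mod_group 6 \<times>\<times> integer_mod_group 2 \<longrightarrow> (endapp G, affapp G) = (1, 3)"
    using app[OF _ app_le_Z6_Z2] app_ge_DirProd_dvd[of 6 2] affapp_ge_Z6_Z2
    by (simp add: DirProd_group)
  moreover have "G \<cong> integer_mod_group 13 \<longrightarrow> (endapp G, affapp G) = (1, 2)"
    using app[OF _ app_le_Z13] app_ge_integer_mod_group[of 13]
    by (simp add: group_integer_mod_group)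
  moreover have "G \<cong> dihedral 7 \<longrightarrow> (endapp G, affapp G) = (0, 2)"
    using app[OF _ app_le_D14] affapp_ge_dihedral[of 7]
    by (simp add: group_dihedral)
  moreover have "G \<cong> integer_mod_group 14 \<longrightarrow> (endapp G, affapp G) = (1, 2)"
    using app[OF _ app_le_Z14] app_ge_integer_mod_group[of 14]
    by (simp add: group_integer_mod_group)
  moreover have "G \<cong> integer_mod_group 15 \<longrightarrow> (endapp G, affapp G) = (1, 2)"
    using app[OF _ app_le_Z15] app_ge_integer_mod_group[of 15]
    by (simp add: group_integer_mod_group)
  moreover note classification_order_le_15[OF assms(2,3)]
  ultimately show ?thesis by (intro conjI) assumption+
qed

end
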